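(* Let $H$ be a Hopf algebra over a commutative ring $k$ with a modular pair in involution $(\delta,\sigma)$, let $A$ be a right $H$-comodule algebra, and let $Tr:A\to k$ be a $\delta$-trace which is $\sigma$-invariant. Then the map $\gamma:C_n(A)\to\widetilde H^{(\delta,\sigma)}_n$, $$\gamma(a_0\otimes\dots\otimes a_n)=\sum Tr\big(a_0a_1^{(0)}\cdots a_n^{(0)}\big)\,a_1^{(1)}\otimes\dots\otimes a_n^{(1)},$$ induces a canonical map on cyclic homology $$\gamma_*:HC_*(A)\to\widetilde{HC}_*^{(\delta,\sigma)}(H).$$
   Context: $H$ has coproduct $\Delta(h)=\sum h^{(1)}\otimes h^{(2)}$, counit $\varepsilon$, antipode $S$; $\sigma\in H$ is grouplike, $\delta:H\to k$ is a character; $S_\sigma(h)=\sigma S(h)$ and $\widetilde S_\sigma(h)=\sigma\sum\delta(h^{(2)})S(h^{(1)})$. $(\delta,\sigma)$ is a modular pair in involution if $\delta(\sigma)=1$ and $\widetilde S_\sigma^2=\mathrm{id}$. The cyclic module $\widetilde{H}^{(\delta,\sigma)}$: $\widetilde{H}^{(\delta,\sigma)}_n=H^{\otimes n}$ ($=k$ for $n=0$), with $d_0(h_1\otimes\dots\otimes h_n)=\varepsilon(h_1)h_2\otimes\dots\otimes h_n$; $d_i$ multiplies $h_i$ and $h_{i+1}$ for $1\le i\le n-1$; $d_n(h_1\otimes\dots\otimes h_n)=\delta(h_n)h_1\otimes\dots\otimes h_{n-1}$; $s_i$ ($0\le i\le n$) inserts $1$ after the $i$-th factor (in front if $i=0$);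 and $\tau_n(h_1\otimes\dots\otimes h_n)=\sum\delta(h_n^{(2)})S_\sigma(h_1^{(1)}\cdots h_n^{(1)})\otimes h_1^{(2)}\otimes\dots\otimes h_{n-1}^{(2)}$ ($\tau_0=\mathrm{id}$). Its cyclic homology (homology of the total complex of the cyclic double complex) is $\widetilde{HC}_*^{(\delta,\sigma)}(H)$. A right $H$-comodule algebra is a unital $k$-algebra $A$ with a coassociative counital right coaction $\beta:A\to A\otimes H$, $\beta(a)=\sum a^{(0)}\otimes a^{(1)}$, which is an algebra map. A linear map $Tr:A\to k$ is a $\delta$-trace if $Tr(ab)=\sum Tr(b\,a^{(0)})\delta(a^{(1)})$ for all $a,b\in A$. It is $\sigma$-invariant if for all $a,b\in A$, $\sum Tr(a^{(0)}b)\,a^{(1)}=\sum Tr(a\,b^{(0)})\,S_\sigma(b^{(1)})$, equivalently $\sum Tr(a^{(0)})a^{(1)}=Tr(a)\sigma$ for all $a$. $C_*(A)$ is the usual cyclic module of the algebra $A$ ($C_n(A)=A^{\otimes(n+1)}$, with $d_n(a_0\otimes\dots\otimes a_n)=a_na_0\otimes\dots\otimes a_{n-1}$ and $\tau_n(a_0\otimes\dots\otimes a_n)=a_n\otimes a_0\otimes\dots\otimes a_{n-1}$), and $HC_*(A)$ is its cyclic homology. *)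

theory Defs
  imports Complex_Main "HOL-Library.Poly_Mapping" "HOL-Library.FuncSet"
begin

text \<open>
  The ground ring is a type \<open>'k\<close> of class \<open>comm_ring_1\<close>.  The algebras \<open>H\<close> and \<open>A\<close> are types of
  sort \<open>{ring, monoid_mult}\<close> (associative unital rings in which \<open>0 = 1\<close> is not excluded) with a
  scalar multiplication.  Tensor products and homology groups are sets of cosets, which depend on
  the scalar multiplication and hence do not form types; for them the module structure is kept in
  a record.
\<close>

record ('k, 'm) kmod =
  mcar :: "'m set"
  madd :: "'m \<Rightarrow> 'm \<Rightarrow> 'm"
  mzero :: 'm
  msmult :: "'k \<Rightarrow> 'm \<Rightarrow> 'm"

definition kmod_of :: "('k::comm_ring_1 \<Rightarrow> 'm::ab_group_add \<Rightarrow> 'm) \<Rightarrow> ('k, 'm) kmod" where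
  "kmod_of scale = \<lparr>mcar = UNIV, madd = (+), mzero = 0, msmult = scale\<rparr>"

definition msum :: "('k, 'm) kmod \<Rightarrow> 'm list \<Rightarrow> 'm" where
  "msum M xs = foldr (madd M) xs (mzero M)"

definition mdiff :: "('k::comm_ring_1, 'm) kmod \<Rightarrow> 'm \<Rightarrow> 'm \<Rightarrow> 'm" where
  "mdiff M x y = madd M x (msmult M (- 1) y)"

definition submod :: "'m set \<Rightarrow> ('k, 'm) kmod \<Rightarrow> bool" where
  "submod N M \<longleftrightarrow> N \<subseteq> mcar M \<and> mzero M \<in> N \<and> (\<forall>x\<in>N. \<forall>y\<in>N. madd M x y \<in> N)
     \<and> (\<forall>c. \<forall>x\<in>N. msmult M c x \<in> N)"

definition mspan :: "('k, 'm) kmod \<Rightarrow> 'm set \<Rightarrow> 'm set" where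
  "mspan M G = \<Inter>{N. submod N M \<and> G \<subseteq> N}"

definition mcoset :: "('k, 'm) kmod \<Rightarrow> 'm set \<Rightarrow> 'm \<Rightarrow> 'm set" where
  "mcoset M N x = {madd M x z |z. z \<in> N}"

definition mquot :: "('k, 'm) kmod \<Rightarrow> 'm set \<Rightarrow> ('k, 'm set) kmod" where
  "mquot M N = \<lparr>mcar = mcoset M N ` mcar M,
     madd = (\<lambda>X Y. {madd M x y |x y. x \<in> X \<and> y \<in> Y}),
     mzero = N,
     msmult = (\<lambda>c X. {madd M (msmult M c x) z |x z. x \<in> X \<and> z \<in> N})\<rparr>"

text \<open>Linear maps are extensional, so that uniqueness is meaningful.\<close>

definition lin_maps :: "('k, 'm) kmod \<Rightarrow> ('k, 'n) kmod \<Rightarrow> ('m \<Rightarrow> 'n) set" where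
  "lin_maps M N = {f \<in> mcar M \<rightarrow>\<^sub>E mcar N.
     (\<forall>x\<in>mcar M. \<forall>y\<in>mcar M. f (madd M x y) = madd N (f x) (f y)) \<and>
     (\<forall>c. \<forall>x\<in>mcar M. f (msmult M c x) = msmult N c (f x))}"

definition free_mod :: "'x set \<Rightarrow> ('k::comm_ring_1, 'x \<Rightarrow>\<^sub>0 'k) kmod" where
  "free_mod X = \<lparr>mcar = {p. Poly_Mapping.keys p \<subseteq> X}, madd = (+), mzero = 0,
     msmult = (\<lambda>c. Poly_Mapping.map ((*) c))\<rparr>"

abbreviation gen :: "'x \<Rightarrow> ('x \<Rightarrow>\<^sub>0 'k::comm_ring_1)" where
  "gen x \<equiv> Poly_Mapping.single x 1"

text \<open>The elements which must vanish for \<open>gen \<circ> \<phi>\<close> to become linear; the parameter \<open>\<phi>\<close> fills one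
  tensor slot and keeps the others fixed.\<close>

definition slot_rels :: "('k::comm_ring_1, 'm) kmod \<Rightarrow> ('m \<Rightarrow> 'x) \<Rightarrow> ('x \<Rightarrow>\<^sub>0 'k) set" where
  "slot_rels M \<phi> =
     {gen (\<phi> (madd M x y)) - gen (\<phi> x) - gen (\<phi> y) |x y. x \<in> mcar M \<and> y \<in> mcar M} \<union>
     {gen (\<phi> (msmult M c x)) - Poly_Mapping.single (\<phi> x) c |c x. x \<in> mcar M}"

definition tensor_rels :: "('k::comm_ring_1, 'm) kmod \<Rightarrow> ('k, 'n) kmod \<Rightarrow> ('m \<times> 'n \<Rightarrow>\<^sub>0 'k) set" where
  "tensor_rels M N = mspan (free_mod (mcar M \<times> mcar N))
     ((\<Union>y\<in>mcar N. slot_rels M (\<lambda>x. (x, y))) \<union> (\<Union>x\<in>mcar M. slot_rels N (\<lambda>y. (x, y))))"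

definition tensor :: "('k::comm_ring_1, 'm) kmod \<Rightarrow> ('k, 'n) kmod \<Rightarrow> ('k, ('m \<times> 'n \<Rightarrow>\<^sub>0 'k) set) kmod" where
  "tensor M N = mquot (free_mod (mcar M \<times> mcar N)) (tensor_rels M N)"

definition tens :: "('k::comm_ring_1, 'm) kmod \<Rightarrow> ('k, 'n) kmod \<Rightarrow> 'm \<Rightarrow> 'n \<Rightarrow> ('m \<times> 'n \<Rightarrow>\<^sub>0 'k) set" where
  "tens M N x y = mcoset (free_mod (mcar M \<times> mcar N)) (tensor_rels M N) (gen (x, y))"

text \<open>Sweedler notation: a chosen list of pairs \<open>(x\<^sub>i, y\<^sub>i)\<close> with \<open>t = \<Sum>\<^sub>i x\<^sub>i \<otimes> y\<^sub>i\<close>.  It is only used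
  inside expressions that are bilinear in the pair, whose value does not depend on the choice.\<close>

definition sweedler :: "('k::comm_ring_1, 'm) kmod \<Rightarrow> ('k, 'n) kmod \<Rightarrow> ('m \<times> 'n \<Rightarrow>\<^sub>0 'k) set \<Rightarrow> ('m \<times> 'n) list" where
  "sweedler M N t = (SOME ps. set ps \<subseteq> mcar M \<times> mcar N \<and>
     msum (tensor M N) (map (\<lambda>(x, y). tens M N x y) ps) = t)"

text \<open>The \<open>n\<close>-th tensor power, generated by the lists of length \<open>n\<close>.  For \<open>n = 0\<close> there are no
  relations and it is free of rank one on the empty list, i.e. the ground ring.\<close>

definition tpow_gens :: "('k, 'm) kmod \<Rightarrow> nat \<Rightarrow> 'm list set" where
  "tpow_gens M n = {xs. length xs = n \<and> set xs \<subseteq> mcar M}"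

definition tpow_rels :: "('k::comm_ring_1, 'm) kmod \<Rightarrow> nat \<Rightarrow> ('m list \<Rightarrow>\<^sub>0 'k) set" where
  "tpow_rels M n = mspan (free_mod (tpow_gens M n))
     (\<Union>{slot_rels M (\<lambda>x. us @ x # vs) |us vs.
          length us + length vs + 1 = n \<and> set us \<subseteq> mcar M \<and> set vs \<subseteq> mcar M})"

definition tpow :: "('k::comm_ring_1, 'm) kmod \<Rightarrow> nat \<Rightarrow> ('k, ('m list \<Rightarrow>\<^sub>0 'k) set) kmod" where
  "tpow M n = mquot (free_mod (tpow_gens M n)) (tpow_rels M n)"

definition pure :: "('k::comm_ring_1, 'm) kmod \<Rightarrow> 'm list \<Rightarrow> ('m list \<Rightarrow>\<^sub>0 'k) set" where
  "pure M xs = mcoset (free_mod (tpow_gens M (length xs))) (tpow_rels M (length xs)) (gen xs)"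

text \<open>The linear map on the \<open>n\<close>-th tensor power with prescribed values on pure tensors.\<close>

definition tlift :: "('k::comm_ring_1, 'm) kmod \<Rightarrow> nat \<Rightarrow> ('k, 'n) kmod \<Rightarrow> ('m list \<Rightarrow> 'n)
    \<Rightarrow> ('m list \<Rightarrow>\<^sub>0 'k) set \<Rightarrow> 'n" where
  "tlift M n N f = (THE g. g \<in> lin_maps (tpow M n) N \<and> (\<forall>xs\<in>tpow_gens M n. g (pure M xs) = f xs))"

locale k_algebra = module scale
  for scale :: "'k::comm_ring_1 \<Rightarrow> 'a::{ring,monoid_mult} \<Rightarrow> 'a" +
  assumes scale_mult_left: "scale c x * y = scale c (x * y)"
    and scale_mult_right: "x * scale c y = scale c (x * y)"

definition character :: "('k::comm_ring_1 \<Rightarrow> 'h::{ring,monoid_mult} \<Rightarrow> 'h) \<Rightarrow> ('h \<Rightarrow> 'k) \<Rightarrow> bool" where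
  "character scale \<chi> \<longleftrightarrow> module_hom scale (*) \<chi> \<and> \<chi> 1 = 1 \<and> (\<forall>x y. \<chi> (x * y) = \<chi> x * \<chi> y)"

text \<open>A map \<open>\<beta> : A \<rightarrow> A \<otimes> H\<close>, where \<open>A \<otimes> H\<close> carries the algebra structure
  \<open>(x \<otimes> u) (y \<otimes> v) = x y \<otimes> u v\<close>.\<close>

definition tensor_algebra_map ::
  "('k::comm_ring_1 \<Rightarrow> 'a::{ring,monoid_mult} \<Rightarrow> 'a) \<Rightarrow> ('k \<Rightarrow> 'h::{ring,monoid_mult} \<Rightarrow> 'h)
    \<Rightarrow> ('a \<Rightarrow> ('a \<times> 'h \<Rightarrow>\<^sub>0 'k) set) \<Rightarrow> bool" where
  "tensor_algebra_map sA sH \<beta> \<longleftrightarrow> (let A = kmod_of sA; H = kmod_of sH in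
     \<beta> \<in> lin_maps A (tensor A H) \<and>
     \<beta> 1 = tens A H 1 1 \<and>
     (\<forall>a b. \<beta> (a * b) = msum (tensor A H)
        [tens A H (x * y) (u * v). (x, u) \<leftarrow> sweedler A H (\<beta> a), (y, v) \<leftarrow> sweedler A H (\<beta> b)]))"

text \<open>\<open>(\<beta> \<otimes> id) \<circ> \<beta> = (id \<otimes> \<Delta>) \<circ> \<beta>\<close> and \<open>(id \<otimes> \<epsilon>) \<circ> \<beta> = id\<close>.  The first equation is written in
  \<open>(A \<otimes> H) \<otimes> H\<close>, i.e. \<open>x \<otimes> (v \<otimes> w)\<close> is rebracketed to \<open>(x \<otimes> v) \<otimes> w\<close>.\<close>

definition coassociative ::
  "('k::comm_ring_1 \<Rightarrow> 'a::ab_group_add \<Rightarrow> 'a) \<Rightarrow> ('k \<Rightarrow> 'h::ab_group_add \<Rightarrow> 'h)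
    \<Rightarrow> ('h \<Rightarrow> ('h \<times> 'h \<Rightarrow>\<^sub>0 'k) set) \<Rightarrow> ('a \<Rightarrow> ('a \<times> 'h \<Rightarrow>\<^sub>0 'k) set) \<Rightarrow> bool" where
  "coassociative sA sH \<Delta> \<beta> \<longleftrightarrow> (let A = kmod_of sA; H = kmod_of sH; AH = tensor A H in
     \<forall>a. msum (tensor AH H) [tens AH H (\<beta> x) u. (x, u) \<leftarrow> sweedler A H (\<beta> a)]
       = msum (tensor AH H) [tens AH H (tens A H x v) w.
           (x, u) \<leftarrow> sweedler A H (\<beta> a), (v, w) \<leftarrow> sweedler H H (\<Delta> u)])"

definition right_counital ::
  "('k::comm_ring_1 \<Rightarrow> 'a::ab_group_add \<Rightarrow> 'a) \<Rightarrow> ('k \<Rightarrow> 'h::ab_group_add \<Rightarrow> 'h)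
    \<Rightarrow> ('h \<Rightarrow> 'k) \<Rightarrow> ('a \<Rightarrow> ('a \<times> 'h \<Rightarrow>\<^sub>0 'k) set) \<Rightarrow> bool" where
  "right_counital sA sH \<epsilon> \<beta> \<longleftrightarrow>
     (\<forall>a. (\<Sum>(x, u)\<leftarrow>sweedler (kmod_of sA) (kmod_of sH) (\<beta> a). sA (\<epsilon> u) x) = a)"

locale hopf_algebra = k_algebra scale
  for scale :: "'k::comm_ring_1 \<Rightarrow> 'h::{ring,monoid_mult} \<Rightarrow> 'h" +
  fixes \<Delta> :: "'h \<Rightarrow> ('h \<times> 'h \<Rightarrow>\<^sub>0 'k) set"
    and \<epsilon> :: "'h \<Rightarrow> 'k"
    and S :: "'h \<Rightarrow> 'h"
  assumes comult_algebra_map: "tensor_algebra_map scale scale \<Delta>"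
    and comult_coassoc: "coassociative scale scale \<Delta> \<Delta>"
    and counit_character: "character scale \<epsilon>"
    and counit_right: "right_counital scale scale \<epsilon> \<Delta>"
    and counit_left: "(\<Sum>(x, y)\<leftarrow>sweedler (kmod_of scale) (kmod_of scale) (\<Delta> h). scale (\<epsilon> x) y) = h"
    and antipode_linear: "module_hom scale scale S"
    and antipode_left:
      "(\<Sum>(x, y)\<leftarrow>sweedler (kmod_of scale) (kmod_of scale) (\<Delta> h). S x * y) = scale (\<epsilon> h) 1"
    and antipode_right:
      "(\<Sum>(x, y)\<leftarrow>sweedler (kmod_of scale) (kmod_of scale) (\<Delta> h). x * S y) = scale (\<epsilon> h) 1"

definition grouplike ::
  "('k::comm_ring_1 \<Rightarrow> 'h::ab_group_add \<Rightarrow> 'h) \<Rightarrow> ('h \<Rightarrow> ('h \<times> 'h \<Rightarrow>\<^sub>0 'k) set) \<Rightarrow> ('h \<Rightarrow> 'k) \<Rightarrow> 'h \<Rightarrow> bool" where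
  "grouplike scale \<Delta> \<epsilon> \<sigma> \<longleftrightarrow> \<Delta> \<sigma> = tens (kmod_of scale) (kmod_of scale) \<sigma> \<sigma> \<and> \<epsilon> \<sigma> = 1"

definition S_sigma :: "('h::{ring,monoid_mult} \<Rightarrow> 'h) \<Rightarrow> 'h \<Rightarrow> 'h \<Rightarrow> 'h" where
  "S_sigma S \<sigma> h = \<sigma> * S h"

definition S_tilde ::
  "('k::comm_ring_1 \<Rightarrow> 'h::{ring,monoid_mult} \<Rightarrow> 'h) \<Rightarrow> ('h \<Rightarrow> ('h \<times> 'h \<Rightarrow>\<^sub>0 'k) set) \<Rightarrow> ('h \<Rightarrow> 'h)
    \<Rightarrow> ('h \<Rightarrow> 'k) \<Rightarrow> 'h \<Rightarrow> 'h \<Rightarrow> 'h" where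
  "S_tilde scale \<Delta> S \<delta> \<sigma> h =
     \<sigma> * (\<Sum>(x, y)\<leftarrow>sweedler (kmod_of scale) (kmod_of scale) (\<Delta> h). scale (\<delta> y) (S x))"

definition modular_pair_in_involution ::
  "('k::comm_ring_1 \<Rightarrow> 'h::{ring,monoid_mult} \<Rightarrow> 'h) \<Rightarrow> ('h \<Rightarrow> ('h \<times> 'h \<Rightarrow>\<^sub>0 'k) set) \<Rightarrow> ('h \<Rightarrow> 'k)
    \<Rightarrow> ('h \<Rightarrow> 'h) \<Rightarrow> ('h \<Rightarrow> 'k) \<Rightarrow> 'h \<Rightarrow> bool" where
  "modular_pair_in_involution scale \<Delta> \<epsilon> S \<delta> \<sigma> \<longleftrightarrow>
     character scale \<delta> \<and> grouplike scale \<Delta> \<epsilon> \<sigma> \<and> \<delta> \<sigma> = 1 \<and>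
     S_tilde scale \<Delta> S \<delta> \<sigma> \<circ> S_tilde scale \<Delta> S \<delta> \<sigma> = id"

locale comodule_algebra = k_algebra sA
  for sA :: "'k::comm_ring_1 \<Rightarrow> 'a::{ring,monoid_mult} \<Rightarrow> 'a" +
  fixes sH :: "'k \<Rightarrow> 'h::{ring,monoid_mult} \<Rightarrow> 'h"
    and \<Delta> :: "'h \<Rightarrow> ('h \<times> 'h \<Rightarrow>\<^sub>0 'k) set"
    and \<epsilon> :: "'h \<Rightarrow> 'k"
    and \<beta> :: "'a \<Rightarrow> ('a \<times> 'h \<Rightarrow>\<^sub>0 'k) set"
  assumes coaction_algebra_map: "tensor_algebra_map sA sH \<beta>"
    and coaction_coassoc: "coassociative sA sH \<Delta> \<beta>"
    and coaction_counit: "right_counital sA sH \<epsilon> \<beta>"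

definition delta_trace ::
  "('k::comm_ring_1 \<Rightarrow> 'a::{ring,monoid_mult} \<Rightarrow> 'a) \<Rightarrow> ('k \<Rightarrow> 'h::{ring,monoid_mult} \<Rightarrow> 'h)
    \<Rightarrow> ('a \<Rightarrow> ('a \<times> 'h \<Rightarrow>\<^sub>0 'k) set) \<Rightarrow> ('h \<Rightarrow> 'k) \<Rightarrow> ('a \<Rightarrow> 'k) \<Rightarrow> bool" where
  "delta_trace sA sH \<beta> \<delta> Tr \<longleftrightarrow> module_hom sA (*) Tr \<and>
     (\<forall>a b. Tr (a * b) = (\<Sum>(x, u)\<leftarrow>sweedler (kmod_of sA) (kmod_of sH) (\<beta> a). Tr (b * x) * \<delta> u))"

definition sigma_invariant ::
  "('k::comm_ring_1 \<Rightarrow> 'a::{ring,monoid_mult} \<Rightarrow> 'a) \<Rightarrow> ('k \<Rightarrow> 'h::{ring,monoid_mult} \<Rightarrow> 'h)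
    \<Rightarrow> ('a \<Rightarrow> ('a \<times> 'h \<Rightarrow>\<^sub>0 'k) set) \<Rightarrow> ('h \<Rightarrow> 'h) \<Rightarrow> 'h \<Rightarrow> ('a \<Rightarrow> 'k) \<Rightarrow> bool" where
  "sigma_invariant sA sH \<beta> S \<sigma> Tr \<longleftrightarrow>
     (\<forall>a b. (\<Sum>(x, u)\<leftarrow>sweedler (kmod_of sA) (kmod_of sH) (\<beta> a). sH (Tr (x * b)) u)
          = (\<Sum>(y, v)\<leftarrow>sweedler (kmod_of sA) (kmod_of sH) (\<beta> b). sH (Tr (a * y)) (S_sigma S \<sigma> v)))"

text \<open>\<open>face C n i\<close> is \<open>d\<^sub>i : C\<^sub>n \<rightarrow> C\<^sub>n\<^sub>-\<^sub>1\<close> (relevant for \<open>n \<ge> 1\<close>, \<open>i \<le> n\<close>), \<open>degen C n i\<close> is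
  \<open>s\<^sub>i : C\<^sub>n \<rightarrow> C\<^sub>n\<^sub>+\<^sub>1\<close> (\<open>i \<le> n\<close>), and \<open>cyc C n\<close> is \<open>\<tau>\<^sub>n\<close> (without sign).\<close>

record ('k, 'm) cyclic_data =
  obj :: "nat \<Rightarrow> ('k, 'm) kmod"
  face :: "nat \<Rightarrow> nat \<Rightarrow> 'm \<Rightarrow> 'm"
  degen :: "nat \<Rightarrow> nat \<Rightarrow> 'm \<Rightarrow> 'm"
  cyc :: "nat \<Rightarrow> 'm \<Rightarrow> 'm"

definition hoch_b :: "('k::comm_ring_1, 'm) cyclic_data \<Rightarrow> nat \<Rightarrow> 'm \<Rightarrow> 'm" where
  "hoch_b C n x = msum (obj C (n - 1)) [msmult (obj C (n - 1)) ((- 1) ^ i) (face C n i x). i \<leftarrow> [0..<Suc n]]"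

definition hoch_b' :: "('k::comm_ring_1, 'm) cyclic_data \<Rightarrow> nat \<Rightarrow> 'm \<Rightarrow> 'm" where
  "hoch_b' C n x = msum (obj C (n - 1)) [msmult (obj C (n - 1)) ((- 1) ^ i) (face C n i x). i \<leftarrow> [0..<n]]"

definition cyc_t :: "('k::comm_ring_1, 'm) cyclic_data \<Rightarrow> nat \<Rightarrow> 'm \<Rightarrow> 'm" where
  "cyc_t C n x = msmult (obj C n) ((- 1) ^ n) (cyc C n x)"

definition cyc_norm :: "('k::comm_ring_1, 'm) cyclic_data \<Rightarrow> nat \<Rightarrow> 'm \<Rightarrow> 'm" where
  "cyc_norm C n x = msum (obj C n) [(cyc_t C n ^^ i) x. i \<leftarrow> [0..<Suc n]]"

text \<open>The cyclic double complex has \<open>C\<^sub>q\<close> in bidegree \<open>(p, q)\<close>, \<open>p, q \<ge> 0\<close>.  Its vertical differential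
  is \<open>b\<close> in even columns and \<open>- b'\<close> in odd ones; its horizontal differential from column \<open>p + 1\<close> to
  column \<open>p\<close> is \<open>1 - t\<close> for \<open>p\<close> even and the norm for \<open>p\<close> odd.  An element of \<open>Tot\<^sub>n\<close> is a family
  \<open>(x\<^sub>q)\<close>, \<open>q \<le> n\<close>, where \<open>x\<^sub>q\<close> lies in bidegree \<open>(n - q, q)\<close>.\<close>

definition tot :: "('k, 'm) cyclic_data \<Rightarrow> nat \<Rightarrow> ('k, nat \<Rightarrow> 'm) kmod" where
  "tot C n = \<lparr>mcar = (\<Pi>\<^sub>E q\<in>{..n}. mcar (obj C q)),
     madd = (\<lambda>x y. \<lambda>q\<in>{..n}. madd (obj C q) (x q) (y q)),
     mzero = (\<lambda>q\<in>{..n}. mzero (obj C q)),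
     msmult = (\<lambda>c x. \<lambda>q\<in>{..n}. msmult (obj C q) c (x q))\<rparr>"

text \<open>\<open>tot_d C n : Tot\<^sub>n \<rightarrow> Tot\<^sub>n\<^sub>-\<^sub>1\<close> for \<open>n \<ge> 1\<close>.\<close>

definition tot_d :: "('k::comm_ring_1, 'm) cyclic_data \<Rightarrow> nat \<Rightarrow> (nat \<Rightarrow> 'm) \<Rightarrow> nat \<Rightarrow> 'm" where
  "tot_d C n x = (\<lambda>q\<in>{..n - 1}. let p = n - 1 - q in
     if even p
     then madd (obj C q) (hoch_b C (Suc q) (x (Suc q))) (mdiff (obj C q) (x q) (cyc_t C q (x q)))
     else mdiff (obj C q) (cyc_norm C q (x q)) (hoch_b' C (Suc q) (x (Suc q))))"

definition cycles :: "('k::comm_ring_1, 'm) cyclic_data \<Rightarrow> nat \<Rightarrow> (nat \<Rightarrow> 'm) set" where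
  "cycles C n = {x \<in> mcar (tot C n). n = 0 \<or> tot_d C n x = mzero (tot C (n - 1))}"

definition boundaries :: "('k::comm_ring_1, 'm) cyclic_data \<Rightarrow> nat \<Rightarrow> (nat \<Rightarrow> 'm) set" where
  "boundaries C n = tot_d C (Suc n) ` mcar (tot C (Suc n))"

definition HC :: "('k::comm_ring_1, 'm) cyclic_data \<Rightarrow> nat \<Rightarrow> ('k, (nat \<Rightarrow> 'm) set) kmod" where
  "HC C n = mquot ((tot C n)\<lparr>mcar := cycles C n\<rparr>) (boundaries C n)"

definition hclass :: "('k::comm_ring_1, 'm) cyclic_data \<Rightarrow> nat \<Rightarrow> (nat \<Rightarrow> 'm) \<Rightarrow> (nat \<Rightarrow> 'm) set" where
  "hclass C n x = mcoset (tot C n) (boundaries C n) x"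

definition tot_map :: "(nat \<Rightarrow> 'm \<Rightarrow> 'n) \<Rightarrow> nat \<Rightarrow> (nat \<Rightarrow> 'm) \<Rightarrow> nat \<Rightarrow> 'n" where
  "tot_map f n x = (\<lambda>q\<in>{..n}. f q (x q))"

definition algebra_cyclic ::
  "('k::comm_ring_1 \<Rightarrow> 'a::{ring,monoid_mult} \<Rightarrow> 'a) \<Rightarrow> ('k, ('a list \<Rightarrow>\<^sub>0 'k) set) cyclic_data" where
  "algebra_cyclic sA = (let A = kmod_of sA; C = (\<lambda>n. tpow A (Suc n)) in
     \<lparr>obj = C,
      face = (\<lambda>n i. tlift A (Suc n) (C (n - 1)) (\<lambda>as. pure A
        (if i < n then take i as @ (as ! i * as ! Suc i) # drop (i + 2) as
         else (last as * hd as) # butlast (tl as)))),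
      degen = (\<lambda>n i. tlift A (Suc n) (C (Suc n)) (\<lambda>as. pure A
        (take (Suc i) as @ 1 # drop (Suc i) as))),
      cyc = (\<lambda>n. tlift A (Suc n) (C n) (\<lambda>as. pure A (last as # butlast as)))\<rparr>)"

text \<open>The list \<open>[h\<^sub>1, \<dots>, h\<^sub>n]\<close> is indexed from \<open>0\<close>, so \<open>h\<^sub>i\<close> is \<open>hs ! (i - 1)\<close>.  In \<open>\<tau>\<^sub>n\<close>, each element
  \<open>ps\<close> of \<open>product_lists\<close> selects one summand \<open>(h\<^sub>j\<^sup>(\<^sup>1\<^sup>), h\<^sub>j\<^sup>(\<^sup>2\<^sup>))\<close> of every \<open>\<Delta> h\<^sub>j\<close>.\<close>

definition hopf_tau ::
  "('k::comm_ring_1 \<Rightarrow> 'h::{ring,monoid_mult} \<Rightarrow> 'h) \<Rightarrow> ('h \<Rightarrow> ('h \<times> 'h \<Rightarrow>\<^sub>0 'k) set)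
    \<Rightarrow> ('h \<Rightarrow> 'h) \<Rightarrow> ('h \<Rightarrow> 'k) \<Rightarrow> 'h \<Rightarrow> 'h list \<Rightarrow> ('h list \<Rightarrow>\<^sub>0 'k) set" where
  "hopf_tau sH \<Delta> S \<delta> \<sigma> hs = (let H = kmod_of sH; T = tpow H (length hs) in
     if hs = [] then pure H []
     else msum T [msmult T (\<delta> (snd (last ps)))
                    (pure H (S_sigma S \<sigma> (prod_list (map fst ps)) # butlast (map snd ps))).
                  ps \<leftarrow> product_lists (map (\<lambda>h. sweedler H H (\<Delta> h)) hs)])"

definition hopf_cyclic ::
  "('k::comm_ring_1 \<Rightarrow> 'h::{ring,monoid_mult} \<Rightarrow> 'h) \<Rightarrow> ('h \<Rightarrow> ('h \<times> 'h \<Rightarrow>\<^sub>0 'k) set) \<Rightarrow> ('h \<Rightarrow> 'k)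
    \<Rightarrow> ('h \<Rightarrow> 'h) \<Rightarrow> ('h \<Rightarrow> 'k) \<Rightarrow> 'h \<Rightarrow> ('k, ('h list \<Rightarrow>\<^sub>0 'k) set) cyclic_data" where
  "hopf_cyclic sH \<Delta> \<epsilon> S \<delta> \<sigma> = (let H = kmod_of sH; C = tpow H in
     \<lparr>obj = C,
      face = (\<lambda>n i. tlift H n (C (n - 1)) (\<lambda>hs.
        if i = 0 then msmult (C (n - 1)) (\<epsilon> (hd hs)) (pure H (tl hs))
        else if i < n then pure H (take (i - 1) hs @ (hs ! (i - 1) * hs ! i) # drop (i + 1) hs)
        else msmult (C (n - 1)) (\<delta> (last hs)) (pure H (butlast hs)))),
      degen = (\<lambda>n i. tlift H n (C (Suc n)) (\<lambda>hs. pure H (take i hs @ 1 # drop i hs))),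
      cyc = (\<lambda>n. tlift H n (C n) (hopf_tau sH \<Delta> S \<delta> \<sigma>))\<rparr>)"

definition gamma_pure ::
  "('k::comm_ring_1 \<Rightarrow> 'a::{ring,monoid_mult} \<Rightarrow> 'a) \<Rightarrow> ('k \<Rightarrow> 'h::{ring,monoid_mult} \<Rightarrow> 'h)
    \<Rightarrow> ('a \<Rightarrow> ('a \<times> 'h \<Rightarrow>\<^sub>0 'k) set) \<Rightarrow> ('a \<Rightarrow> 'k) \<Rightarrow> 'a \<Rightarrow> 'a list \<Rightarrow> ('h list \<Rightarrow>\<^sub>0 'k) set" where
  "gamma_pure sA sH \<beta> Tr a0 as = (let A = kmod_of sA; H = kmod_of sH; T = tpow H (length as) in
     msum T [msmult T (Tr (a0 * prod_list (map fst ps))) (pure H (map snd ps)).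
             ps \<leftarrow> product_lists (map (\<lambda>a. sweedler A H (\<beta> a)) as)])"

definition gamma ::
  "('k::comm_ring_1 \<Rightarrow> 'a::{ring,monoid_mult} \<Rightarrow> 'a) \<Rightarrow> ('k \<Rightarrow> 'h::{ring,monoid_mult} \<Rightarrow> 'h)
    \<Rightarrow> ('a \<Rightarrow> ('a \<times> 'h \<Rightarrow>\<^sub>0 'k) set) \<Rightarrow> ('a \<Rightarrow> 'k) \<Rightarrow> nat \<Rightarrow> ('a list \<Rightarrow>\<^sub>0 'k) set \<Rightarrow> ('h list \<Rightarrow>\<^sub>0 'k) set" where
  "gamma sA sH \<beta> Tr n = tlift (kmod_of sA) (Suc n) (tpow (kmod_of sH) n)
     (\<lambda>as. gamma_pure sA sH \<beta> Tr (hd as) (tl as))"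

end

theory Submission
  imports Defs "HOL-Algebra.FiniteProduct"
begin

text \<open>
  The map \<open>\<gamma>\<close> commutes with all faces and with the cyclic operators, hence with the differentials of
  the total complexes.  On pure tensors, \<open>d\<^sub>0\<close> is the counit axiom of the coaction, the inner faces are
  multiplicativity of the coaction, and the last face is the \<open>\<delta>\<close>-trace property.  For \<open>\<tau>\<^sub>n\<close>,
  coassociativity moves the first Sweedler components of \<open>a\<^sub>1\<^sup>(\<^sup>1\<^sup>), \<dots>, a\<^sub>n\<^sup>(\<^sup>1\<^sup>)\<close> onto the coaction of the product
  \<open>a\<^sub>1\<^sup>(\<^sup>0\<^sup>) \<cdots> a\<^sub>n\<^sup>(\<^sup>0\<^sup>)\<close>; there \<open>\<sigma>\<close>-invariance trades \<open>S\<^sub>\<sigma>\<close> for the coaction of \<open>a\<^sub>0\<close>, and the \<open>\<delta>\<close>-trace property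
  brings \<open>a\<^sub>n\<close> to the front.
\<close>

section \<open>Modules on carrier sets\<close>

text \<open>Sweedler lists are picked by \<open>SOME\<close>, so the list chosen for
  \<open>\<beta> (a * b)\<close> bears no visible relation to the lists for \<open>\<beta> a\<close>
  and \<open>\<beta> b\<close>, and an axiom that equates two tensors says nothing about the chosen
  lists. Every Sweedler expression is therefore read as the value of the linear map induced by a
  bilinear function; an axiom becomes usable by applying that map to both of its sides. The price is
  a bilinearity or multilinearity proof for each integrand. It is also paid for the operators:
  \<open>tlift\<close> is a definite description and has its prescribed values once the prescribed
  function is known to be multilinear. In the computation of \<tau>, coassociativity is used in all
  tensor factors at the same time, which forces sums over lists of elements and an induction over
  these lists. Uniqueness of the map on homology comes from the extensionality built into
  \<open>lin_maps\<close>, since every element of the homology module is the class of a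
  cycle.\<close>

locale cmodule =
  fixes M :: "('k::comm_ring_1, 'm) kmod"
  assumes add_closed [simp, intro]: "x \<in> mcar M \<Longrightarrow> y \<in> mcar M \<Longrightarrow> madd M x y \<in> mcar M"
    and zero_closed [simp, intro]: "mzero M \<in> mcar M"
    and smult_closed [simp, intro]: "x \<in> mcar M \<Longrightarrow> msmult M c x \<in> mcar M"
    and add_assoc: "x \<in> mcar M \<Longrightarrow> y \<in> mcar M \<Longrightarrow> z \<in> mcar M \<Longrightarrow>
      madd M (madd M x y) z = madd M x (madd M y z)"
    and add_commute: "x \<in> mcar M \<Longrightarrow> y \<in> mcar M \<Longrightarrow> madd M x y = madd M y x"
    and add_zero [simp]: "x \<in> mcar M \<Longrightarrow> madd M x (mzero M) = x"
    and smult_add: "x \<in> mcar M \<Longrightarrow> y \<in> mcar M \<Longrightarrow>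
      msmult M c (madd M x y) = madd M (msmult M c x) (msmult M c y)"
    and add_smult: "x \<in> mcar M \<Longrightarrow> msmult M (c + d) x = madd M (msmult M c x) (msmult M d x)"
    and smult_smult [simp]: "x \<in> mcar M \<Longrightarrow> msmult M c (msmult M d x) = msmult M (c * d) x"
    and one_smult [simp]: "x \<in> mcar M \<Longrightarrow> msmult M 1 x = x"
    and null_smult [simp]: "x \<in> mcar M \<Longrightarrow> msmult M 0 x = mzero M"
begin

lemma zero_add [simp]: "x \<in> mcar M \<Longrightarrow> madd M (mzero M) x = x"
  using add_commute add_zero zero_closed by metis

lemma add_left_commute:
  "x \<in> mcar M \<Longrightarrow> y \<in> mcar M \<Longrightarrow> z \<in> mcar M \<Longrightarrow> madd M x (madd M y z) = madd M y (madd M x z)"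
  by (metis add_assoc add_commute)

lemma smult_zero [simp]: "msmult M c (mzero M) = mzero M"
  by (metis mult_zero_right null_smult smult_smult zero_closed)

text \<open>The scalar \<open>1 + (- 1)\<close> is \<open>0\<close>, and \<open>null_smult\<close>
  sends it to \<open>mzero M\<close>. The record has no negation, so \<open>null_smult\<close> could
  not be derived by cancellation and is an axiom.\<close>

lemma right_minus [simp]: "x \<in> mcar M \<Longrightarrow> madd M x (msmult M (- 1) x) = mzero M"
  using add_smult[of x 1 "- 1"] by simp

lemma mdiff_closed [simp, intro]: "x \<in> mcar M \<Longrightarrow> y \<in> mcar M \<Longrightarrow> mdiff M x y \<in> mcar M"
  by (simp add: mdiff_def)

lemma add_minus_cancel [simp]:
  assumes "x \<in> mcar M" "y \<in> mcar M"
  shows "madd M x (madd M (msmult M (- 1) x) y) = y"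
proof -
  have "madd M x (madd M (msmult M (- 1) x) y) = madd M (madd M x (msmult M (- 1) x)) y"
    using assms by (simp add: add_assoc del: right_minus)
  then show ?thesis
    using assms by simp
qed

lemma msum_Nil [simp]: "msum M [] = mzero M"
  by (simp add: msum_def)

lemma msum_Cons [simp]: "msum M (x # xs) = madd M x (msum M xs)"
  by (simp add: msum_def)

lemma msum_closed [simp, intro]: "set xs \<subseteq> mcar M \<Longrightarrow> msum M xs \<in> mcar M"
  by (induction xs) auto

lemma msum_map_closed [simp, intro]: "(\<And>x. x \<in> set xs \<Longrightarrow> f x \<in> mcar M) \<Longrightarrow> msum M (map f xs) \<in> mcar M"
  by (rule msum_closed) auto

lemma msum_append: "set xs \<subseteq> mcar M \<Longrightarrow> set ys \<subseteq> mcar M \<Longrightarrow>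
    msum M (xs @ ys) = madd M (msum M xs) (msum M ys)"
  by (induction xs) (auto simp: add_assoc)

lemma msum_concat: "(\<And>xs. xs \<in> set xss \<Longrightarrow> set xs \<subseteq> mcar M) \<Longrightarrow>
    msum M (concat xss) = msum M (map (msum M) xss)"
  by (induction xss) (simp_all add: msum_append UN_least)

lemma msum_add:
  "(\<And>x. x \<in> set xs \<Longrightarrow> f x \<in> mcar M) \<Longrightarrow> (\<And>x. x \<in> set xs \<Longrightarrow> g x \<in> mcar M) \<Longrightarrow>
    msum M (map (\<lambda>x. madd M (f x) (g x)) xs) = madd M (msum M (map f xs)) (msum M (map g xs))"
proof (induction xs)
  case (Cons a xs)
  then have [simp]: "f a \<in> mcar M" "g a \<in> mcar M" "msum M (map f xs) \<in> mcar M" "msum M (map g xs) \<in> mcar M"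
    by simp_all
  show ?case
    using Cons by (simp add: add_assoc add_left_commute)
qed simp

lemma msum_zero [simp]: "msum M (map (\<lambda>x. mzero M) xs) = mzero M"
  by (induction xs) auto

lemma msum_swap:
  assumes "\<And>x y. x \<in> set xs \<Longrightarrow> y \<in> set ys \<Longrightarrow> f x y \<in> mcar M"
  shows "msum M (map (\<lambda>x. msum M (map (\<lambda>y. f x y) ys)) xs)
    = msum M (map (\<lambda>y. msum M (map (\<lambda>x. f x y) xs)) ys)"
  using assms
proof (induction xs)
  case (Cons a xs)
  have "msum M (map (\<lambda>y. madd M (f a y) (msum M (map (\<lambda>x. f x y) xs))) ys)
      = madd M (msum M (map (f a) ys)) (msum M (map (\<lambda>y. msum M (map (\<lambda>x. f x y) xs)) ys))"
    using Cons.prems by (intro msum_add) simp_all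
  then show ?case
    using Cons by simp
qed simp

end

text \<open>The linearity clauses of \<open>lin_maps\<close> without extensionality, so that lambda
  terms, sums and compositions qualify directly. Restriction to the carrier is added only where an
  element of \<open>lin_maps\<close> is wanted.\<close>

definition klinear :: "('k, 'm) kmod \<Rightarrow> ('k, 'n) kmod \<Rightarrow> ('m \<Rightarrow> 'n) \<Rightarrow> bool" where
  "klinear M N f \<longleftrightarrow> (\<forall>x\<in>mcar M. f x \<in> mcar N)
     \<and> (\<forall>x\<in>mcar M. \<forall>y\<in>mcar M. f (madd M x y) = madd N (f x) (f y))
     \<and> (\<forall>c. \<forall>x\<in>mcar M. f (msmult M c x) = msmult N c (f x))"

lemma lin_maps_iff: "f \<in> lin_maps M N \<longleftrightarrow> klinear M N f \<and> f \<in> extensional (mcar M)"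
  by (auto simp: lin_maps_def klinear_def PiE_def)

lemma klinearI:
  assumes "\<And>x. x \<in> mcar M \<Longrightarrow> f x \<in> mcar N"
    "\<And>x y. x \<in> mcar M \<Longrightarrow> y \<in> mcar M \<Longrightarrow> f (madd M x y) = madd N (f x) (f y)"
    "\<And>c x. x \<in> mcar M \<Longrightarrow> f (msmult M c x) = msmult N c (f x)"
  shows "klinear M N f"
  using assms by (simp add: klinear_def)

lemma klinearD:
  assumes "klinear M N f"
  shows "x \<in> mcar M \<Longrightarrow> f x \<in> mcar N"
    "x \<in> mcar M \<Longrightarrow> y \<in> mcar M \<Longrightarrow> f (madd M x y) = madd N (f x) (f y)"
    "x \<in> mcar M \<Longrightarrow> f (msmult M c x) = msmult N c (f x)"
  using assms by (simp_all add: klinear_def)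

lemma klinear_cong:
  assumes "cmodule M" "\<And>x. x \<in> mcar M \<Longrightarrow> f x = g x"
  shows "klinear M N f \<longleftrightarrow> klinear M N g"
proof -
  interpret M: cmodule M by fact
  show ?thesis
    by (simp add: klinear_def assms(2))
qed

lemma klinear_ident: "klinear M M (\<lambda>x. x)"
  by (simp add: klinear_def)

lemma klinear_comp: "klinear M N f \<Longrightarrow> klinear N P g \<Longrightarrow> klinear M P (\<lambda>x. g (f x))"
  by (simp add: klinear_def)

lemma klinear_zero:
  assumes "cmodule M" "cmodule N" "klinear M N f"
  shows "f (mzero M) = mzero N"
proof -
  interpret M: cmodule M by fact
  interpret N: cmodule N by fact
  show ?thesis
    using klinearD[OF assms(3)] M.null_smult[of "mzero M"] M.zero_closed N.null_smult by metis
qed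

lemma klinear_msum:
  assumes "cmodule M" "cmodule N" "klinear M N f" "set xs \<subseteq> mcar M"
  shows "f (msum M xs) = msum N (map f xs)"
proof -
  interpret M: cmodule M by fact
  interpret N: cmodule N by fact
  show ?thesis
    using assms(4) by (induction xs) (simp_all add: klinear_zero[OF assms(1-3)] klinearD[OF assms(3)])
qed

lemma klinear_mdiff:
  assumes "cmodule M" "klinear M N f" "x \<in> mcar M" "y \<in> mcar M"
  shows "f (mdiff M x y) = mdiff N (f x) (f y)"
proof -
  interpret M: cmodule M by fact
  show ?thesis
    using assms(3,4) by (simp add: mdiff_def klinearD[OF assms(2)])
qed

lemma klinear_add:
  assumes "cmodule N" "klinear M N f" "klinear M N g"
  shows "klinear M N (\<lambda>x. madd N (f x) (g x))"
proof -
  interpret N: cmodule N by fact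
  show ?thesis
    by (rule klinearI)
      (simp_all add: klinearD[OF assms(2)] klinearD[OF assms(3)] N.smult_add N.add_assoc N.add_left_commute)
qed

lemma klinear_const_zero: "cmodule N \<Longrightarrow> klinear M N (\<lambda>x. mzero N)"
  by (simp add: klinear_def cmodule.zero_closed cmodule.smult_zero cmodule.add_zero)

lemma klinear_smult:
  assumes "cmodule N" "klinear M N f"
  shows "klinear M N (\<lambda>x. msmult N c (f x))"
proof -
  interpret N: cmodule N by fact
  show ?thesis
    by (rule klinearI) (simp_all add: klinearD[OF assms(2)] N.smult_add mult.commute)
qed

lemma klinear_diff:
  assumes "cmodule N" "klinear M N f" "klinear M N g"
  shows "klinear M N (\<lambda>x. mdiff N (f x) (g x))"
  unfolding mdiff_def using assms by (intro klinear_add klinear_smult)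

lemma klinear_msum_map:
  assumes "cmodule N" "\<And>i. i \<in> set is \<Longrightarrow> klinear M N (f i)"
  shows "klinear M N (\<lambda>x. msum N (map (\<lambda>i. f i x) is))"
proof -
  interpret N: cmodule N by fact
  show ?thesis
    using assms(2) by (induction "is") (simp_all add: klinear_const_zero klinear_add N.cmodule_axioms)
qed

section \<open>Modules carried by a whole type, and the ground ring as a module over itself\<close>

lemma kmod_of_sel [simp]:
  "mcar (kmod_of s) = UNIV" "madd (kmod_of s) = (+)" "mzero (kmod_of s) = 0" "msmult (kmod_of s) = s"
  by (simp_all add: kmod_of_def)

lemma cmodule_kmod_of: "module s \<Longrightarrow> cmodule (kmod_of s)"
  by unfold_locales
    (auto simp: module.scale_right_distrib module.scale_left_distrib module.scale_scale module.scale_one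
      module.scale_zero_left add.assoc add.commute)

lemma module_mult: "module ((*) :: 'k::comm_ring_1 \<Rightarrow> 'k \<Rightarrow> 'k)"
  by unfold_locales (auto simp: algebra_simps)

lemma cmodule_ground: "cmodule (kmod_of ((*) :: 'k::comm_ring_1 \<Rightarrow> 'k \<Rightarrow> 'k))"
  by (simp add: cmodule_kmod_of module_mult)

lemma msum_kmod_of [simp]: "msum (kmod_of s) xs = sum_list xs"
  by (induction xs) (simp_all add: msum_def)

lemma klinear_module_hom: "module_hom s t f \<Longrightarrow> klinear (kmod_of s) (kmod_of t) f"
  by (rule klinearI) (simp_all add: module_hom.add module_hom.scale)

lemma klinear_scalar:
  assumes "cmodule P" "klinear M (kmod_of (*)) \<chi>" "p \<in> mcar P"
  shows "klinear M P (\<lambda>x. msmult P (\<chi> x) p)"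
proof -
  interpret P: cmodule P by fact
  show ?thesis
    using assms(3) by (intro klinearI) (simp_all add: klinearD[OF assms(2)] P.add_smult)
qed

section \<open>Quotients of free modules\<close>

lemma lookup_map_mult [simp]:
  "Poly_Mapping.lookup (Poly_Mapping.map ((*) c) p) x = c * Poly_Mapping.lookup p x" for c :: "'k::comm_ring_1"
  by (simp add: map.rep_eq when_def)

lemma cmodule_free: "cmodule (free_mod X)"
proof
  fix x y :: "'b \<Rightarrow>\<^sub>0 'a"
  assume "x \<in> mcar (free_mod X)" "y \<in> mcar (free_mod X)"
  then show "madd (free_mod X) x y \<in> mcar (free_mod X)"
    using Poly_Mapping.keys_add[of x y] by (auto simp: free_mod_def)
next
  fix c :: 'a and x :: "'b \<Rightarrow>\<^sub>0 'a"
  assume "x \<in> mcar (free_mod X)"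
  then show "msmult (free_mod X) c x \<in> mcar (free_mod X)"
    by (fastforce simp: free_mod_def in_keys_iff)
qed (auto simp: free_mod_def lookup_add algebra_simps intro!: poly_mapping_eqI)

lemma submod_mspan:
  assumes "cmodule M" "G \<subseteq> mcar M"
  shows "submod (mspan M G) M"
proof -
  interpret M: cmodule M by fact
  have "submod (mcar M) M"
    by (simp add: submod_def)
  then have "mspan M G \<subseteq> mcar M"
    using assms(2) by (auto simp: mspan_def)
  then show ?thesis
    by (auto simp: submod_def mspan_def)
qed

lemma mspan_superset: "G \<subseteq> mspan M G"
  by (auto simp: mspan_def)

lemma mspan_least: "submod N M \<Longrightarrow> G \<subseteq> N \<Longrightarrow> mspan M G \<subseteq> N"
  by (auto simp: mspan_def)

locale csubmodule = cmodule M for M :: "('k::comm_ring_1, 'm) kmod" +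
  fixes N :: "'m set"
  assumes sub: "submod N M"
begin

lemma sub_closed:
  "x \<in> N \<Longrightarrow> x \<in> mcar M" "mzero M \<in> N" "x \<in> N \<Longrightarrow> y \<in> N \<Longrightarrow> madd M x y \<in> N"
  "x \<in> N \<Longrightarrow> msmult M c x \<in> N"
  using sub by (auto simp: submod_def)

lemma coset_self: "x \<in> mcar M \<Longrightarrow> x \<in> mcoset M N x"
  using sub_closed(2) by (force simp: mcoset_def)

lemma coset_shift:
  assumes "x \<in> mcar M" "z \<in> N"
  shows "mcoset M N (madd M x z) = mcoset M N x"
proof (intro equalityI subsetI)
  fix w assume "w \<in> mcoset M N (madd M x z)"
  then obtain v where v: "v \<in> N" "w = madd M (madd M x z) v" by (auto simp: mcoset_def)
  then have "w = madd M x (madd M z v)" using assms sub_closed(1) by (simp add: add_assoc)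
  then show "w \<in> mcoset M N x" using sub_closed(3)[OF assms(2) v(1)] by (auto simp: mcoset_def)
next
  fix w assume "w \<in> mcoset M N x"
  then obtain v where v: "v \<in> N" "w = madd M x v" by (auto simp: mcoset_def)
  then have "w = madd M (madd M x z) (madd M (msmult M (- 1) z) v)"
    using assms sub_closed(1) by (simp add: add_assoc)
  then show "w \<in> mcoset M N (madd M x z)"
    using sub_closed(3)[OF sub_closed(4)[OF assms(2)] v(1)] by (auto simp: mcoset_def)
qed

lemma coset_eq_iff:
  assumes "x \<in> mcar M" "y \<in> mcar M"
  shows "mcoset M N x = mcoset M N y \<longleftrightarrow> (\<exists>z\<in>N. y = madd M x z)"
proof
  assume "mcoset M N x = mcoset M N y"
  then have "y \<in> mcoset M N x" using coset_self assms by blast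
  then show "\<exists>z\<in>N. y = madd M x z" by (auto simp: mcoset_def)
qed (auto simp: coset_shift assms)

lemma coset_diff_eq:
  assumes "x \<in> mcar M" "y \<in> mcar M" "mdiff M y x \<in> N"
  shows "mcoset M N x = mcoset M N y"
proof -
  have "madd M x (mdiff M y x) = y"
    using assms(1,2) by (simp add: mdiff_def add_left_commute[of x y])
  then show ?thesis
    using coset_eq_iff assms by metis
qed

lemma quot_add:
  assumes x: "x \<in> mcar M" and y: "y \<in> mcar M"
  shows "madd (mquot M N) (mcoset M N x) (mcoset M N y) = mcoset M N (madd M x y)"
proof -
  have "{madd M a b |a b. a \<in> mcoset M N x \<and> b \<in> mcoset M N y} = mcoset M N (madd M x y)"
  proof (intro equalityI subsetI)
    fix w assume "w \<in> {madd M a b |a b. a \<in> mcoset M N x \<and> b \<in> mcoset M N y}"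
    then obtain u v where uv: "u \<in> N" "v \<in> N" "w = madd M (madd M x u) (madd M y v)"
      by (auto simp: mcoset_def)
    then have "w = madd M (madd M x y) (madd M u v)"
      using x y sub_closed(1) by (simp add: add_assoc add_left_commute)
    then show "w \<in> mcoset M N (madd M x y)"
      using sub_closed(3)[OF uv(1,2)] by (auto simp: mcoset_def)
  next
    fix w assume "w \<in> mcoset M N (madd M x y)"
    then obtain v where v: "v \<in> N" "w = madd M x (madd M y v)"
      using x y sub_closed(1) by (auto simp: mcoset_def add_assoc)
    then show "w \<in> {madd M a b |a b. a \<in> mcoset M N x \<and> b \<in> mcoset M N y}"
      using coset_self[OF x] by (auto simp: mcoset_def)
  qed
  then show ?thesis by (simp add: mquot_def)
qed

lemma quot_smult:
  assumes x: "x \<in> mcar M"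
  shows "msmult (mquot M N) c (mcoset M N x) = mcoset M N (msmult M c x)"
proof -
  have "{madd M (msmult M c a) z |a z. a \<in> mcoset M N x \<and> z \<in> N} = mcoset M N (msmult M c x)"
  proof (intro equalityI subsetI)
    fix w assume "w \<in> {madd M (msmult M c a) z |a z. a \<in> mcoset M N x \<and> z \<in> N}"
    then obtain u v where uv: "u \<in> N" "v \<in> N" "w = madd M (msmult M c (madd M x u)) v"
      by (auto simp: mcoset_def)
    then have "w = madd M (msmult M c x) (madd M (msmult M c u) v)"
      using x sub_closed(1) by (simp add: add_assoc smult_add)
    then show "w \<in> mcoset M N (msmult M c x)"
      using sub_closed(3)[OF sub_closed(4)[OF uv(1)] uv(2)] by (auto simp: mcoset_def)
  next
    fix w assume "w \<in> mcoset M N (msmult M c x)"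
    then show "w \<in> {madd M (msmult M c a) z |a z. a \<in> mcoset M N x \<and> z \<in> N}"
      using coset_self[OF x] by (auto simp: mcoset_def)
  qed
  then show ?thesis by (simp add: mquot_def)
qed

lemma quot_car: "mcar (mquot M N) = mcoset M N ` mcar M"
  by (simp add: mquot_def)

lemma quot_zero: "mzero (mquot M N) = mcoset M N (mzero M)"
  using sub_closed(1) zero_add by (force simp: mquot_def mcoset_def)

lemma cmodule_quot: "cmodule (mquot M N)"
proof
  fix x y z assume "x \<in> mcar (mquot M N)" "y \<in> mcar (mquot M N)" "z \<in> mcar (mquot M N)"
  then show "madd (mquot M N) (madd (mquot M N) x y) z = madd (mquot M N) x (madd (mquot M N) y z)"
    by (auto simp: quot_car quot_add add_assoc)
qed (auto simp: quot_car quot_zero quot_add quot_smult add_commute smult_add add_smult)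

lemma klinear_coset: "klinear M (mquot M N) (mcoset M N)"
  by (rule klinearI) (simp_all add: quot_car quot_add quot_smult)

end

text \<open>Two representatives of a coset differ by an element of \<open>N\<close>, where
  \<open>E\<close> vanishes, so evaluating \<open>E\<close> at an arbitrarily chosen representative
  is well defined.\<close>

lemma (in csubmodule) quot_lift:
  assumes "cmodule P" "klinear M P E" "\<And>z. z \<in> N \<Longrightarrow> E z = mzero P"
  obtains g where "klinear (mquot M N) P g" "\<And>x. x \<in> mcar M \<Longrightarrow> g (mcoset M N x) = E x"
proof -
  interpret P: cmodule P by fact
  define g where "g c = E (SOME x. x \<in> mcar M \<and> mcoset M N x = c)" for c
  have g: "g (mcoset M N x) = E x" if x: "x \<in> mcar M" for x
  proof -
    define y where "y = (SOME y. y \<in> mcar M \<and> mcoset M N y = mcoset M N x)"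
    have "y \<in> mcar M \<and> mcoset M N y = mcoset M N x"
      unfolding y_def by (rule someI[where x = x]) (use x in auto)
    then obtain z where "z \<in> N" "y = madd M x z"
      using coset_eq_iff[of x y] x by auto
    then show ?thesis
      using x sub_closed(1) by (simp add: g_def flip: y_def) (simp add: klinearD[OF assms(2)] assms(3))
  qed
  have "klinear (mquot M N) P g"
    by (rule klinearI) (auto simp: quot_car quot_add quot_smult g klinearD[OF assms(2)])
  then show ?thesis
    using g that by blast
qed

text \<open>The linear extension of \<open>f\<close> from the free generators. Addition in
  \<open>P\<close> is a record field, so the sum over the support is a \<open>finprod\<close> in the
  commutative monoid made from that field, written multiplicatively.\<close>

definition lin_ext :: "('k::comm_ring_1, 'p) kmod \<Rightarrow> ('x \<Rightarrow> 'p) \<Rightarrow> ('x \<Rightarrow>\<^sub>0 'k) \<Rightarrow> 'p" where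
  "lin_ext P f p = finprod \<lparr>carrier = mcar P, monoid.mult = madd P, one = mzero P\<rparr>
     (\<lambda>x. msmult P (Poly_Mapping.lookup p x) (f x)) (Poly_Mapping.keys p)"

lemma
  fixes P :: "('k::comm_ring_1, 'p) kmod" and X :: "'x set"
  assumes "cmodule P" and f: "\<And>x. x \<in> X \<Longrightarrow> f x \<in> mcar P"
  shows klinear_lin_ext: "klinear (free_mod X) P (lin_ext P f)"
    and lin_ext_single: "x \<in> X \<Longrightarrow> lin_ext P f (Poly_Mapping.single x c) = msmult P c (f x)"
proof -
  interpret P: cmodule P by fact
  let ?G = "\<lparr>carrier = mcar P, monoid.mult = madd P, one = mzero P\<rparr>"
  interpret G: comm_monoid ?G
    by unfold_locales (auto simp: P.add_assoc P.add_commute P.add_left_commute)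
  let ?h = "\<lambda>p x. msmult P (Poly_Mapping.lookup p x) (f x)"
  \<comment> \<open>The supports of \<open>p\<close>, \<open>q\<close>, \<open>p + q\<close> and of
    a multiple of \<open>p\<close> differ. All sums are moved to a common finite index set, where
    the additional terms have coefficient \<open>0\<close>.\<close>
  have ext: "lin_ext P f p = finprod ?G (?h p) K"
    if "Poly_Mapping.keys p \<subseteq> K" "finite K" "K \<subseteq> X" for p K
    unfolding lin_ext_def using that f
    by (intro G.finprod_mono_neutral_cong_left) (auto simp: in_keys_iff Pi_def subset_iff)
  show "lin_ext P f (Poly_Mapping.single x c) = msmult P c (f x)" if "x \<in> X" for x c
  proof -
    have "lin_ext P f (Poly_Mapping.single x c) = finprod ?G (?h (Poly_Mapping.single x c)) {x}"
      using that by (intro ext) auto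
    also have "\<dots> = msmult P c (f x)"
      using that f by (subst G.finprod_insert) (auto simp: Pi_def)
    finally show ?thesis .
  qed
  show "klinear (free_mod X) P (lin_ext P f)"
  proof (rule klinearI)
    fix p :: "'x \<Rightarrow>\<^sub>0 'k" assume p: "p \<in> mcar (free_mod X)"
    then have pX: "Poly_Mapping.keys p \<subseteq> X" by (simp add: free_mod_def)
    then have "?h p \<in> Poly_Mapping.keys p \<rightarrow> carrier ?G" using f by auto
    from G.finprod_closed[OF this] show "lin_ext P f p \<in> mcar P" by (simp add: lin_ext_def)
    fix c
    have sub: "Poly_Mapping.keys (Poly_Mapping.map ((*) c) p) \<subseteq> Poly_Mapping.keys p"
      by (auto simp: in_keys_iff)
    have *: "finprod ?G (\<lambda>x. msmult P c (?h p x)) K = msmult P c (finprod ?G (?h p) K)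
        \<and> finprod ?G (?h p) K \<in> mcar P"
      if "finite K" "K \<subseteq> X" for K
      using that
    proof (induction K)
      case (insert a K)
      then have "?h p \<in> K \<rightarrow> carrier ?G" "(\<lambda>x. msmult P c (?h p x)) \<in> K \<rightarrow> carrier ?G"
        "f a \<in> mcar P" using f by auto
      then show ?case using insert
        by (subst (1 2 3) G.finprod_insert) (auto simp: P.smult_add)
    qed auto
    have "lin_ext P f (Poly_Mapping.map ((*) c) p)
        = finprod ?G (?h (Poly_Mapping.map ((*) c) p)) (Poly_Mapping.keys p)"
      using sub pX by (intro ext) auto
    also have "\<dots> = finprod ?G (\<lambda>x. msmult P c (?h p x)) (Poly_Mapping.keys p)"
      using f pX by (intro G.finprod_cong') (auto simp: subset_iff)
    also have "\<dots> = msmult P c (lin_ext P f p)"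
      using * pX by (simp add: lin_ext_def)
    finally show "lin_ext P f (msmult (free_mod X) c p) = msmult P c (lin_ext P f p)"
      by (simp add: free_mod_def)
    fix q :: "'x \<Rightarrow>\<^sub>0 'k" assume "q \<in> mcar (free_mod X)"
    then have qX: "Poly_Mapping.keys q \<subseteq> X" by (simp add: free_mod_def)
    let ?K = "Poly_Mapping.keys p \<union> Poly_Mapping.keys q"
    have "lin_ext P f (p + q) = finprod ?G (?h (p + q)) ?K"
      using pX qX Poly_Mapping.keys_add[of p q] by (intro ext) auto
    also have "\<dots> = finprod ?G (\<lambda>x. ?h p x \<otimes>\<^bsub>?G\<^esub> ?h q x) ?K"
      using f pX qX by (intro G.finprod_cong') (auto simp: lookup_add P.add_smult subset_iff)
    also have "\<dots> = madd P (finprod ?G (?h p) ?K) (finprod ?G (?h q) ?K)"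
      using f pX qX by (subst G.finprod_multf) (auto simp: subset_iff)
    also have "\<dots> = madd P (lin_ext P f p) (lin_ext P f q)"
      using pX qX by (subst (1 2) ext[where K = ?K]) auto
    finally show "lin_ext P f (madd (free_mod X) p q) = madd P (lin_ext P f p) (lin_ext P f q)"
      by (simp add: free_mod_def)
  qed
qed

lemma free_mod_induct [consumes 1, case_names zero add single]:
  assumes "p \<in> mcar (free_mod X)" "Q 0" "\<And>p q. Q p \<Longrightarrow> Q q \<Longrightarrow> p \<in> mcar (free_mod X) \<Longrightarrow> q \<in> mcar (free_mod X) \<Longrightarrow> Q (p + q)"
    "\<And>x c. x \<in> X \<Longrightarrow> Q (Poly_Mapping.single x c)"
  shows "Q p"
proof -
  have "Poly_Mapping.keys p \<subseteq> X \<longrightarrow> Q p"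
  proof (induction p rule: update_induct)
    case (update f a b)
    have eq: "Poly_Mapping.update a b f = f + Poly_Mapping.single a b"
      using update by (intro poly_mapping_eqI) (auto simp: lookup_update lookup_add lookup_single in_keys_iff when_def)
    have "Poly_Mapping.keys (Poly_Mapping.update a b f) = insert a (Poly_Mapping.keys f)"
      using update by (auto simp: keys_update)
    then show ?case
      using update assms(3,4) by (simp add: eq free_mod_def)
  qed (simp add: assms(2))
  then show ?thesis
    using assms(1) by (simp add: free_mod_def)
qed

lemma free_mod_sel [simp]:
  "madd (free_mod X) = (+)" "mzero (free_mod X) = 0" "msmult (free_mod X) c = Poly_Mapping.map ((*) c)"
  by (simp_all add: free_mod_def)

lemma single_free [simp]: "x \<in> X \<Longrightarrow> Poly_Mapping.single x c \<in> mcar (free_mod X)"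
  by (auto simp: free_mod_def)

lemma mdiff_free: "mdiff (free_mod X) p q = p - q"
  by (intro poly_mapping_eqI) (simp add: mdiff_def lookup_add lookup_minus)

lemma single_free_scale: "Poly_Mapping.single x c = msmult (free_mod X) c (gen x)"
  by (intro poly_mapping_eqI) (simp add: lookup_single when_def)

text \<open>A module presented by generators \<open>X\<close> and relations \<open>R\<close>. The
  binary tensor product and the tensor power are both instances, so lifting, induction and slotwise
  linearity are derived once for the two.\<close>

locale free_quot =
  fixes X :: "'x set" and R :: "('x \<Rightarrow>\<^sub>0 'k::comm_ring_1) set"
  assumes rels: "R \<subseteq> mcar (free_mod X)"
begin

abbreviation "N \<equiv> mspan (free_mod X) R"
abbreviation "Q \<equiv> mquot (free_mod X) N"
abbreviation "g x \<equiv> mcoset (free_mod X) N (gen x)"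

sublocale csubmodule "free_mod X" N
  by (intro csubmodule.intro csubmodule_axioms.intro cmodule_free submod_mspan rels)

sublocale Q: cmodule Q
  by (rule cmodule_quot)

lemma gen_closed [simp]: "x \<in> X \<Longrightarrow> g x \<in> mcar Q"
  by (simp add: quot_car)

text \<open>The elements killed by \<open>lin_ext P f\<close> form a submodule. It contains
  \<open>R\<close>, hence the span \<open>N\<close>, and \<open>quot_lift\<close> applies.\<close>

lemma lift:
  assumes "cmodule P" "\<And>x. x \<in> X \<Longrightarrow> f x \<in> mcar P" "\<And>r. r \<in> R \<Longrightarrow> lin_ext P f r = mzero P"
  obtains h where "klinear Q P h" "\<And>x. x \<in> X \<Longrightarrow> h (g x) = f x"
proof -
  interpret P: cmodule P by fact
  have E: "klinear (free_mod X) P (lin_ext P f)"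
    using assms by (intro klinear_lin_ext)
  have "submod {p \<in> mcar (free_mod X). lin_ext P f p = mzero P} (free_mod X)"
    using klinearD[OF E] klinear_zero[OF cmodule_free \<open>cmodule P\<close> E] add_closed smult_closed zero_closed
    unfolding submod_def by (simp del: free_mod_sel)
  then have "N \<subseteq> {p \<in> mcar (free_mod X). lin_ext P f p = mzero P}"
    using rels assms(3) by (intro mspan_least) auto
  then obtain h where h: "klinear Q P h" "\<And>x. x \<in> mcar (free_mod X) \<Longrightarrow> h (mcoset (free_mod X) N x) = lin_ext P f x"
    using quot_lift[OF \<open>cmodule P\<close> E] by blast
  show ?thesis
    by (rule that[OF h(1)]) (simp add: h(2) lin_ext_single[OF assms(1,2)] P.one_smult assms(2))
qed

lemma induct [consumes 1, case_names zero add smult]: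
  assumes "t \<in> mcar Q" "K (mzero Q)" "\<And>s t. K s \<Longrightarrow> K t \<Longrightarrow> s \<in> mcar Q \<Longrightarrow> t \<in> mcar Q \<Longrightarrow> K (madd Q s t)"
    "\<And>c x. x \<in> X \<Longrightarrow> K (msmult Q c (g x))"
  shows "K t"
proof -
  obtain p where p: "p \<in> mcar (free_mod X)" "t = mcoset (free_mod X) N p"
    using assms(1) by (auto simp: quot_car)
  have "K (mcoset (free_mod X) N p)"
    using p(1)
  proof (induction p rule: free_mod_induct)
    case zero
    then show ?case using assms(2) quot_zero by simp
  next
    case (add p q)
    then show ?case using assms(3) quot_add[of p q] klinearD(1)[OF klinear_coset] by (metis free_mod_sel(1))
  next
    case (single x c)
    then show ?case using assms(4)[of x c] quot_smult[of "gen x" c]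
      by (simp del: free_mod_sel flip: single_free_scale)
  qed
  then show ?thesis by (simp add: p)
qed

lemma klinear_eq:
  assumes "cmodule P" "klinear Q P h" "klinear Q P h'" "\<And>x. x \<in> X \<Longrightarrow> h (g x) = h' (g x)" "t \<in> mcar Q"
  shows "h t = h' t"
  using assms(5)
proof (induction t rule: induct)
  case zero
  show ?case
    by (simp add: klinear_zero[OF Q.cmodule_axioms assms(1,2)] klinear_zero[OF Q.cmodule_axioms assms(1,3)])
qed (simp_all add: klinearD[OF assms(2)] klinearD[OF assms(3)] assms(4))

text \<open>The two families in \<open>slot_rels\<close> are the defects of additivity and of
  homogeneity of \<open>gen (\<phi> x)\<close> in \<open>x\<close>; they vanish in the
  quotient.\<close>

lemma klinear_slot:
  assumes "cmodule M" "slot_rels M \<phi> \<subseteq> R" "\<And>x. x \<in> mcar M \<Longrightarrow> \<phi> x \<in> X"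
  shows "klinear M Q (\<lambda>x. g (\<phi> x))"
proof (rule klinearI)
  interpret M: cmodule M by fact
  have relsN: "r \<in> N" if "r \<in> slot_rels M \<phi>" for r
    using subsetD[OF mspan_superset subsetD[OF assms(2) that]] .
  fix x assume x: "x \<in> mcar M"
  then show "g (\<phi> x) \<in> mcar Q" using assms by simp
  fix c
  have "gen (\<phi> (msmult M c x)) - Poly_Mapping.single (\<phi> x) c \<in> N"
    by (rule relsN) (use x in \<open>auto simp: slot_rels_def\<close>)
  then have "mcoset (free_mod X) N (Poly_Mapping.single (\<phi> x) c) = g (\<phi> (msmult M c x))"
    using x assms(3) by (intro coset_diff_eq) (simp_all add: mdiff_free)
  then show "g (\<phi> (msmult M c x)) = msmult Q c (g (\<phi> x))"
    using x assms(3) quot_smult[of "gen (\<phi> x)" c] by (simp del: free_mod_sel flip: single_free_scale)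
  fix y assume y: "y \<in> mcar M"
  have "gen (\<phi> (madd M x y)) - gen (\<phi> x) - gen (\<phi> y) \<in> N"
    by (rule relsN) (use x y in \<open>auto simp: slot_rels_def\<close>)
  then have "mdiff (free_mod X) (gen (\<phi> (madd M x y))) (gen (\<phi> x) + gen (\<phi> y)) \<in> N"
    by (simp add: mdiff_free algebra_simps)
  then have "mcoset (free_mod X) N (gen (\<phi> x) + gen (\<phi> y)) = g (\<phi> (madd M x y))"
    using x y assms(3) add_closed by (intro coset_diff_eq) auto
  then show "g (\<phi> (madd M x y)) = madd Q (g (\<phi> x)) (g (\<phi> y))"
    using x y assms(3) quot_add[of "gen (\<phi> x)" "gen (\<phi> y)"] by simp
qed

end

lemma slot_rels_free:
  assumes "cmodule M" "\<And>x. x \<in> mcar M \<Longrightarrow> \<phi> x \<in> X"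
  shows "slot_rels M \<phi> \<subseteq> mcar (free_mod X)"
proof -
  interpret M: cmodule M by fact
  interpret F: cmodule "free_mod X" by (rule cmodule_free)
  have "gen (\<phi> (madd M x y)) - gen (\<phi> x) - gen (\<phi> y) \<in> mcar (free_mod X)"
    "gen (\<phi> (msmult M c x)) - Poly_Mapping.single (\<phi> x) c \<in> mcar (free_mod X)"
    if "x \<in> mcar M" "y \<in> mcar M" for x y c
    using that assms(2) unfolding mdiff_free[of X, symmetric]
    by (intro F.mdiff_closed single_free; simp)+
  then show ?thesis by (auto simp: slot_rels_def)
qed

text \<open>The counterpart of \<open>klinear_slot\<close>: linearity of \<open>f\<close> along
  \<open>\<phi>\<close> makes its linear extension kill the relations of that slot, which is what
  lifting to the quotient asks for.\<close>

lemma slot_rels_vanish: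
  fixes P :: "('k::comm_ring_1, 'p) kmod" and X :: "'x set"
  assumes "cmodule M" "cmodule P" "\<And>x. x \<in> mcar M \<Longrightarrow> \<phi> x \<in> X" "\<And>x. x \<in> X \<Longrightarrow> f x \<in> mcar P"
    and lin: "klinear M P (\<lambda>x. f (\<phi> x))" and r: "r \<in> slot_rels M \<phi>"
  shows "lin_ext P f r = mzero P"
proof -
  interpret M: cmodule M by fact
  interpret P: cmodule P by fact
  interpret F: cmodule "free_mod X :: ('k, _) kmod" by (rule cmodule_free)
  note E = klinear_lin_ext[OF assms(2,4), of X]
  note S = lin_ext_single[OF assms(2,4), of X]
  have diff: "lin_ext P f (p - q) = mdiff P (lin_ext P f p) (lin_ext P f q)"
    if "p \<in> mcar (free_mod X)" "q \<in> mcar (free_mod X)" for p q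
    using klinear_mdiff[OF cmodule_free E that] by (simp add: mdiff_free)
  have "lin_ext P f (gen (\<phi> (madd M x y)) - gen (\<phi> x) - gen (\<phi> y)) = mzero P"
    if "x \<in> mcar M" "y \<in> mcar M" for x y
  proof -
    have X: "\<phi> x \<in> X" "\<phi> y \<in> X" "\<phi> (madd M x y) \<in> X"
      using that by (auto intro!: assms(3))
    have P: "f (\<phi> x) \<in> mcar P" "f (\<phi> y) \<in> mcar P" "f (\<phi> (madd M x y)) \<in> mcar P"
      using X by (auto intro!: assms(4))
    have "(gen (\<phi> (madd M x y)) - gen (\<phi> x) :: _ \<Rightarrow>\<^sub>0 'k) \<in> mcar (free_mod X)"
      unfolding mdiff_free[of X, symmetric] using X by (intro F.mdiff_closed single_free)
    then have "lin_ext P f (gen (\<phi> (madd M x y)) - gen (\<phi> x) - gen (\<phi> y))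
       = mdiff P (mdiff P (f (\<phi> (madd M x y))) (f (\<phi> x))) (f (\<phi> y))"
      using X P by (simp add: diff S)
    also have "\<dots> = mzero P"
      using that P
      by (simp add: klinearD(2)[OF lin] mdiff_def P.add_assoc P.add_left_commute[of "f (\<phi> y)"])
    finally show ?thesis .
  qed
  moreover have "lin_ext P f (gen (\<phi> (msmult M c x)) - Poly_Mapping.single (\<phi> x) c) = mzero P"
    if "x \<in> mcar M" for x c
    using that assms(3,4) by (simp add: diff S klinearD[OF lin] mdiff_def flip: P.smult_smult)
  ultimately show ?thesis using r by (auto simp: slot_rels_def)
qed

section \<open>Tensor products\<close>

definition kbilinear :: "('k, 'm) kmod \<Rightarrow> ('k, 'n) kmod \<Rightarrow> ('k, 'p) kmod \<Rightarrow> ('m \<Rightarrow> 'n \<Rightarrow> 'p) \<Rightarrow> bool" where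
  "kbilinear M N P f \<longleftrightarrow> (\<forall>y\<in>mcar N. klinear M P (\<lambda>x. f x y)) \<and> (\<forall>x\<in>mcar M. klinear N P (f x))"

lemma kbilinearI:
  "(\<And>y. y \<in> mcar N \<Longrightarrow> klinear M P (\<lambda>x. f x y)) \<Longrightarrow> (\<And>x. x \<in> mcar M \<Longrightarrow> klinear N P (f x))
    \<Longrightarrow> kbilinear M N P f"
  by (simp add: kbilinear_def)

lemma kbilinear_closed: "kbilinear M N P f \<Longrightarrow> x \<in> mcar M \<Longrightarrow> y \<in> mcar N \<Longrightarrow> f x y \<in> mcar P"
  by (simp add: kbilinear_def klinear_def)

locale tensor_product = M: cmodule M + N: cmodule N
  for M :: "('k::comm_ring_1, 'm) kmod" and N :: "('k, 'n) kmod"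
begin

abbreviation "rel_gens \<equiv>
  (\<Union>y\<in>mcar N. slot_rels M (\<lambda>x. (x, y))) \<union> (\<Union>x\<in>mcar M. slot_rels N (\<lambda>y. (x, y)))"

sublocale Q: free_quot "mcar M \<times> mcar N" rel_gens
  by unfold_locales
    (intro Un_least UN_least slot_rels_free M.cmodule_axioms N.cmodule_axioms; simp)

lemma tensor_eq: "tensor M N = Q.Q"
  by (simp add: tensor_def tensor_rels_def)

lemma tens_eq: "tens M N x y = Q.g (x, y)"
  by (simp add: tens_def tensor_rels_def)

sublocale T: cmodule "tensor M N"
  unfolding tensor_eq by (rule Q.Q.cmodule_axioms)

lemma tens_closed [simp]: "x \<in> mcar M \<Longrightarrow> y \<in> mcar N \<Longrightarrow> tens M N x y \<in> mcar (tensor M N)"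
  by (simp add: tens_eq tensor_eq)

lemma kbilinear_tens: "kbilinear M N (tensor M N) (tens M N)"
proof (rule kbilinearI)
  fix y assume "y \<in> mcar N"
  then show "klinear M (tensor M N) (\<lambda>x. tens M N x y)"
    unfolding tens_eq tensor_eq by (intro Q.klinear_slot M.cmodule_axioms) auto
next
  fix x assume "x \<in> mcar M"
  then show "klinear N (tensor M N) (tens M N x)"
    unfolding tens_eq tensor_eq by (intro Q.klinear_slot N.cmodule_axioms) auto
qed

text \<open>With one argument frozen, \<open>f\<close> is linear in the other, so
  \<open>slot_rels_vanish\<close> disposes of each of the two families of relations.\<close>

lemma bilinear_lift:
  assumes P: "cmodule P" and f: "kbilinear M N P f"
  obtains h where "klinear (tensor M N) P h"
    "\<And>x y. x \<in> mcar M \<Longrightarrow> y \<in> mcar N \<Longrightarrow> h (tens M N x y) = f x y"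
proof -
  let ?f = "\<lambda>(x, y). f x y"
  have "lin_ext P ?f r = mzero P" if "r \<in> rel_gens" for r
    using that
  proof (elim UnE UN_E)
    fix y assume "y \<in> mcar N" "r \<in> slot_rels M (\<lambda>x. (x, y))"
    then show ?thesis
      using f by (intro slot_rels_vanish[OF M.cmodule_axioms P, where X = "mcar M \<times> mcar N"])
        (auto simp: kbilinear_closed[OF f], auto simp: kbilinear_def)
  next
    fix x assume "x \<in> mcar M" "r \<in> slot_rels N (\<lambda>y. (x, y))"
    then show ?thesis
      using f by (intro slot_rels_vanish[OF N.cmodule_axioms P, where X = "mcar M \<times> mcar N"])
        (auto simp: kbilinear_closed[OF f], auto simp: kbilinear_def)
  qed
  moreover have "?f p \<in> mcar P" if "p \<in> mcar M \<times> mcar N" for p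
    using kbilinear_closed[OF f] that by auto
  ultimately obtain h where "klinear Q.Q P h" "\<And>p. p \<in> mcar M \<times> mcar N \<Longrightarrow> h (Q.g p) = ?f p"
    using Q.lift[OF P, of ?f] by blast
  then show ?thesis
    using that[of h] by (simp add: tensor_eq tens_eq)
qed

lemmas tensor_induct [consumes 1, case_names zero add smult] = Q.induct[folded tensor_eq]

text \<open>Ensures that the \<open>SOME\<close> in \<open>sweedler\<close> chooses from a nonempty
  set. The list carries no coefficients: a scalar is absorbed into the left factor.\<close>

lemma tensor_decomp:
  assumes "t \<in> mcar (tensor M N)"
  shows "\<exists>ps. set ps \<subseteq> mcar M \<times> mcar N \<and> msum (tensor M N) (map (\<lambda>(x, y). tens M N x y) ps) = t"
  using assms
proof (induction t rule: tensor_induct)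
  case zero
  show ?case by (intro exI[of _ "[]"]) simp
next
  case (add s t)
  then obtain ps qs where
    ps: "set ps \<subseteq> mcar M \<times> mcar N" "msum (tensor M N) (map (\<lambda>(x, y). tens M N x y) ps) = s"
    and qs: "set qs \<subseteq> mcar M \<times> mcar N" "msum (tensor M N) (map (\<lambda>(x, y). tens M N x y) qs) = t"
    by (elim exE conjE)
  have "set (map (\<lambda>(x, y). tens M N x y) rs) \<subseteq> mcar (tensor M N)" if "set rs \<subseteq> mcar M \<times> mcar N" for rs
    using that by (auto simp: subset_iff)
  then have "msum (tensor M N) (map (\<lambda>(x, y). tens M N x y) (ps @ qs)) = madd (tensor M N) s t"
    using ps qs T.msum_append by (metis map_append)
  then show ?case
    using ps(1) qs(1) by (intro exI[of _ "ps @ qs"]) simp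
next
  case (smult c p)
  obtain x y where p: "p = (x, y)" "x \<in> mcar M" "y \<in> mcar N" using smult by auto
  have "klinear M (tensor M N) (\<lambda>x. tens M N x y)" using kbilinear_tens p by (simp add: kbilinear_def)
  from klinearD(3)[OF this p(2), of c] show ?case
    using p by (intro exI[of _ "[(msmult M c x, y)]"]) (simp flip: tens_eq)
qed

end

text \<open>The value at \<open>t\<close> of the linear map on \<open>M \<otimes> N\<close> induced by a bilinear \<open>f\<close>.\<close>

definition tsum :: "('k::comm_ring_1, 'm) kmod \<Rightarrow> ('k, 'n) kmod \<Rightarrow> ('k, 'p) kmod
    \<Rightarrow> ('m \<times> 'n \<Rightarrow>\<^sub>0 'k) set \<Rightarrow> ('m \<Rightarrow> 'n \<Rightarrow> 'p) \<Rightarrow> 'p" where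
  "tsum M N P t f = msum P (map (\<lambda>(x, y). f x y) (sweedler M N t))"

context tensor_product
begin

lemma sweedler:
  assumes "t \<in> mcar (tensor M N)"
  shows "set (sweedler M N t) \<subseteq> mcar M \<times> mcar N"
    "msum (tensor M N) (map (\<lambda>(x, y). tens M N x y) (sweedler M N t)) = t"
  using someI_ex[OF tensor_decomp[OF assms]] by (simp_all add: sweedler_def)

text \<open>Pushing the linear \<open>h\<close> through the sum of pure tensors that represents
  \<open>t\<close> leaves the sum of the \<open>f x y\<close>. Since \<open>h t\<close> depends on
  \<open>t\<close> alone, the choice made by \<open>sweedler\<close> has disappeared.\<close>

lemma tsum_lift:
  assumes P: "cmodule P" and h: "klinear (tensor M N) P h"
    "\<And>x y. x \<in> mcar M \<Longrightarrow> y \<in> mcar N \<Longrightarrow> h (tens M N x y) = f x y" and t: "t \<in> mcar (tensor M N)"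
  shows "tsum M N P t f = h t"
proof -
  note sw = sweedler[OF t]
  have "h t = msum P (map h (map (\<lambda>(x, y). tens M N x y) (sweedler M N t)))"
  proof -
    have "set (map (\<lambda>(x, y). tens M N x y) (sweedler M N t)) \<subseteq> mcar (tensor M N)"
      using sw(1) by (auto simp: subset_iff)
    from klinear_msum[OF T.cmodule_axioms P h(1) this] show ?thesis by (simp add: sw(2))
  qed
  also have "map h (map (\<lambda>(x, y). tens M N x y) (sweedler M N t)) = map (\<lambda>(x, y). f x y) (sweedler M N t)"
    using sw(1) h(2) by auto
  finally show ?thesis by (simp add: tsum_def)
qed

lemma
  assumes "cmodule P" "kbilinear M N P f"
  shows klinear_tsum: "klinear (tensor M N) P (\<lambda>t. tsum M N P t f)"
    and tsum_tens: "x \<in> mcar M \<Longrightarrow> y \<in> mcar N \<Longrightarrow> tsum M N P (tens M N x y) f = f x y"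
proof -
  obtain h where h: "klinear (tensor M N) P h"
    "\<And>x y. x \<in> mcar M \<Longrightarrow> y \<in> mcar N \<Longrightarrow> h (tens M N x y) = f x y"
    using bilinear_lift[OF assms] by metis
  show "klinear (tensor M N) P (\<lambda>t. tsum M N P t f)"
    using h(1) klinear_cong[OF T.cmodule_axioms, of "\<lambda>t. tsum M N P t f" h P]
      tsum_lift[OF assms(1) h] by simp
  show "tsum M N P (tens M N x y) f = f x y" if "x \<in> mcar M" "y \<in> mcar N"
    using tsum_lift[OF assms(1) h] that h(2) by simp
qed

text \<open>Linearity of \<open>tsum\<close> in the tensor lets an explicit decomposition replace
  the chosen one. Axioms that equate sums of pure tensors are evaluated through this.\<close>

lemma tsum_msum_tens:
  assumes "cmodule P" "kbilinear M N P f" "\<And>i. i \<in> set is \<Longrightarrow> u i \<in> mcar M" "\<And>i. i \<in> set is \<Longrightarrow> v i \<in> mcar N"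
  shows "tsum M N P (msum (tensor M N) (map (\<lambda>i. tens M N (u i) (v i)) is)) f
    = msum P (map (\<lambda>i. f (u i) (v i)) is)"
proof -
  have "set (map (\<lambda>i. tens M N (u i) (v i)) is) \<subseteq> mcar (tensor M N)"
    using assms(3,4) by auto
  from klinear_msum[OF T.cmodule_axioms assms(1) klinear_tsum[OF assms(1,2)] this]
  have "tsum M N P (msum (tensor M N) (map (\<lambda>i. tens M N (u i) (v i)) is)) f
      = msum P (map (\<lambda>i. tsum M N P (tens M N (u i) (v i)) f) is)"
    by (simp add: o_def)
  also have "map (\<lambda>i. tsum M N P (tens M N (u i) (v i)) f) is = map (\<lambda>i. f (u i) (v i)) is"
    using assms by (simp add: tsum_tens)
  finally show ?thesis .
qed

end

section \<open>Tensor powers\<close>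

text \<open>A slot is a position between a prefix \<open>us\<close> and a suffix \<open>vs\<close>,
  as in \<open>tpow_rels\<close>. Closure is a separate clause, because for \<open>n = 0\<close>
  there is no slot from which it would follow.\<close>

definition multilinear :: "('k, 'm) kmod \<Rightarrow> nat \<Rightarrow> ('k, 'p) kmod \<Rightarrow> ('m list \<Rightarrow> 'p) \<Rightarrow> bool" where
  "multilinear M n P f \<longleftrightarrow> (\<forall>xs\<in>tpow_gens M n. f xs \<in> mcar P) \<and>
     (\<forall>us vs. length us + length vs + 1 = n \<longrightarrow> set us \<subseteq> mcar M \<longrightarrow> set vs \<subseteq> mcar M \<longrightarrow>
        klinear M P (\<lambda>x. f (us @ x # vs)))"

lemma multilinear_closed: "multilinear M n P f \<Longrightarrow> xs \<in> tpow_gens M n \<Longrightarrow> f xs \<in> mcar P"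
  by (simp add: multilinear_def)

lemma multilinear_slot:
  "multilinear M n P f \<Longrightarrow> length us + length vs + 1 = n \<Longrightarrow> set us \<subseteq> mcar M \<Longrightarrow> set vs \<subseteq> mcar M \<Longrightarrow>
    klinear M P (\<lambda>x. f (us @ x # vs))"
  by (simp add: multilinear_def)

lemma multilinear_0: "multilinear M 0 P f \<longleftrightarrow> f [] \<in> mcar P"
  by (auto simp: multilinear_def tpow_gens_def)

text \<open>A slot is either the head or lies in the tail, which reduces multilinearity to an
  induction on the number of factors.\<close>

lemma multilinear_SucI:
  assumes "\<And>x. x \<in> mcar M \<Longrightarrow> multilinear M n P (\<lambda>xs. f (x # xs))"
    "\<And>xs. xs \<in> tpow_gens M n \<Longrightarrow> klinear M P (\<lambda>x. f (x # xs))"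
  shows "multilinear M (Suc n) P f"
  unfolding multilinear_def
proof (intro conjI ballI allI impI)
  fix xs assume "xs \<in> tpow_gens M (Suc n)"
  then obtain y ys where "xs = y # ys" "y \<in> mcar M" "ys \<in> tpow_gens M n"
    by (cases xs) (auto simp: tpow_gens_def)
  then show "f xs \<in> mcar P" using multilinear_closed[OF assms(1)] by blast
next
  fix us vs
  assume *: "length us + length vs + 1 = Suc n" "set us \<subseteq> mcar M" "set vs \<subseteq> mcar M"
  show "klinear M P (\<lambda>x. f (us @ x # vs))"
  proof (cases us)
    case Nil
    then show ?thesis using * assms(2)[of vs] by (simp add: tpow_gens_def)
  next
    case (Cons y ys)
    then show ?thesis using * multilinear_slot[OF assms(1)[of y], of ys vs] by simp
  qed
qed

lemma multilinear_SucD: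
  assumes "multilinear M (Suc n) P f"
  shows "x \<in> mcar M \<Longrightarrow> multilinear M n P (\<lambda>xs. f (x # xs))"
    "xs \<in> tpow_gens M n \<Longrightarrow> klinear M P (\<lambda>x. f (x # xs))"
proof -
  assume x: "x \<in> mcar M"
  show "multilinear M n P (\<lambda>xs. f (x # xs))"
    unfolding multilinear_def
  proof (intro conjI ballI allI impI)
    fix xs assume "xs \<in> tpow_gens M n"
    then show "f (x # xs) \<in> mcar P"
      using x by (intro multilinear_closed[OF assms]) (simp add: tpow_gens_def)
  next
    fix us vs
    assume "length us + length vs + 1 = n" "set us \<subseteq> mcar M" "set vs \<subseteq> mcar M"
    then show "klinear M P (\<lambda>y. f (x # us @ y # vs))"
      using x multilinear_slot[OF assms, of "x # us" vs] by simp
  qed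
next
  assume "xs \<in> tpow_gens M n"
  then show "klinear M P (\<lambda>x. f (x # xs))"
    using multilinear_slot[OF assms, of "[]" xs] by (simp add: tpow_gens_def)
qed

lemma multilinear_msum_map:
  assumes "cmodule P" "\<And>i. i \<in> set is \<Longrightarrow> multilinear M n P (f i)"
  shows "multilinear M n P (\<lambda>xs. msum P (map (\<lambda>i. f i xs) is))"
proof -
  interpret P: cmodule P by fact
  show ?thesis
    unfolding multilinear_def using multilinear_closed[OF assms(2)]
    by (auto intro!: P.msum_map_closed klinear_msum_map[OF assms(1)] multilinear_slot[OF assms(2)])
qed

lemma multilinear_comp:
  assumes "multilinear M n P f" "klinear P P' h"
  shows "multilinear M n P' (\<lambda>xs. h (f xs))"
  unfolding multilinear_def
  by (intro conjI ballI allI impI klinearD(1)[OF assms(2)] multilinear_closed[OF assms(1)]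
      klinear_comp[OF multilinear_slot[OF assms(1)] assms(2)])

lemma multilinear_scalar:
  assumes "cmodule P" "multilinear M n (kmod_of (*)) \<chi>" "p \<in> mcar P"
  shows "multilinear M n P (\<lambda>xs. msmult P (\<chi> xs) p)"
  by (rule multilinear_comp[OF assms(2) klinear_scalar[OF assms(1) klinear_ident assms(3)]])

text \<open>With all other entries fixed, the varying entry must reach exactly one output slot,
  through a linear map \<open>\<phi>\<close>. The new prefix, the new suffix and
  \<open>\<phi>\<close> may depend on the fixed entries; this covers products of neighbouring
  entries.\<close>

lemma multilinear_reshape:
  assumes f: "multilinear M m P f"
    and r: "\<And>xs. xs \<in> tpow_gens M n \<Longrightarrow> r xs \<in> tpow_gens M m"
    and slot: "\<And>us vs. length us + length vs + 1 = n \<Longrightarrow> set us \<subseteq> mcar M \<Longrightarrow> set vs \<subseteq> mcar M \<Longrightarrow>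
      \<exists>us' vs' \<phi>. length us' + length vs' + 1 = m \<and> set us' \<subseteq> mcar M \<and> set vs' \<subseteq> mcar M \<and>
        klinear M M \<phi> \<and> (\<forall>x. r (us @ x # vs) = us' @ \<phi> x # vs')"
  shows "multilinear M n P (\<lambda>xs. f (r xs))"
  unfolding multilinear_def
proof (intro conjI ballI allI impI)
  fix us vs
  assume "length us + length vs + 1 = n" "set us \<subseteq> mcar M" "set vs \<subseteq> mcar M"
  then obtain us' vs' \<phi> where *: "length us' + length vs' + 1 = m" "set us' \<subseteq> mcar M" "set vs' \<subseteq> mcar M"
    and "klinear M M \<phi>" "\<And>x. r (us @ x # vs) = us' @ \<phi> x # vs'"
    using slot[of us vs] by auto
  then show "klinear M P (\<lambda>x. f (r (us @ x # vs)))"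
    using klinear_comp[OF _ multilinear_slot[OF f *], of M \<phi>] by simp
qed (use multilinear_closed[OF f] r in auto)

locale tensor_power = cmodule M for M :: "('k::comm_ring_1, 'm) kmod" +
  fixes n :: nat
begin

abbreviation "rel_gens \<equiv> \<Union>{slot_rels M (\<lambda>x. us @ x # vs) |us vs.
  length us + length vs + 1 = n \<and> set us \<subseteq> mcar M \<and> set vs \<subseteq> mcar M}"

sublocale Q: free_quot "tpow_gens M n" rel_gens
proof unfold_locales
  have "slot_rels M (\<lambda>x. us @ x # vs) \<subseteq> mcar (free_mod (tpow_gens M n))"
    if "length us + length vs + 1 = n" "set us \<subseteq> mcar M" "set vs \<subseteq> mcar M" for us vs
    using that by (intro slot_rels_free cmodule_axioms) (auto simp: tpow_gens_def)
  then show "rel_gens \<subseteq> mcar (free_mod (tpow_gens M n))"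
    by auto
qed

lemma tpow_eq: "tpow M n = Q.Q"
  by (simp add: tpow_def tpow_rels_def)

lemma pure_eq: "length xs = n \<Longrightarrow> pure M xs = Q.g xs"
  by (simp add: pure_def tpow_rels_def)

sublocale T: cmodule "tpow M n"
  unfolding tpow_eq by (rule Q.Q.cmodule_axioms)

lemma pure_closed: "xs \<in> tpow_gens M n \<Longrightarrow> pure M xs \<in> mcar (tpow M n)"
  using Q.gen_closed[of xs] pure_eq[of xs] by (simp add: tpow_eq) (simp add: tpow_gens_def)

lemma multilinear_pure: "multilinear M n (tpow M n) (pure M)"
  unfolding multilinear_def
proof (intro conjI ballI allI impI)
  fix us vs
  assume *: "length us + length vs + 1 = n" "set us \<subseteq> mcar M" "set vs \<subseteq> mcar M"
  have "klinear M (tpow M n) (\<lambda>x. Q.g (us @ x # vs))"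
    unfolding tpow_eq using * by (intro Q.klinear_slot cmodule_axioms) (auto simp: tpow_gens_def)
  then show "klinear M (tpow M n) (\<lambda>x. pure M (us @ x # vs))"
    using * by (simp add: pure_eq)
qed (rule pure_closed)

lemma tpow_klinear_eq:
  assumes "cmodule P" "klinear (tpow M n) P h" "klinear (tpow M n) P h'"
    "\<And>xs. xs \<in> tpow_gens M n \<Longrightarrow> h (pure M xs) = h' (pure M xs)" "t \<in> mcar (tpow M n)"
  shows "h t = h' t"
proof (rule Q.klinear_eq)
  fix xs assume "xs \<in> tpow_gens M n"
  then show "h (Q.g xs) = h' (Q.g xs)"
    using assms(4)[of xs] by (simp add: tpow_gens_def pure_eq)
qed (use assms in \<open>simp_all add: tpow_eq\<close>)

lemma multilinear_lift:
  assumes P: "cmodule P" and f: "multilinear M n P f"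
  obtains h where "klinear (tpow M n) P h" "\<And>xs. xs \<in> tpow_gens M n \<Longrightarrow> h (pure M xs) = f xs"
proof -
  have "lin_ext P f r = mzero P" if r: "r \<in> rel_gens" for r
  proof -
    obtain us vs where *: "length us + length vs + 1 = n" "set us \<subseteq> mcar M" "set vs \<subseteq> mcar M"
      "r \<in> slot_rels M (\<lambda>x. us @ x # vs)"
      using r by auto
    show ?thesis
      using multilinear_closed[OF f] multilinear_slot[OF f *(1-3)] *
      by (intro slot_rels_vanish[OF cmodule_axioms P _ _ _ *(4), where X = "tpow_gens M n"])
        (auto simp: tpow_gens_def)
  qed
  from Q.lift[OF P multilinear_closed[OF f] this] obtain h where
    "klinear Q.Q P h" "\<And>xs. xs \<in> tpow_gens M n \<Longrightarrow> h (Q.g xs) = f xs"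
    by blast
  then show ?thesis
    using that[of h] by (simp add: tpow_eq pure_eq tpow_gens_def)
qed

text \<open>The description in \<open>tlift\<close> is proper: a map exists by the universal
  property, restricted to the carrier, and it is unique because pure tensors span the tensor power
  while extensionality fixes the values outside.\<close>

lemma
  assumes P: "cmodule P" and f: "multilinear M n P f"
  shows tlift_lin_maps: "tlift M n P f \<in> lin_maps (tpow M n) P"
    and tlift_pure: "xs \<in> tpow_gens M n \<Longrightarrow> tlift M n P f (pure M xs) = f xs"
proof -
  obtain h where h: "klinear (tpow M n) P h" "\<And>xs. xs \<in> tpow_gens M n \<Longrightarrow> h (pure M xs) = f xs"
    using multilinear_lift[OF assms] by blast
  let ?h = "restrict h (mcar (tpow M n))"
  have h': "?h \<in> lin_maps (tpow M n) P \<and> (\<forall>xs\<in>tpow_gens M n. ?h (pure M xs) = f xs)"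
    using h klinear_cong[OF T.cmodule_axioms, of ?h h P] pure_closed by (simp add: lin_maps_iff)
  have "\<exists>!g. g \<in> lin_maps (tpow M n) P \<and> (\<forall>xs\<in>tpow_gens M n. g (pure M xs) = f xs)"
  proof (rule ex1I[of _ ?h])
    fix g assume g: "g \<in> lin_maps (tpow M n) P \<and> (\<forall>xs\<in>tpow_gens M n. g (pure M xs) = f xs)"
    have "g x = ?h x" if "x \<in> mcar (tpow M n)" for x
    proof (rule tpow_klinear_eq[OF P _ _ _ that])
      show "klinear (tpow M n) P g" "klinear (tpow M n) P ?h"
        using g h' by (simp_all only: lin_maps_iff)
      show "g (pure M xs) = ?h (pure M xs)" if "xs \<in> tpow_gens M n" for xs
        using g h' that by metis
    qed
    moreover have "g \<in> extensional (mcar (tpow M n))"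
      using g by (simp only: lin_maps_iff)
    ultimately show "g = ?h"
      by (intro extensionalityI[OF _ restrict_extensional])
  qed (rule h')
  from theI'[OF this] show "tlift M n P f \<in> lin_maps (tpow M n) P"
    "xs \<in> tpow_gens M n \<Longrightarrow> tlift M n P f (pure M xs) = f xs"
    by (simp_all add: tlift_def)
qed

end

section \<open>Sweedler sums\<close>

text \<open>The tensor \<open>t\<close>, and with it the chosen list, stays fixed while
  \<open>l\<close> varies, so linearity is checked summand by summand. Dependence on the tensor
  itself is the harder case, treated by \<open>klinear_tsum\<close> for bilinear functions.\<close>

lemma klinear_tsum_param:
  "cmodule P \<Longrightarrow> (\<And>x y. klinear L P (\<lambda>l. f l x y)) \<Longrightarrow> klinear L P (\<lambda>l. tsum M N P t (f l))"
  unfolding tsum_def by (rule klinear_msum_map) (auto split: prod.split)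

lemma multilinear_tsum_param:
  "cmodule P \<Longrightarrow> (\<And>x y. multilinear L n P (\<lambda>l. f l x y)) \<Longrightarrow>
    multilinear L n P (\<lambda>l. tsum M N P t (f l))"
  unfolding tsum_def by (rule multilinear_msum_map) (auto split: prod.split)

lemma tsum_map:
  assumes "cmodule P" "cmodule P'" "klinear P P' h" "\<And>x y. f x y \<in> mcar P"
  shows "h (tsum M N P t f) = tsum M N P' t (\<lambda>x y. h (f x y))"
proof -
  have "set (map (\<lambda>(x, y). f x y) (sweedler M N t)) \<subseteq> mcar P"
    using assms(4) by auto
  from klinear_msum[OF assms(1-3) this] show ?thesis
    by (simp add: tsum_def o_def case_prod_unfold)
qed

lemma klinear_smult_id: "cmodule P \<Longrightarrow> klinear P P (msmult P c)"
  using klinear_smult[OF _ klinear_ident] .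

text \<open>The iterated Sweedler sum over all entries of \<open>as\<close>. Left and right
  components are collected in separate lists to match the formulas for \<gamma> and \<tau>, where
  the left components are multiplied together and the right ones become tensor factors.\<close>

definition tsums :: "('k::comm_ring_1, 'm) kmod \<Rightarrow> ('k, 'n) kmod \<Rightarrow> ('a \<Rightarrow> ('m \<times> 'n \<Rightarrow>\<^sub>0 'k) set)
    \<Rightarrow> ('k, 'p) kmod \<Rightarrow> 'a list \<Rightarrow> ('m list \<Rightarrow> 'n list \<Rightarrow> 'p) \<Rightarrow> 'p" where
  "tsums M N \<beta> P as F = msum P (map (\<lambda>ps. F (map fst ps) (map snd ps))
     (product_lists (map (\<lambda>a. sweedler M N (\<beta> a)) as)))"

lemma tsums_Nil: "cmodule P \<Longrightarrow> F [] [] \<in> mcar P \<Longrightarrow> tsums M N \<beta> P [] F = F [] []"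
  by (simp add: tsums_def cmodule.msum_Cons cmodule.msum_Nil cmodule.add_zero)

lemma tsums_closed:
  assumes "cmodule P"
    "\<And>xs us. length xs = length as \<Longrightarrow> length us = length as \<Longrightarrow> F xs us \<in> mcar P"
  shows "tsums M N \<beta> P as F \<in> mcar P"
  unfolding tsums_def using assms
  by (intro cmodule.msum_map_closed) (auto dest: in_set_product_lists_length)

text \<open>\<open>product_lists\<close> varies its head slowest, so the sum over the head becomes
  the outer one. Closure of \<open>F\<close> is assumed only for lists of full length: tensors with
  another number of factors lie in another tensor power.\<close>

lemma tsums_Cons:
  assumes "cmodule P"
    "\<And>xs us. length xs = Suc (length as) \<Longrightarrow> length us = Suc (length as) \<Longrightarrow> F xs us \<in> mcar P"
  shows "tsums M N \<beta> P (a # as) F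
    = tsum M N P (\<beta> a) (\<lambda>x u. tsums M N \<beta> P as (\<lambda>xs us. F (x # xs) (u # us)))"
proof -
  let ?L = "product_lists (map (\<lambda>a. sweedler M N (\<beta> a)) as)"
  have "tsums M N \<beta> P (a # as) F = msum P (concat (map (\<lambda>p. map (\<lambda>ps.
      F (fst p # map fst ps) (snd p # map snd ps)) ?L) (sweedler M N (\<beta> a))))"
    by (simp add: tsums_def map_concat o_def)
  also have "\<dots> = msum P (map (msum P) (map (\<lambda>p. map (\<lambda>ps.
      F (fst p # map fst ps) (snd p # map snd ps)) ?L) (sweedler M N (\<beta> a))))"
    using assms by (intro cmodule.msum_concat) (auto dest!: in_set_product_lists_length)
  finally show ?thesis
    by (simp add: tsum_def tsums_def o_def case_prod_unfold)
qed

lemma tsums_cong: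
  assumes "\<And>xs us. length xs = length as \<Longrightarrow> length us = length as \<Longrightarrow> F xs us = G xs us"
  shows "tsums M N \<beta> P as F = tsums M N \<beta> P as G"
  unfolding tsums_def
  by (rule arg_cong[of _ _ "msum P"]) (auto intro!: assms dest: in_set_product_lists_length)

lemma tsums_append:
  assumes "cmodule P"
    "\<And>xs us. length xs = length as + length bs \<Longrightarrow> length us = length as + length bs \<Longrightarrow> F xs us \<in> mcar P"
  shows "tsums M N \<beta> P (as @ bs) F
    = tsums M N \<beta> P as (\<lambda>xs us. tsums M N \<beta> P bs (\<lambda>ys vs. F (xs @ ys) (us @ vs)))"
  using assms(2)
proof (induction as arbitrary: F)
  case Nil
  then show ?case
    using tsums_closed[OF assms(1), of bs F] by (simp add: tsums_Nil[OF assms(1)])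
next
  case (Cons a as)
  have "tsums M N \<beta> P (as @ bs) (\<lambda>xs us. F (x # xs) (u # us))
      = tsums M N \<beta> P as (\<lambda>xs us. tsums M N \<beta> P bs (\<lambda>ys vs. F (x # xs @ ys) (u # us @ vs)))" for x u
    using Cons.prems by (intro Cons.IH) auto
  moreover have "tsums M N \<beta> P bs (\<lambda>ys vs. F (xs @ ys) (us @ vs)) \<in> mcar P"
    if "length xs = Suc (length as)" "length us = Suc (length as)" for xs us
    using Cons.prems that by (intro tsums_closed assms(1)) auto
  ultimately show ?case
    using Cons.prems by (simp add: tsums_Cons[OF assms(1)])
qed

lemma klinear_tsums_param:
  "cmodule P \<Longrightarrow> (\<And>xs us. length xs = length as \<Longrightarrow> length us = length as \<Longrightarrow> klinear L P (\<lambda>l. F l xs us)) \<Longrightarrow>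
    klinear L P (\<lambda>l. tsums M N \<beta> P as (F l))"
  unfolding tsums_def by (rule klinear_msum_map) (auto dest: in_set_product_lists_length)

lemma tsums_map:
  assumes "cmodule P" "cmodule P'" "klinear P P' h"
    "\<And>xs us. length xs = length as \<Longrightarrow> length us = length as \<Longrightarrow> F xs us \<in> mcar P"
  shows "h (tsums M N \<beta> P as F) = tsums M N \<beta> P' as (\<lambda>xs us. h (F xs us))"
proof -
  have "set (map (\<lambda>ps. F (map fst ps) (map snd ps)) (product_lists (map (\<lambda>a. sweedler M N (\<beta> a)) as))) \<subseteq> mcar P"
    using assms(4) by (auto dest!: in_set_product_lists_length)
  from klinear_msum[OF assms(1-3) this] show ?thesis
    by (simp add: tsums_def o_def)
qed

lemma tsums_tsum_swap:
  assumes "cmodule P"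
    "\<And>xs us x u. length xs = length as \<Longrightarrow> length us = length as \<Longrightarrow> F xs us x u \<in> mcar P"
  shows "tsums M N \<beta> P as (\<lambda>xs us. tsum M' N' P t (F xs us))
    = tsum M' N' P t (\<lambda>x u. tsums M N \<beta> P as (\<lambda>xs us. F xs us x u))"
  unfolding tsums_def tsum_def case_prod_unfold using assms(2)
  by (intro cmodule.msum_swap assms(1)) (auto dest: in_set_product_lists_length)

definition bimultilinear :: "('k, 'm) kmod \<Rightarrow> ('k, 'n) kmod \<Rightarrow> nat \<Rightarrow> ('k, 'p) kmod
    \<Rightarrow> ('m list \<Rightarrow> 'n list \<Rightarrow> 'p) \<Rightarrow> bool" where
  "bimultilinear M N n P F \<longleftrightarrow> (\<forall>us\<in>tpow_gens N n. multilinear M n P (\<lambda>xs. F xs us))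
     \<and> (\<forall>xs\<in>tpow_gens M n. multilinear N n P (F xs))"

lemma tpow_gens_kmod_of [simp]: "xs \<in> tpow_gens (kmod_of s) n \<longleftrightarrow> length xs = n"
  by (simp add: tpow_gens_def)

lemma multilinear_cong:
  assumes "\<And>xs. length xs = n \<Longrightarrow> f xs = g xs"
  shows "multilinear (kmod_of s) n P f \<longleftrightarrow> multilinear (kmod_of s) n P g"
proof -
  have "(\<lambda>x. f (us @ x # vs)) = (\<lambda>x. g (us @ x # vs))" if "length us + length vs + 1 = n" for us vs
    using that by (intro ext assms) simp
  then show ?thesis
    unfolding multilinear_def by (auto simp: assms)
qed

lemma bimultilinear_closed:
  "bimultilinear M N n P F \<Longrightarrow> xs \<in> tpow_gens M n \<Longrightarrow> us \<in> tpow_gens N n \<Longrightarrow> F xs us \<in> mcar P"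
  by (auto simp: bimultilinear_def intro: multilinear_closed)

lemma bimultilinear_Suc:
  assumes "bimultilinear M N (Suc n) P F" "x \<in> mcar M" "u \<in> mcar N"
  shows "bimultilinear M N n P (\<lambda>xs us. F (x # xs) (u # us))"
proof -
  have "x # xs \<in> tpow_gens M (Suc n)" if "xs \<in> tpow_gens M n" for xs
    using assms(2) that by (simp add: tpow_gens_def)
  moreover have "u # us \<in> tpow_gens N (Suc n)" if "us \<in> tpow_gens N n" for us
    using assms(3) that by (simp add: tpow_gens_def)
  ultimately show ?thesis
    using assms(1) unfolding bimultilinear_def
    by (intro conjI ballI multilinear_SucD(1)[OF _ assms(2)] multilinear_SucD(1)[OF _ assms(3)]) simp_all
qed

text \<open>Both the coaction of a comodule algebra and the comultiplication of \<open>H\<close> are instances.\<close>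

locale coaction = A: module sA + H: module sH
  for sA :: "'k::comm_ring_1 \<Rightarrow> 'a::ab_group_add \<Rightarrow> 'a" and sH :: "'k \<Rightarrow> 'h::ab_group_add \<Rightarrow> 'h" +
  fixes \<beta> :: "'a \<Rightarrow> ('a \<times> 'h \<Rightarrow>\<^sub>0 'k) set"
  assumes coaction_linear: "klinear (kmod_of sA) (tensor (kmod_of sA) (kmod_of sH)) \<beta>"
begin

abbreviation "A \<equiv> kmod_of sA"
abbreviation "H \<equiv> kmod_of sH"
abbreviation "sw P a f \<equiv> tsum A H P (\<beta> a) f"
abbreviation "swl P as F \<equiv> tsums A H \<beta> P as F"

sublocale AM: cmodule A by (rule cmodule_kmod_of) (rule A.module_axioms)
sublocale HM: cmodule H by (rule cmodule_kmod_of) (rule H.module_axioms)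
sublocale AH: tensor_product A H ..

lemma coaction_closed: "\<beta> a \<in> mcar (tensor A H)"
  using klinearD(1)[OF coaction_linear] by simp

lemma klinear_sw: "cmodule P \<Longrightarrow> kbilinear A H P f \<Longrightarrow> klinear A P (\<lambda>a. sw P a f)"
  using klinear_comp[OF coaction_linear AH.klinear_tsum] .

text \<open>In the tail entries the Sweedler list of the head is fixed and the induction hypothesis
  applies. In the head entry the list itself varies, so \<open>klinear_sw\<close> is used, with
  bilinearity taken from the two head slots of \<open>F\<close>.\<close>

lemma multilinear_swl:
  assumes "cmodule P" "bimultilinear A H n P F"
  shows "multilinear A n P (\<lambda>as. swl P as F)"
  using assms(2)
proof (induction n arbitrary: F)
  case 0
  then have "F [] [] \<in> mcar P" by (auto dest!: bimultilinear_closed)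
  then show ?case by (simp add: multilinear_0 tsums_Nil assms(1))
next
  case (Suc n)
  have *: "swl P (a # as) F = sw P a (\<lambda>x u. swl P as (\<lambda>xs us. F (x # xs) (u # us)))"
    if "length as = n" for a as
    using bimultilinear_closed[OF Suc.prems] that by (intro tsums_Cons[OF assms(1)]) simp
  \<comment> \<open>\<open>tsums_Cons\<close> holds only for lists of the right length, so the sum
    is replaced by a total function that splits off the head by its form. The value at
    \<open>[]\<close> is a dummy, as lists of length \<open>Suc n\<close> are nonempty.\<close>
  let ?G = "\<lambda>as. case as of [] \<Rightarrow> mzero P | a # as \<Rightarrow> sw P a (\<lambda>x u. swl P as (\<lambda>xs us. F (x # xs) (u # us)))"
  have "multilinear A (Suc n) P ?G"
  proof (rule multilinear_SucI; simp)
    fix a show "multilinear A n P (\<lambda>as. sw P a (\<lambda>x u. swl P as (\<lambda>xs us. F (x # xs) (u # us))))"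
      using Suc by (intro multilinear_tsum_param assms(1) Suc.IH bimultilinear_Suc) auto
  next
    fix as :: "'a list" assume as: "length as = n"
    show "klinear A P (\<lambda>a. sw P a (\<lambda>x u. swl P as (\<lambda>xs us. F (x # xs) (u # us))))"
    proof (intro klinear_sw assms(1) kbilinearI)
      fix u
      have "klinear A P (\<lambda>x. F (x # xs) (u # us))" if "length xs = n" "length us = n" for xs us
        using Suc.prems that multilinear_SucD(2)[of A n P "\<lambda>xs. F xs (u # us)" xs] by (auto simp: bimultilinear_def)
      then show "klinear A P (\<lambda>x. swl P as (\<lambda>xs us. F (x # xs) (u # us)))"
        using as by (intro klinear_tsums_param assms(1)) auto
    next
      fix x
      have "klinear H P (\<lambda>u. F (x # xs) (u # us))" if "length xs = n" "length us = n" for xs us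
        using Suc.prems that multilinear_SucD(2)[of H n P "F (x # xs)" us] by (auto simp: bimultilinear_def)
      then show "klinear H P (\<lambda>u. swl P as (\<lambda>xs us. F (x # xs) (u # us)))"
        using as by (intro klinear_tsums_param assms(1)) auto
    qed
  qed
  moreover have "swl P as F = ?G as" if "length as = Suc n" for as
    using that * by (cases as) auto
  ultimately show ?case
    using multilinear_cong[of "Suc n" "\<lambda>as. swl P as F" ?G] by blast
qed

end

section \<open>Coactions that are algebra maps\<close>

lemma (in k_algebra) klinear_times:
  "klinear (kmod_of scale) (kmod_of scale) (\<lambda>x. a * x)" "klinear (kmod_of scale) (kmod_of scale) (\<lambda>x. x * a)"
  by (simp_all add: klinear_def distrib_left distrib_right scale_mult_right scale_mult_left)

locale algebra_coaction = A: k_algebra sA + H: k_algebra sH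
  for sA :: "'k::comm_ring_1 \<Rightarrow> 'a::{ring,monoid_mult} \<Rightarrow> 'a"
    and sH :: "'k \<Rightarrow> 'h::{ring,monoid_mult} \<Rightarrow> 'h" +
  fixes \<beta> :: "'a \<Rightarrow> ('a \<times> 'h \<Rightarrow>\<^sub>0 'k) set"
  assumes algebra_map: "tensor_algebra_map sA sH \<beta>"
begin

sublocale coaction sA sH \<beta>
  by unfold_locales (use algebra_map in \<open>simp add: tensor_algebra_map_def Let_def lin_maps_iff\<close>)

lemma sw_one:
  assumes "cmodule P" "kbilinear A H P f"
  shows "sw P 1 f = f 1 1"
proof -
  have "\<beta> 1 = tens A H 1 1"
    using algebra_map by (simp add: tensor_algebra_map_def Let_def)
  then show ?thesis
    using AH.tsum_tens[OF assms] by simp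
qed

text \<open>The algebra map axiom supplies a second decomposition of the tensor
  \<open>\<beta> (a * b)\<close>, and the linear map induced by \<open>f\<close> is evaluated on
  that one instead of the chosen list.\<close>

lemma sw_mult:
  assumes P: "cmodule P" and f: "kbilinear A H P f"
  shows "sw P (a * b) f = sw P a (\<lambda>x u. sw P b (\<lambda>y v. f (x * y) (u * v)))"
proof -
  let ?T = "tensor A H"
  have inner: "tsum A H P (msum ?T (map (\<lambda>q. tens A H (x * fst q) (u * snd q)) (sweedler A H (\<beta> b)))) f
      = sw P b (\<lambda>y v. f (x * y) (u * v))" for x u
    by (subst AH.tsum_msum_tens[OF P f]) (simp_all add: tsum_def case_prod_unfold)
  let ?L = "map (\<lambda>p. map (\<lambda>q. tens A H (fst p * fst q) (snd p * snd q)) (sweedler A H (\<beta> b))) (sweedler A H (\<beta> a))"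
  have "\<beta> (a * b) = msum ?T (concat ?L)"
    using algebra_map by (simp add: tensor_algebra_map_def Let_def case_prod_unfold)
  also have "\<dots> = msum ?T (map (msum ?T) ?L)"
    by (rule AH.T.msum_concat) auto
  finally have "sw P (a * b) f = tsum A H P (msum ?T (map (msum ?T) ?L)) f"
    by (rule arg_cong)
  also have "\<dots> = msum P (map (\<lambda>t. tsum A H P t f) (map (msum ?T) ?L))"
    by (rule klinear_msum[OF AH.T.cmodule_axioms P AH.klinear_tsum[OF P f]])
      (auto intro!: AH.T.msum_map_closed)
  also have "\<dots> = sw P a (\<lambda>x u. sw P b (\<lambda>y v. f (x * y) (u * v)))"
    by (simp only: map_map o_def inner) (simp only: tsum_def[of A H P "\<beta> a"] case_prod_unfold)
  finally show ?thesis .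
qed

text \<open>Each step hands \<open>f (x * y) (u * v)\<close>, as a bilinear function of
  \<open>y\<close> and \<open>v\<close>, to the remaining factors; hence the induction with
  \<open>f\<close> arbitrary.\<close>

lemma sw_prod_list:
  assumes P: "cmodule P" and f: "kbilinear A H P f"
  shows "sw P (prod_list as) f = swl P as (\<lambda>xs us. f (prod_list xs) (prod_list us))"
  using f
proof (induction as arbitrary: f)
  case Nil
  then show ?case
    by (simp add: sw_one[OF P] tsums_Nil[OF P] kbilinear_closed)
next
  case (Cons a as)
  have "kbilinear A H P (\<lambda>y v. f (x * y) (u * v))" for x u
    using Cons.prems unfolding kbilinear_def
    by (auto intro: klinear_comp[OF A.klinear_times(1)] klinear_comp[OF H.klinear_times(1)])
  then show ?case
    using Cons.prems by (simp add: sw_mult[OF P] Cons.IH tsums_Cons[OF P] kbilinear_closed)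
qed

end

section \<open>Coassociativity under Sweedler sums, for one element and for lists\<close>

locale comodule = coaction sA sH \<beta> + D: coaction sH sH \<Delta>
  for sA :: "'k::comm_ring_1 \<Rightarrow> 'a::ab_group_add \<Rightarrow> 'a" and sH :: "'k \<Rightarrow> 'h::ab_group_add \<Rightarrow> 'h"
    and \<Delta> and \<beta> +
  assumes coassoc: "coassociative sA sH \<Delta> \<beta>"
begin

text \<open>Both sides are values of one linear map on the threefold tensor product, taken at the
  two decompositions that the coassociativity axiom equates.\<close>

lemma sw_coassoc:
  assumes P: "cmodule P"
    and f: "\<And>v w. klinear A P (\<lambda>x. f x v w)" "\<And>x w. klinear H P (\<lambda>v. f x v w)" "\<And>x v. klinear H P (\<lambda>w. f x v w)"
  shows "sw P a (\<lambda>x u. D.sw P u (\<lambda>v w. f x v w)) = sw P a (\<lambda>x w. sw P x (\<lambda>y v. f y v w))"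
proof -
  interpret AHH: tensor_product "tensor A H" H ..
  let ?T = "tensor (tensor A H) H"
  \<comment> \<open>For fixed \<open>w\<close> the trilinear \<open>f\<close> is bilinear in its
    other two arguments and induces a map on \<open>tensor A H\<close>. So \<open>h\<close> is a
    bilinear function on the pair \<open>tensor A H\<close>, \<open>H\<close>, matching the
    bracketing of the axiom.\<close>
  define h where "h t w = tsum A H P t (\<lambda>x v. f x v w)" for t w
  have bil: "kbilinear A H P (\<lambda>x v. f x v w)" for w
    using f by (intro kbilinearI) auto
  have h: "kbilinear (tensor A H) H P h"
    unfolding h_def using f by (intro kbilinearI AH.klinear_tsum[OF P bil] klinear_tsum_param P)
  have ht: "h (tens A H x v) w = f x v w" for x v w
    unfolding h_def using AH.tsum_tens[OF P bil] by simp
  have inner: "tsum (tensor A H) H P (msum ?T (map (\<lambda>q. tens (tensor A H) H (tens A H x (fst q)) (snd q))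
      (sweedler H H (\<Delta> u)))) h = D.sw P u (\<lambda>v w. f x v w)" for x u
    by (subst AHH.tsum_msum_tens[OF P h]) (simp_all add: ht tsum_def[of H H] case_prod_unfold)
  let ?L = "map (\<lambda>p. map (\<lambda>q. tens (tensor A H) H (tens A H (fst p) (fst q)) (snd q)) (sweedler H H (\<Delta> (snd p))))
    (sweedler A H (\<beta> a))"
  let ?t = "msum ?T (map (\<lambda>p. tens (tensor A H) H (\<beta> (fst p)) (snd p)) (sweedler A H (\<beta> a)))"
  have "?t = msum ?T (concat ?L)"
    using coassoc by (simp add: coassociative_def Let_def case_prod_unfold)
  also have "\<dots> = msum ?T (map (msum ?T) ?L)"
    by (rule AHH.T.msum_concat) auto
  finally have "tsum (tensor A H) H P ?t h = tsum (tensor A H) H P (msum ?T (map (msum ?T) ?L)) h"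
    by (rule arg_cong)
  also have "\<dots> = msum P (map (\<lambda>t. tsum (tensor A H) H P t h) (map (msum ?T) ?L))"
    by (rule klinear_msum[OF AHH.T.cmodule_axioms P AHH.klinear_tsum[OF P h]])
      (auto intro!: AHH.T.msum_map_closed)
  also have "\<dots> = sw P a (\<lambda>x u. D.sw P u (\<lambda>v w. f x v w))"
    by (simp only: map_map o_def inner) (simp only: tsum_def[of A H P "\<beta> a"] case_prod_unfold)
  finally have "sw P a (\<lambda>x u. D.sw P u (\<lambda>v w. f x v w)) = tsum (tensor A H) H P ?t h" ..
  also have "\<dots> = sw P a (\<lambda>x w. sw P x (\<lambda>y v. f y v w))"
    by (subst AHH.tsum_msum_tens[OF P h])
      (simp_all only: h_def tsum_def[of A H P "\<beta> a"] case_prod_unfold kmod_of_sel UNIV_I coaction_closed)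
  finally show ?thesis .
qed

definition trimultilinear :: "nat \<Rightarrow> ('k, 'p) kmod \<Rightarrow> ('a list \<Rightarrow> 'h list \<Rightarrow> 'h list \<Rightarrow> 'p) \<Rightarrow> bool" where
  "trimultilinear n P F \<longleftrightarrow>
     (\<forall>vs ws. length vs = n \<longrightarrow> length ws = n \<longrightarrow> multilinear A n P (\<lambda>xs. F xs vs ws)) \<and>
     (\<forall>xs ws. length xs = n \<longrightarrow> length ws = n \<longrightarrow> multilinear H n P (\<lambda>vs. F xs vs ws)) \<and>
     (\<forall>xs vs. length xs = n \<longrightarrow> length vs = n \<longrightarrow> multilinear H n P (F xs vs))"

lemma trimultilinear_Suc:
  assumes "trimultilinear (Suc n) P F"
  shows "trimultilinear n P (\<lambda>xs vs ws. F (x # xs) (v # vs) (w # ws))"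
    and "length xs = n \<Longrightarrow> length vs = n \<Longrightarrow> length ws = n \<Longrightarrow> klinear A P (\<lambda>x. F (x # xs) (v # vs) (w # ws))"
    and "length xs = n \<Longrightarrow> length vs = n \<Longrightarrow> length ws = n \<Longrightarrow> klinear H P (\<lambda>v. F (x # xs) (v # vs) (w # ws))"
    and "length xs = n \<Longrightarrow> length vs = n \<Longrightarrow> length ws = n \<Longrightarrow> klinear H P (\<lambda>w. F (x # xs) (v # vs) (w # ws))"
proof -
  note F = assms[unfolded trimultilinear_def]
  have 1: "multilinear A (Suc n) P (\<lambda>xs. F xs vs ws)" if "length vs = Suc n" "length ws = Suc n" for vs ws
    using F that by blast
  have 2: "multilinear H (Suc n) P (\<lambda>vs. F xs vs ws)" if "length xs = Suc n" "length ws = Suc n" for xs ws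
    using F that by blast
  have 3: "multilinear H (Suc n) P (\<lambda>ws. F xs vs ws)" if "length xs = Suc n" "length vs = Suc n" for xs vs
    using F that by blast
  show "trimultilinear n P (\<lambda>xs vs ws. F (x # xs) (v # vs) (w # ws))"
    unfolding trimultilinear_def
    using multilinear_SucD(1)[OF 1, of "v # _" "w # _"] multilinear_SucD(1)[OF 2, of "x # _" "w # _"]
      multilinear_SucD(1)[OF 3, of "x # _" "v # _"] by simp
  assume l: "length xs = n" "length vs = n" "length ws = n"
  then show "klinear A P (\<lambda>x. F (x # xs) (v # vs) (w # ws))"
    using multilinear_SucD(2)[OF 1, of "v # vs" "w # ws" xs] by simp
  show "klinear H P (\<lambda>v. F (x # xs) (v # vs) (w # ws))"
    using multilinear_SucD(2)[OF 2, of "x # xs" "w # ws" vs] l by simp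
  show "klinear H P (\<lambda>w. F (x # xs) (v # vs) (w # ws))"
    using multilinear_SucD(2)[OF 3, of "x # xs" "v # vs" ws] l by simp
qed

lemma trimultilinear_closed:
  "trimultilinear n P F \<Longrightarrow> length xs = n \<Longrightarrow> length vs = n \<Longrightarrow> length ws = n \<Longrightarrow> F xs vs ws \<in> mcar P"
  using multilinear_closed[of A n P "\<lambda>xs. F xs vs ws" xs] by (simp add: trimultilinear_def)

text \<open>The head is treated by \<open>sw_coassoc\<close> and the tail by the induction
  hypothesis. Each of them needs its two sums nested directly, so the inner head sum is moved out
  past the tail sums beforehand and back afterwards.\<close>

lemma swl_coassoc:
  assumes P: "cmodule P" and F: "trimultilinear (length as) P F"
  shows "swl P as (\<lambda>xs us. D.swl P us (\<lambda>vs ws. F xs vs ws)) = swl P as (\<lambda>xs ws. swl P xs (\<lambda>ys vs. F ys vs ws))"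
  using F
proof (induction as arbitrary: F)
  case Nil
  then show ?case
    using trimultilinear_closed[OF Nil.prems] by (simp add: tsums_Nil[OF P])
next
  case (Cons a as)
  let ?n = "length as"
  note F = Cons.prems[simplified]
  have cl: "F xs vs ws \<in> mcar P" if "length xs = Suc ?n" "length vs = Suc ?n" "length ws = Suc ?n" for xs vs ws
    using trimultilinear_closed[OF F that] .
  have "swl P (a # as) (\<lambda>xs us. D.swl P us (F xs))
      = sw P a (\<lambda>x u. swl P as (\<lambda>xs us. D.swl P (u # us) (F (x # xs))))"
    by (intro tsums_Cons P tsums_closed) (simp_all add: cl)
  also have "(\<lambda>x u. swl P as (\<lambda>xs us. D.swl P (u # us) (F (x # xs))))
      = (\<lambda>x u. swl P as (\<lambda>xs us. D.sw P u (\<lambda>v w. D.swl P us (\<lambda>vs ws. F (x # xs) (v # vs) (w # ws)))))"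
    by (intro ext tsums_cong tsums_Cons P) (simp add: cl)
  also have "\<dots> = (\<lambda>x u. D.sw P u (\<lambda>v w. swl P as (\<lambda>xs us. D.swl P us (\<lambda>vs ws. F (x # xs) (v # vs) (w # ws)))))"
    by (intro ext tsums_tsum_swap P tsums_closed) (simp add: cl)
  also have "\<dots> = (\<lambda>x u. D.sw P u (\<lambda>v w. swl P as (\<lambda>xs ws. swl P xs (\<lambda>ys vs. F (x # ys) (v # vs) (w # ws)))))"
    by (simp add: Cons.IH[OF trimultilinear_Suc(1)[OF F]])
  also have "sw P a \<dots> = sw P a (\<lambda>x w. sw P x (\<lambda>y v. swl P as (\<lambda>xs ws. swl P xs (\<lambda>ys vs. F (y # ys) (v # vs) (w # ws)))))"
    by (intro sw_coassoc P klinear_tsums_param trimultilinear_Suc[OF F]) simp_all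
  also have "(\<lambda>x w. sw P x (\<lambda>y v. swl P as (\<lambda>xs ws. swl P xs (\<lambda>ys vs. F (y # ys) (v # vs) (w # ws)))))
      = (\<lambda>x w. swl P as (\<lambda>xs ws. sw P x (\<lambda>y v. swl P xs (\<lambda>ys vs. F (y # ys) (v # vs) (w # ws)))))"
    by (intro ext tsums_tsum_swap[symmetric] P tsums_closed) (simp add: cl)
  also have "\<dots> = (\<lambda>x w. swl P as (\<lambda>xs ws. swl P (x # xs) (\<lambda>ys vs. F ys vs (w # ws))))"
    by (intro ext tsums_cong tsums_Cons[symmetric] P) (simp add: cl)
  also have "sw P a \<dots> = swl P (a # as) (\<lambda>xs ws. swl P xs (\<lambda>ys vs. F ys vs ws))"
    by (intro tsums_Cons[symmetric] P tsums_closed) (simp_all add: cl)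
  finally show ?case .
qed

end

section \<open>Chain maps of cyclic double complexes\<close>

locale cyclic_modules =
  fixes C :: "('k::comm_ring_1, 'm) cyclic_data"
  assumes cmodule_obj: "cmodule (obj C n)"
    and face_linear: "0 < n \<Longrightarrow> i \<le> n \<Longrightarrow> klinear (obj C n) (obj C (n - 1)) (face C n i)"
    and cyc_linear: "klinear (obj C n) (obj C n) (cyc C n)"
begin

lemma hoch_b_linear: "0 < n \<Longrightarrow> klinear (obj C n) (obj C (n - 1)) (hoch_b C n)"
  unfolding hoch_b_def
  by (intro klinear_msum_map klinear_smult face_linear cmodule_obj) auto

lemma hoch_b'_linear: "0 < n \<Longrightarrow> klinear (obj C n) (obj C (n - 1)) (hoch_b' C n)"
  unfolding hoch_b'_def
  by (intro klinear_msum_map klinear_smult face_linear cmodule_obj) auto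

lemma cyc_t_linear: "klinear (obj C n) (obj C n) (cyc_t C n)"
  unfolding cyc_t_def by (intro klinear_smult cyc_linear cmodule_obj)

lemma cyc_t_pow_linear: "klinear (obj C n) (obj C n) (cyc_t C n ^^ i)"
proof (induction i)
  case 0
  show ?case by (simp add: klinear_def)
next
  case (Suc i)
  then show ?case using klinear_comp[OF Suc cyc_t_linear] by (simp add: o_def)
qed

lemma cyc_norm_linear: "klinear (obj C n) (obj C n) (cyc_norm C n)"
  unfolding cyc_norm_def by (intro klinear_msum_map cyc_t_pow_linear cmodule_obj)

section \<open>The total complex and its homology\<close>

lemma tot_sel:
  "mcar (tot C n) = (\<Pi>\<^sub>E q\<in>{..n}. mcar (obj C q))"
  "madd (tot C n) x y = (\<lambda>q\<in>{..n}. madd (obj C q) (x q) (y q))"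
  "mzero (tot C n) = (\<lambda>q\<in>{..n}. mzero (obj C q))"
  "msmult (tot C n) c x = (\<lambda>q\<in>{..n}. msmult (obj C q) c (x q))"
  by (simp_all add: tot_def)

lemma cmodule_tot: "cmodule (tot C n)"
proof -
  interpret O: cmodule "obj C q" for q by (rule cmodule_obj)
  have mem: "x q \<in> mcar (obj C q)" if "x \<in> mcar (tot C n)" "q \<le> n" for x q
    using that by (auto simp: tot_sel)
  have eq: "x = y" if "x \<in> extensional {..n}" "y \<in> extensional {..n}" "\<And>q. q \<le> n \<Longrightarrow> x q = y q" for x y :: "nat \<Rightarrow> 'm"
    using that by (intro extensionalityI[of x "{..n}" y]) auto
  have ext: "x \<in> extensional {..n}" if "x \<in> mcar (tot C n)" for x
    using that by (simp add: tot_sel PiE_def)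
  show ?thesis
  proof
    fix x y z assume *: "x \<in> mcar (tot C n)" "y \<in> mcar (tot C n)" "z \<in> mcar (tot C n)"
    note m = mem[OF *(1)] mem[OF *(2)] mem[OF *(3)]
    show "madd (tot C n) (madd (tot C n) x y) z = madd (tot C n) x (madd (tot C n) y z)"
      by (rule eq) (simp_all add: tot_sel m O.add_assoc)
  next
    fix x y c assume *: "x \<in> mcar (tot C n)" "y \<in> mcar (tot C n)"
    note m = mem[OF *(1)] mem[OF *(2)]
    show "madd (tot C n) x y \<in> mcar (tot C n)"
      by (simp add: tot_sel(1)) (simp add: tot_sel m)
    show "madd (tot C n) x y = madd (tot C n) y x"
      by (rule eq) (simp_all add: tot_sel m O.add_commute)
    show "msmult (tot C n) c (madd (tot C n) x y) = madd (tot C n) (msmult (tot C n) c x) (msmult (tot C n) c y)"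
      by (rule eq) (simp_all add: tot_sel m O.smult_add)
  next
    fix x c d assume *: "x \<in> mcar (tot C n)"
    note m = mem[OF *]
    show "msmult (tot C n) c x \<in> mcar (tot C n)"
      by (simp add: tot_sel(1)) (simp add: tot_sel m)
    show "madd (tot C n) x (mzero (tot C n)) = x"
      by (rule eq) (simp_all add: tot_sel(2-) m ext[OF *])
    show "msmult (tot C n) (c + d) x = madd (tot C n) (msmult (tot C n) c x) (msmult (tot C n) d x)"
      by (rule eq) (simp_all add: tot_sel m O.add_smult)
    show "msmult (tot C n) c (msmult (tot C n) d x) = msmult (tot C n) (c * d) x"
      by (rule eq) (simp_all add: tot_sel m)
    show "msmult (tot C n) 1 x = x"
      by (rule eq) (simp_all add: tot_sel(2-) m ext[OF *])
    show "msmult (tot C n) 0 x = mzero (tot C n)"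
      by (rule eq) (simp_all add: tot_sel m)
  qed (simp add: tot_sel)
qed

lemma tot_proj_linear: "q \<le> n \<Longrightarrow> klinear (tot C n) (obj C q) (\<lambda>x. x q)"
  by (auto simp: klinear_def tot_sel)

lemma klinear_into_tot:
  assumes "cmodule M" "\<And>q. q \<le> n \<Longrightarrow> klinear M (obj C q) (\<lambda>x. g x q)"
  shows "klinear M (tot C n) (\<lambda>x. \<lambda>q\<in>{..n}. g x q)"
proof -
  note g = klinearD[OF assms(2)]
  show ?thesis
    by (rule klinearI) (auto simp: tot_sel g intro!: restrict_ext)
qed

lemma tot_d_linear: "klinear (tot C (Suc n)) (tot C n) (tot_d C (Suc n))"
proof -
  \<comment> \<open>For a differential leaving degree \<open>Suc n\<close>, the component
    \<open>q\<close> of the result lies in column \<open>n - q\<close>; its parity selects the shape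
    of the differential.\<close>
  have "klinear (tot C (Suc n)) (obj C q) (\<lambda>x. tot_d C (Suc n) x q)" if "q \<le> n" for q
  proof (cases "even (n - q)")
    case True
    have "klinear (tot C (Suc n)) (obj C q) (\<lambda>x. madd (obj C q) (hoch_b C (Suc q) (x (Suc q))) (mdiff (obj C q) (x q) (cyc_t C q (x q))))"
      using that klinear_comp[OF tot_proj_linear hoch_b_linear[of "Suc q"], of "Suc n"]
      by (intro klinear_add klinear_diff cmodule_obj tot_proj_linear klinear_comp[OF tot_proj_linear cyc_t_linear]) auto
    then show ?thesis using that True by (simp add: tot_d_def)
  next
    case False
    have "klinear (tot C (Suc n)) (obj C q) (\<lambda>x. mdiff (obj C q) (cyc_norm C q (x q)) (hoch_b' C (Suc q) (x (Suc q))))"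
      using that klinear_comp[OF tot_proj_linear hoch_b'_linear[of "Suc q"], of "Suc n"]
      by (intro klinear_diff cmodule_obj tot_proj_linear klinear_comp[OF tot_proj_linear cyc_norm_linear]) auto
    then show ?thesis using that False by (simp add: tot_d_def)
  qed
  then have "klinear (tot C (Suc n)) (tot C n) (\<lambda>x. \<lambda>q\<in>{..n}. tot_d C (Suc n) x q)"
    by (intro klinear_into_tot cmodule_tot)
  moreover have "(\<lambda>x. \<lambda>q\<in>{..n}. tot_d C (Suc n) x q) = tot_d C (Suc n)"
    by (intro ext) (simp add: tot_d_def)
  ultimately show ?thesis by simp
qed

lemma csubmodule_boundaries: "csubmodule (tot C n) (boundaries C n)"
proof (intro csubmodule.intro csubmodule_axioms.intro cmodule_tot)
  interpret T: cmodule "tot C m" for m by (rule cmodule_tot)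
  note d = klinearD[OF tot_d_linear[of n]] klinear_zero[OF cmodule_tot cmodule_tot tot_d_linear[of n]]
  show "submod (boundaries C n) (tot C n)"
    unfolding submod_def boundaries_def
  proof (intro conjI ballI allI)
    show "mzero (tot C n) \<in> tot_d C (Suc n) ` mcar (tot C (Suc n))"
      by (rule image_eqI[of _ _ "mzero (tot C (Suc n))"]) (simp_all add: d)
  qed (auto simp: d simp flip: d(2,3))
qed

lemma cycles_closed:
  assumes "x \<in> cycles C n" "y \<in> cycles C n"
  shows "madd (tot C n) x y \<in> cycles C n" "msmult (tot C n) c x \<in> cycles C n"
proof -
  interpret T: cmodule "tot C m" for m by (rule cmodule_tot)
  show "madd (tot C n) x y \<in> cycles C n" "msmult (tot C n) c x \<in> cycles C n"
    using assms klinearD[OF tot_d_linear[of "n - 1"]] by (cases n; simp add: cycles_def)+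
qed

text \<open>\<open>mquot\<close> uses the carrier of its argument only to form the carrier of the
  quotient. Homology therefore has the operations of the quotient of the whole of
  \<open>tot C n\<close> by the boundaries, and the quotient lemmas can be applied there.\<close>

lemma HC_sel:
  "mcar (HC C n) = hclass C n ` cycles C n"
  "madd (HC C n) = madd (mquot (tot C n) (boundaries C n))"
  "msmult (HC C n) = msmult (mquot (tot C n) (boundaries C n))"
  by (simp_all add: HC_def mquot_def hclass_def mcoset_def)

end

section \<open>Morphisms of cyclic data and the induced map on homology\<close>

locale cyclic_morphism = C: cyclic_modules C + D: cyclic_modules D
  for C :: "('k::comm_ring_1, 'm) cyclic_data" and D :: "('k, 'n) cyclic_data" +
  fixes f :: "nat \<Rightarrow> 'm \<Rightarrow> 'n"
  assumes linear: "klinear (obj C n) (obj D n) (f n)"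
    and face: "0 < n \<Longrightarrow> i \<le> n \<Longrightarrow> x \<in> mcar (obj C n) \<Longrightarrow> f (n - 1) (face C n i x) = face D n i (f n x)"
    and cyc: "x \<in> mcar (obj C n) \<Longrightarrow> f n (cyc C n x) = cyc D n (f n x)"
begin

text \<open>The free index list serves \<open>hoch_b\<close> and \<open>hoch_b'\<close> at once,
  which differ by the last face.\<close>

lemma alternating_sum:
  assumes "0 < n" "x \<in> mcar (obj C n)" "\<And>i. i \<in> set is \<Longrightarrow> i \<le> n"
  shows "f (n - 1) (msum (obj C (n - 1)) (map (\<lambda>i. msmult (obj C (n - 1)) ((- 1) ^ i) (face C n i x)) is))
    = msum (obj D (n - 1)) (map (\<lambda>i. msmult (obj D (n - 1)) ((- 1) ^ i) (face D n i (f n x))) is)"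
proof -
  have cl: "face C n i x \<in> mcar (obj C (n - 1))" if "i \<in> set is" for i
    using klinearD(1)[OF C.face_linear] assms that by simp
  then have "set (map (\<lambda>i. msmult (obj C (n - 1)) ((- 1) ^ i) (face C n i x)) is) \<subseteq> mcar (obj C (n - 1))"
    by (auto intro!: cmodule.smult_closed C.cmodule_obj)
  from klinear_msum[OF C.cmodule_obj D.cmodule_obj linear this] show ?thesis
    using assms cl by (simp add: o_def klinearD[OF linear] face del: One_nat_def cong: map_cong)
qed

lemma hoch_b: "0 < n \<Longrightarrow> x \<in> mcar (obj C n) \<Longrightarrow> f (n - 1) (hoch_b C n x) = hoch_b D n (f n x)"
  unfolding hoch_b_def by (rule alternating_sum) auto

lemma hoch_b': "0 < n \<Longrightarrow> x \<in> mcar (obj C n) \<Longrightarrow> f (n - 1) (hoch_b' C n x) = hoch_b' D n (f n x)"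
  unfolding hoch_b'_def by (rule alternating_sum) auto

lemma cyc_t: "x \<in> mcar (obj C n) \<Longrightarrow> f n (cyc_t C n x) = cyc_t D n (f n x)"
  by (simp add: cyc_t_def klinearD[OF linear] klinearD[OF C.cyc_linear] cyc)

lemma cyc_t_pow: "x \<in> mcar (obj C n) \<Longrightarrow> f n ((cyc_t C n ^^ i) x) = (cyc_t D n ^^ i) (f n x)"
  by (induction i) (simp_all add: cyc_t klinearD(1)[OF C.cyc_t_pow_linear])

lemma cyc_norm:
  assumes "x \<in> mcar (obj C n)"
  shows "f n (cyc_norm C n x) = cyc_norm D n (f n x)"
proof -
  have "set (map (\<lambda>i. (cyc_t C n ^^ i) x) [0..<Suc n]) \<subseteq> mcar (obj C n)"
    using assms klinearD(1)[OF C.cyc_t_pow_linear] by auto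
  from klinear_msum[OF C.cmodule_obj D.cmodule_obj linear this] show ?thesis
    unfolding cyc_norm_def using assms by (simp add: o_def cyc_t_pow)
qed

lemma tot_map_linear: "klinear (tot C n) (tot D n) (tot_map f n)"
  unfolding tot_map_def
  by (intro D.klinear_into_tot C.cmodule_tot klinear_comp[OF C.tot_proj_linear linear])

lemma tot_map_tot_d:
  assumes x: "x \<in> mcar (tot C (Suc n))"
  shows "tot_map f n (tot_d C (Suc n) x) = tot_d D (Suc n) (tot_map f (Suc n) x)"
proof (rule extensionalityI[of _ "{..n}"])
  fix q assume "q \<in> {..n}"
  then have q: "q \<le> n" by simp
  then have m: "x q \<in> mcar (obj C q)" "x (Suc q) \<in> mcar (obj C (Suc q))"
    using klinearD(1)[OF C.tot_proj_linear x] by simp_all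
  interpret O: cmodule "obj C q" by (rule C.cmodule_obj)
  have cl: "hoch_b C (Suc q) (x (Suc q)) \<in> mcar (obj C q)" "hoch_b' C (Suc q) (x (Suc q)) \<in> mcar (obj C q)"
    "cyc_t C q (x q) \<in> mcar (obj C q)" "cyc_norm C q (x q) \<in> mcar (obj C q)"
    using m klinearD(1)[OF C.hoch_b_linear[of "Suc q"]] klinearD(1)[OF C.hoch_b'_linear[of "Suc q"]]
      klinearD(1)[OF C.cyc_t_linear] klinearD(1)[OF C.cyc_norm_linear] by simp_all
  show "tot_map f n (tot_d C (Suc n) x) q = tot_d D (Suc n) (tot_map f (Suc n) x) q"
    using q m cl hoch_b[of "Suc q" "x (Suc q)"] hoch_b'[of "Suc q" "x (Suc q)"]
    by (simp add: tot_map_def tot_d_def klinearD(2)[OF linear] klinear_mdiff[OF C.cmodule_obj linear] cyc_t cyc_norm)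
qed (simp_all add: tot_map_def tot_d_def)

lemma tot_map_cycles: "x \<in> cycles C n \<Longrightarrow> tot_map f n x \<in> cycles D n"
  using klinearD(1)[OF tot_map_linear] klinear_zero[OF C.cmodule_tot D.cmodule_tot tot_map_linear[of "n - 1"]]
  by (cases n) (auto simp: cycles_def simp flip: tot_map_tot_d)

lemma tot_map_boundaries: "x \<in> boundaries C n \<Longrightarrow> tot_map f n x \<in> boundaries D n"
  using klinearD(1)[OF tot_map_linear] by (auto simp: boundaries_def tot_map_tot_d)

text \<open>The map is lifted to the quotient of the full total module by the boundaries, which
  \<open>tot_map f n\<close> respects, and only then restricted to classes of cycles. No
  representative has to be chosen among the cycles.\<close>

theorem ex1_homology_map:
  "\<exists>!h. h \<in> lin_maps (HC C n) (HC D n) \<and> (\<forall>x\<in>cycles C n. tot_map f n x \<in> cycles D n \<and>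
     h (hclass C n x) = hclass D n (tot_map f n x))"
proof -
  interpret BC: csubmodule "tot C n" "boundaries C n" by (rule C.csubmodule_boundaries)
  interpret BD: csubmodule "tot D n" "boundaries D n" by (rule D.csubmodule_boundaries)
  have lin: "klinear (tot C n) (mquot (tot D n) (boundaries D n)) (\<lambda>x. hclass D n (tot_map f n x))"
    unfolding hclass_def by (intro klinear_comp[OF tot_map_linear] BD.klinear_coset)
  have zero: "hclass D n (tot_map f n x) = mzero (mquot (tot D n) (boundaries D n))" if "x \<in> boundaries C n" for x
    using BD.coset_shift[OF BD.zero_closed tot_map_boundaries[OF that]] tot_map_boundaries[OF that] BD.sub_closed(1)
    by (simp add: BD.quot_zero hclass_def)
  obtain h where h: "klinear (mquot (tot C n) (boundaries C n)) (mquot (tot D n) (boundaries D n)) h"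
    "\<And>x. x \<in> mcar (tot C n) \<Longrightarrow> h (hclass C n x) = hclass D n (tot_map f n x)"
    using BC.quot_lift[OF BD.cmodule_quot lin zero] unfolding hclass_def by metis
  have cyc: "x \<in> mcar (tot C n)" if "x \<in> cycles C n" for x
    using that by (simp add: cycles_def)
  have ops: "madd (HC C n) (hclass C n x) (hclass C n y) = hclass C n (madd (tot C n) x y)"
    "msmult (HC C n) c (hclass C n x) = hclass C n (msmult (tot C n) c x)"
    if "x \<in> cycles C n" "y \<in> cycles C n" for x y c
    using that cyc by (simp_all add: C.HC_sel hclass_def BC.quot_add BC.quot_smult)
  let ?h = "restrict h (mcar (HC C n))"
  show ?thesis
  proof (rule ex1I[of _ ?h])
    have "klinear (HC C n) (HC D n) ?h"
    proof (rule klinearI)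
      fix X assume "X \<in> mcar (HC C n)"
      then obtain x where x: "x \<in> cycles C n" "X = hclass C n x" by (auto simp: C.HC_sel)
      then show "?h X \<in> mcar (HC D n)"
        by (auto simp: C.HC_sel D.HC_sel h(2) cyc tot_map_cycles)
      fix c
      have "msmult (HC C n) c X \<in> mcar (HC C n)"
        using x C.cycles_closed by (simp add: ops) (simp add: C.HC_sel)
      then show "?h (msmult (HC C n) c X) = msmult (HC D n) c (?h X)"
        using x cyc klinearD(3)[OF h(1)] by (simp add: C.HC_sel D.HC_sel hclass_def BC.quot_car)
      fix Y assume "Y \<in> mcar (HC C n)"
      then obtain y where y: "y \<in> cycles C n" "Y = hclass C n y" by (auto simp: C.HC_sel)
      have "madd (HC C n) X Y \<in> mcar (HC C n)"
        using x y C.cycles_closed by (simp add: ops) (simp add: C.HC_sel)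
      then show "?h (madd (HC C n) X Y) = madd (HC D n) (?h X) (?h Y)"
        using x y cyc klinearD(2)[OF h(1)] by (simp add: C.HC_sel D.HC_sel hclass_def BC.quot_car)
    qed
    then show "?h \<in> lin_maps (HC C n) (HC D n) \<and> (\<forall>x\<in>cycles C n. tot_map f n x \<in> cycles D n \<and>
        ?h (hclass C n x) = hclass D n (tot_map f n x))"
      by (auto simp: lin_maps_iff C.HC_sel h(2) cyc tot_map_cycles)
  next
    fix g assume g: "g \<in> lin_maps (HC C n) (HC D n) \<and> (\<forall>x\<in>cycles C n. tot_map f n x \<in> cycles D n \<and>
        g (hclass C n x) = hclass D n (tot_map f n x))"
    have "g X = ?h X" if "X \<in> mcar (HC C n)" for X
      using that g by (auto simp: C.HC_sel h(2) cyc)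
    then show "g = ?h"
      using g by (intro extensionalityI[OF _ restrict_extensional]) (auto simp: lin_maps_iff)
  qed
qed

end

section \<open>The cyclic modules of an algebra and of a Hopf algebra\<close>

text \<open>Translates the index formula of the inner faces into concatenation form, where slots and
  Sweedler sums can be split; \<open>split_two\<close> provides the splitting.\<close>

lemma take_drop_merge:
  "length ps = j \<Longrightarrow>
    take j (ps @ a # b # qs) @ ((ps @ a # b # qs) ! j * (ps @ a # b # qs) ! Suc j) # drop (j + 2) (ps @ a # b # qs)
    = ps @ a * b # qs"
  by (simp add: nth_append)

lemma split_two:
  assumes "Suc j < length xs"
  obtains ps a b qs where "xs = ps @ a # b # qs" "length ps = j"
proof -
  have "xs = take j xs @ xs ! j # xs ! Suc j # drop (Suc (Suc j)) xs"
    using assms id_take_nth_drop[of j xs] Cons_nth_drop_Suc[of "Suc j" xs] by simp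
  then show ?thesis
    using that[of "take j xs"] assms by simp
qed

text \<open>The mirror image of \<open>multilinear_SucI\<close>, suited to the last faces and to
  rotation, whose formulas single out \<open>last\<close>.\<close>

lemma multilinear_snocI:
  assumes "\<And>x. x \<in> mcar M \<Longrightarrow> multilinear M n P (\<lambda>xs. f (xs @ [x]))"
    "\<And>xs. xs \<in> tpow_gens M n \<Longrightarrow> klinear M P (\<lambda>x. f (xs @ [x]))"
  shows "multilinear M (Suc n) P f"
  unfolding multilinear_def
proof (intro conjI ballI allI impI)
  fix xs assume "xs \<in> tpow_gens M (Suc n)"
  then obtain y ys where "xs = ys @ [y]" "y \<in> mcar M" "ys \<in> tpow_gens M n"
    by (cases xs rule: rev_cases) (auto simp: tpow_gens_def)
  then show "f xs \<in> mcar P" using multilinear_closed[OF assms(1)] by blast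
next
  fix us vs
  assume *: "length us + length vs + 1 = Suc n" "set us \<subseteq> mcar M" "set vs \<subseteq> mcar M"
  show "klinear M P (\<lambda>x. f (us @ x # vs))"
  proof (cases vs rule: rev_cases)
    case Nil
    then show ?thesis using * assms(2)[of us] by (simp add: tpow_gens_def)
  next
    case (snoc ys y)
    then show ?thesis using * multilinear_slot[OF assms(1)[of y], of us ys] by simp
  qed
qed

context k_algebra
begin

lemma multilinear_prod_list: "multilinear (kmod_of scale) n (kmod_of scale) prod_list"
  unfolding multilinear_def
proof (intro conjI ballI allI impI)
  fix us vs
  show "klinear (kmod_of scale) (kmod_of scale) (\<lambda>x. prod_list (us @ x # vs))"
    using klinear_comp[OF klinear_times(1) klinear_times(2)] by (simp add: mult.assoc klinear_def
        distrib_left distrib_right scale_mult_right scale_mult_left)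
qed simp

text \<open>The varying slot lies before the merged pair, is its left or its right factor, or lies
  after it. The map required by \<open>multilinear_reshape\<close> is the identity outside the pair
  and multiplication by the partner inside.\<close>

lemma multilinear_merge:
  assumes f: "multilinear (kmod_of scale) (n - 1) P f" and j: "Suc j < n"
  shows "multilinear (kmod_of scale) n P (\<lambda>xs. f (take j xs @ (xs ! j * xs ! Suc j) # drop (j + 2) xs))"
proof (rule multilinear_reshape[OF f])
  let ?r = "\<lambda>xs. take j xs @ (xs ! j * xs ! Suc j) # drop (j + 2) xs"
  show "?r xs \<in> tpow_gens (kmod_of scale) (n - 1)" if "xs \<in> tpow_gens (kmod_of scale) n" for xs
    using that j by simp
  fix us vs :: "'a list" assume n: "length us + length vs + 1 = n"
  consider "length us < j" | "length us = j" | "length us = Suc j" | "Suc j < length us" by linarith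
  then show "\<exists>us' vs' \<phi>. length us' + length vs' + 1 = n - 1 \<and> set us' \<subseteq> mcar (kmod_of scale) \<and>
      set vs' \<subseteq> mcar (kmod_of scale) \<and> klinear (kmod_of scale) (kmod_of scale) \<phi> \<and>
      (\<forall>x. ?r (us @ x # vs) = us' @ \<phi> x # vs')"
  proof cases
    case 1
    then have "Suc (j - Suc (length us)) < length vs" using n j by linarith
    from split_two[OF this] obtain ps a b qs
      where vs: "vs = ps @ a # b # qs" "length ps = j - Suc (length us)" .
    have "?r (us @ x # vs) = us @ x # ps @ a * b # qs" for x
      using take_drop_merge[of "us @ x # ps" j a b qs] 1 vs by simp
    then show ?thesis
      using n vs 1 by (intro exI[of _ us] exI[of _ "ps @ a * b # qs"] exI[of _ "\<lambda>x. x"]) (simp add: klinear_ident)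
  next
    case 2
    then obtain b qs where vs: "vs = b # qs" using n j by (cases vs) auto
    have "?r (us @ x # vs) = us @ x * b # qs" for x
      using take_drop_merge[of us j x b qs] 2 vs by simp
    then show ?thesis
      using n vs by (intro exI[of _ us] exI[of _ qs] exI[of _ "\<lambda>x. x * b"]) (simp add: klinear_times)
  next
    case 3
    then obtain a ps where us: "us = ps @ [a]" by (cases us rule: rev_cases) auto
    have "?r (us @ x # vs) = ps @ a * x # vs" for x
      using take_drop_merge[of ps j a x vs] 3 us by simp
    then show ?thesis
      using n us by (intro exI[of _ ps] exI[of _ vs] exI[of _ "\<lambda>x. a * x"]) (simp add: klinear_times)
  next
    case 4
    from split_two[OF this] obtain ps a b qs where us: "us = ps @ a # b # qs" "length ps = j" .
    have "?r (us @ x # vs) = (ps @ a * b # qs) @ x # vs" for x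
      using take_drop_merge[of ps j a b "qs @ x # vs"] us by simp
    then show ?thesis
      using n us by (intro exI[of _ "ps @ a * b # qs"] exI[of _ vs] exI[of _ "\<lambda>x. x"]) (simp add: klinear_ident)
  qed
qed

lemma multilinear_last_merge:
  assumes f: "multilinear (kmod_of scale) (Suc m) P f"
  shows "multilinear (kmod_of scale) (Suc (Suc m)) P (\<lambda>xs. f ((last xs * hd xs) # butlast (tl xs)))"
proof (rule multilinear_SucI; simp)
  let ?K = "kmod_of scale"
  fix a
  \<comment> \<open>The branch \<open>xs = []\<close> stems from unfolding \<open>last\<close> on a
    \<open>Cons\<close>; it does not occur, as \<open>xs\<close> has length \<open>Suc m\<close>.
    The first and last entries are thus distinct slots, and the product is linear in each.\<close>
  show "multilinear ?K (Suc m) P (\<lambda>xs. f ((if xs = [] then a else last xs) * a # butlast xs))"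
  proof (rule multilinear_snocI; simp)
    fix b show "multilinear ?K m P (\<lambda>xs. f (b * a # xs))"
      using multilinear_SucD(1)[OF f] by simp
  next
    fix xs :: "'a list" assume "length xs = m"
    then show "klinear ?K P (\<lambda>b. f (b * a # xs))"
      using klinear_comp[OF klinear_times(2) multilinear_SucD(2)[OF f, of xs]] by simp
  qed
next
  let ?K = "kmod_of scale"
  fix xs :: "'a list" assume xs: "length xs = Suc m"
  then show "klinear ?K P (\<lambda>x. f ((if xs = [] then x else last xs) * x # butlast xs))"
    using klinear_comp[OF klinear_times(1) multilinear_SucD(2)[OF f, of "butlast xs"], of "last xs"]
    by (cases "xs = []") simp_all
qed

lemma multilinear_rotate:
  assumes f: "multilinear (kmod_of scale) (Suc m) P f"
  shows "multilinear (kmod_of scale) (Suc m) P (\<lambda>xs. f (last xs # butlast xs))"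
  by (rule multilinear_snocI) (simp_all add: multilinear_SucD[OF f])

sublocale K: cmodule "kmod_of scale"
  by (rule cmodule_kmod_of) (rule module_axioms)

sublocale T: tensor_power "kmod_of scale" n for n ..

lemma algebra_cyclic_sel:
  "obj (algebra_cyclic scale) n = tpow (kmod_of scale) (Suc n)"
  "face (algebra_cyclic scale) n i = tlift (kmod_of scale) (Suc n) (tpow (kmod_of scale) (Suc (n - 1)))
    (\<lambda>as. pure (kmod_of scale) (if i < n then take i as @ (as ! i * as ! Suc i) # drop (i + 2) as
      else (last as * hd as) # butlast (tl as)))"
  "cyc (algebra_cyclic scale) n = tlift (kmod_of scale) (Suc n) (tpow (kmod_of scale) (Suc n))
    (\<lambda>as. pure (kmod_of scale) (last as # butlast as))"
  by (simp_all add: algebra_cyclic_def Let_def)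

lemma algebra_face_multilinear:
  assumes "0 < n"
  shows "multilinear (kmod_of scale) (Suc n) (tpow (kmod_of scale) (Suc (n - 1)))
    (\<lambda>as. pure (kmod_of scale) (if i < n then take i as @ (as ! i * as ! Suc i) # drop (i + 2) as
      else (last as * hd as) # butlast (tl as)))"
proof (cases "i < n")
  case True
  then show ?thesis
    using assms multilinear_merge[of "Suc n" "tpow (kmod_of scale) n" "pure (kmod_of scale)" i] T.multilinear_pure by simp
next
  case False
  obtain m where "n = Suc m" using assms by (cases n) auto
  then show ?thesis
    using False multilinear_last_merge[OF T.multilinear_pure] by simp
qed

lemma cyclic_modules_algebra: "cyclic_modules (algebra_cyclic scale)"
proof (rule cyclic_modules.intro)
  fix n i :: nat
  show "cmodule (obj (algebra_cyclic scale) n)"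
    unfolding algebra_cyclic_sel by (rule T.T.cmodule_axioms)
  show "klinear (obj (algebra_cyclic scale) n) (obj (algebra_cyclic scale) n) (cyc (algebra_cyclic scale) n)"
    using T.tlift_lin_maps[OF T.T.cmodule_axioms multilinear_rotate[OF T.multilinear_pure]]
    unfolding algebra_cyclic_sel by (simp add: lin_maps_iff)
  assume "0 < n"
  from T.tlift_lin_maps[OF T.T.cmodule_axioms algebra_face_multilinear[OF this, of i]]
  show "klinear (obj (algebra_cyclic scale) n) (obj (algebra_cyclic scale) (n - 1)) (face (algebra_cyclic scale) n i)"
    unfolding algebra_cyclic_sel by (simp add: lin_maps_iff)
qed

end

section \<open>The cyclic module of the Hopf algebra, with all data of the theorem fixed\<close>

locale hopf_trace = hopf: hopf_algebra sH \<Delta> \<epsilon> S + comod: comodule_algebra sA sH \<Delta> \<epsilon> \<beta>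
  for sH :: "'k::comm_ring_1 \<Rightarrow> 'h::{ring,monoid_mult} \<Rightarrow> 'h" and \<Delta> \<epsilon> S
    and sA :: "'k \<Rightarrow> 'a::{ring,monoid_mult} \<Rightarrow> 'a" and \<beta> +
  fixes \<delta> :: "'h \<Rightarrow> 'k" and \<sigma> :: 'h and Tr :: "'a \<Rightarrow> 'k"
  assumes modular_pair: "modular_pair_in_involution sH \<Delta> \<epsilon> S \<delta> \<sigma>"
    and trace: "delta_trace sA sH \<beta> \<delta> Tr"
    and invariant: "sigma_invariant sA sH \<beta> S \<sigma> Tr"
begin

sublocale algebra_coaction sA sH \<beta>
  by unfold_locales (rule comod.coaction_algebra_map)

sublocale comodule sA sH \<Delta> \<beta>
  by unfold_locales
    (use hopf.comult_algebra_map comod.coaction_coassoc in \<open>simp_all add: tensor_algebra_map_def Let_def lin_maps_iff\<close>)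

abbreviation "K \<equiv> kmod_of ((*) :: 'k \<Rightarrow> 'k \<Rightarrow> 'k)"
abbreviation "HT n \<equiv> tpow H n"
abbreviation "CA \<equiv> algebra_cyclic sA"
abbreviation "CH \<equiv> hopf_cyclic sH \<Delta> \<epsilon> S \<delta> \<sigma>"

lemma klinear_Tr: "klinear A K Tr" and klinear_counit: "klinear H K \<epsilon>" and klinear_char: "klinear H K \<delta>"
  and klinear_S_sigma: "klinear H H (S_sigma S \<sigma>)"
proof -
  show "klinear A K Tr" using trace by (intro klinear_module_hom) (simp add: delta_trace_def)
  show "klinear H K \<epsilon>" using hopf.counit_character by (intro klinear_module_hom) (simp add: character_def)
  show "klinear H K \<delta>" using modular_pair by (intro klinear_module_hom) (simp add: modular_pair_in_involution_def character_def)
  show "klinear H H (S_sigma S \<sigma>)"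
    using klinear_comp[OF klinear_module_hom[OF hopf.antipode_linear] hopf.klinear_times(1)]
    by (simp add: S_sigma_def[abs_def])
qed

text \<open>The \<delta>-trace identity holds between scalars. Applying the linear map that sends
  \<open>k\<close> to \<open>msmult P k p\<close> moves it into the coefficient of a tensor
  \<open>p\<close>, as it occurs inside \<gamma>.\<close>

lemma sw_trace:
  assumes P: "cmodule P" and p: "p \<in> mcar P"
  shows "sw P c (\<lambda>x u. msmult P (Tr (b * x)) (msmult P (\<delta> u) p)) = msmult P (Tr (c * b)) p"
proof -
  interpret P: cmodule P by fact
  have "Tr (c * b) = sw K c (\<lambda>x u. Tr (b * x) * \<delta> u)"
    using trace unfolding delta_trace_def tsum_def msum_kmod_of by blast
  moreover have "klinear K P (\<lambda>k. msmult P k p)"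
    by (rule klinear_scalar[OF P _ p]) (rule klinear_ident)
  from tsum_map[OF cmodule_ground P this, of "\<lambda>x u. Tr (b * x) * \<delta> u" A H "\<beta> c"]
  have "msmult P (sw K c (\<lambda>x u. Tr (b * x) * \<delta> u)) p = sw P c (\<lambda>x u. msmult P (Tr (b * x) * \<delta> u) p)"
    by simp
  ultimately show ?thesis using p by simp
qed

lemma sw_counit:
  assumes P: "cmodule P" and f: "klinear A P f"
  shows "sw P a (\<lambda>x u. msmult P (\<epsilon> u) (f x)) = f a"
proof -
  have "sw A a (\<lambda>x u. sA (\<epsilon> u) x) = a"
    using comod.coaction_counit by (simp add: right_counital_def tsum_def)
  moreover have "f (sw A a (\<lambda>x u. sA (\<epsilon> u) x)) = sw P a (\<lambda>x u. f (sA (\<epsilon> u) x))"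
    by (rule tsum_map[OF comod.K.cmodule_axioms P f]) simp
  ultimately show ?thesis
    using klinearD(3)[OF f] by simp
qed

text \<open>The function \<open>f\<close> stands for a tensor expression in its single entry from
  \<open>H\<close>; the invariance identity in \<open>H\<close> is transported by applying
  \<open>f\<close>.\<close>

lemma sw_invariant:
  assumes P: "cmodule P" and f: "klinear H P f"
  shows "sw P b (\<lambda>y v. msmult P (Tr (a * y)) (f (S_sigma S \<sigma> v))) = sw P a (\<lambda>x u. msmult P (Tr (x * b)) (f u))"
proof -
  have "f (sw H b (\<lambda>y v. sH (Tr (a * y)) (S_sigma S \<sigma> v))) = sw P b (\<lambda>y v. f (sH (Tr (a * y)) (S_sigma S \<sigma> v)))"
    by (rule tsum_map[OF hopf.K.cmodule_axioms P f]) simp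
  moreover have "f (sw H a (\<lambda>x u. sH (Tr (x * b)) u)) = sw P a (\<lambda>x u. f (sH (Tr (x * b)) u))"
    by (rule tsum_map[OF hopf.K.cmodule_axioms P f]) simp
  moreover have "sw H a (\<lambda>x u. sH (Tr (x * b)) u) = sw H b (\<lambda>y v. sH (Tr (a * y)) (S_sigma S \<sigma> v))"
    using invariant unfolding sigma_invariant_def tsum_def msum_kmod_of by blast
  ultimately show ?thesis
    using klinearD(3)[OF f] by simp
qed

lemma hopf_cyclic_sel:
  "obj CH n = HT n"
  "face CH n i = tlift H n (HT (n - 1)) (\<lambda>hs. if i = 0 then msmult (HT (n - 1)) (\<epsilon> (hd hs)) (pure H (tl hs))
        else if i < n then pure H (take (i - 1) hs @ (hs ! (i - 1) * hs ! i) # drop (i + 1) hs)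
        else msmult (HT (n - 1)) (\<delta> (last hs)) (pure H (butlast hs)))"
  "cyc CH n = tlift H n (HT n) (hopf_tau sH \<Delta> S \<delta> \<sigma>)"
  by (simp_all add: hopf_cyclic_def Let_def)

lemma pure_closed: "length hs = n \<Longrightarrow> pure H hs \<in> mcar (HT n)"
  by (rule hopf.T.pure_closed) simp

lemma klinear_pure_Cons: "length hs = n \<Longrightarrow> klinear H (HT (Suc n)) (\<lambda>h. pure H (h # hs))"
  using multilinear_SucD(2)[OF hopf.T.multilinear_pure, of hs n] by simp

lemma multilinear_char_last:
  assumes "multilinear H n P f" "cmodule P"
  shows "multilinear H (Suc n) P (\<lambda>hs. msmult P (\<delta> (last hs)) (f (butlast hs)))"
  by (rule multilinear_snocI)
    (use multilinear_closed[OF assms(1)] in \<open>auto intro!: multilinear_comp[OF assms(1)] klinear_smult_id klinear_scalar klinear_char assms(2)\<close>)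

lemma hopf_face_multilinear:
  assumes "0 < n"
  shows "multilinear H n (HT (n - 1)) (\<lambda>hs. if i = 0 then msmult (HT (n - 1)) (\<epsilon> (hd hs)) (pure H (tl hs))
        else if i < n then pure H (take (i - 1) hs @ (hs ! (i - 1) * hs ! i) # drop (i + 1) hs)
        else msmult (HT (n - 1)) (\<delta> (last hs)) (pure H (butlast hs)))"
proof -
  obtain m where n: "n = Suc m" using assms by (cases n) auto
  \<comment> \<open>The inner face of index \<open>i\<close> multiplies the entries at positions
    \<open>i - 1\<close> and \<open>i\<close>, so \<open>i = Suc j\<close> gives a merge at
    \<open>j\<close> and \<open>Suc j\<close>.\<close>
  consider "i = 0" | j where "i = Suc j" "i < n" | "i \<noteq> 0" "n \<le> i"
    by (metis not_less not0_implies_Suc)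
  then show ?thesis
  proof cases
    case 1
    have "multilinear H (Suc m) (HT m) (\<lambda>hs. msmult (HT m) (\<epsilon> (hd hs)) (pure H (tl hs)))"
      by (rule multilinear_SucI)
        (auto intro!: multilinear_comp[OF hopf.T.multilinear_pure] klinear_smult_id klinear_scalar klinear_counit
          hopf.T.T.cmodule_axioms pure_closed)
    then show ?thesis using 1 n by simp
  next
    case 2
    then show ?thesis
      using n hopf.multilinear_merge[of n "HT m" "pure H" j] hopf.T.multilinear_pure by simp
  next
    case 3
    then show ?thesis
      using n multilinear_char_last[OF hopf.T.multilinear_pure hopf.T.T.cmodule_axioms] by simp
  qed
qed

text \<open>One summand of \<open>hopf_tau\<close>, with the first Sweedler components in
  \<open>vs\<close> and the second ones in \<open>ws\<close>, so that multilinearity can be checked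
  in each list separately.\<close>

definition tau_term :: "nat \<Rightarrow> 'h list \<Rightarrow> 'h list \<Rightarrow> ('h list \<Rightarrow>\<^sub>0 'k) set" where
  "tau_term n vs ws = msmult (HT n) (\<delta> (last ws)) (pure H (S_sigma S \<sigma> (prod_list vs) # butlast ws))"

lemma hopf_tau_eq:
  assumes "length hs = Suc m"
  shows "hopf_tau sH \<Delta> S \<delta> \<sigma> hs = D.swl (HT (Suc m)) hs (tau_term (Suc m))"
proof -
  \<comment> \<open>Exchanging \<open>last\<close> with \<open>map snd\<close> needs a nonempty
    selection.\<close>
  have "ps \<noteq> []" if "ps \<in> set (product_lists (map (\<lambda>h. sweedler H H (\<Delta> h)) hs))" for ps
    using in_set_product_lists_length[OF that] assms by auto
  then show ?thesis
    using assms unfolding hopf_tau_def tsums_def Let_def tau_term_def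
    by (auto simp: last_map map_butlast intro!: arg_cong[of _ _ "msum _"])
qed

lemma tau_term_multilinear:
  shows "length ws = Suc m \<Longrightarrow> multilinear H (Suc m) (HT (Suc m)) (\<lambda>vs. tau_term (Suc m) vs ws)"
    and "length vs = Suc m \<Longrightarrow> multilinear H (Suc m) (HT (Suc m)) (tau_term (Suc m) vs)"
proof -
  assume "length ws = Suc m"
  then have "klinear H (HT (Suc m)) (\<lambda>h. msmult (HT (Suc m)) (\<delta> (last ws)) (pure H (S_sigma S \<sigma> h # butlast ws)))"
    by (intro klinear_smult hopf.T.T.cmodule_axioms klinear_comp[OF klinear_S_sigma klinear_pure_Cons]) simp
  then show "multilinear H (Suc m) (HT (Suc m)) (\<lambda>vs. tau_term (Suc m) vs ws)"
    unfolding tau_term_def by (rule multilinear_comp[OF hopf.multilinear_prod_list])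
next
  show "multilinear H (Suc m) (HT (Suc m)) (tau_term (Suc m) vs)"
    unfolding tau_term_def
    using multilinear_SucD(1)[OF hopf.T.multilinear_pure]
    by (intro multilinear_char_last hopf.T.T.cmodule_axioms) simp
qed

lemma hopf_tau_multilinear: "multilinear H n (HT n) (hopf_tau sH \<Delta> S \<delta> \<sigma>)"
proof (cases n)
  case 0
  then show ?thesis by (simp add: multilinear_0 hopf_tau_def pure_closed)
next
  case (Suc m)
  have "multilinear H (Suc m) (HT (Suc m)) (\<lambda>hs. D.swl (HT (Suc m)) hs (tau_term (Suc m)))"
    by (intro D.multilinear_swl hopf.T.T.cmodule_axioms) (simp add: bimultilinear_def tau_term_multilinear)
  then show ?thesis
    unfolding Suc by (subst multilinear_cong[OF hopf_tau_eq])
qed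

lemma cyclic_modules_hopf: "cyclic_modules CH"
proof (rule cyclic_modules.intro)
  fix n i :: nat
  show "cmodule (obj CH n)"
    unfolding hopf_cyclic_sel by (rule hopf.T.T.cmodule_axioms)
  show "klinear (obj CH n) (obj CH n) (cyc CH n)"
    using hopf.T.tlift_lin_maps[OF hopf.T.T.cmodule_axioms hopf_tau_multilinear]
    unfolding hopf_cyclic_sel by (simp add: lin_maps_iff)
  assume "0 < n"
  from hopf.T.tlift_lin_maps[OF hopf.T.T.cmodule_axioms hopf_face_multilinear[OF this, of i]]
  show "klinear (obj CH n) (obj CH (n - 1)) (face CH n i)"
    unfolding hopf_cyclic_sel by (simp add: lin_maps_iff)
qed

end

section \<open>The characteristic map\<close>

context hopf_trace
begin

definition gamma_term :: "nat \<Rightarrow> 'a \<Rightarrow> 'a list \<Rightarrow> 'h list \<Rightarrow> ('h list \<Rightarrow>\<^sub>0 'k) set" where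
  "gamma_term n a xs us = msmult (HT n) (Tr (a * prod_list xs)) (pure H us)"

lemma gamma_pure_eq: "length as = n \<Longrightarrow> gamma_pure sA sH \<beta> Tr a as = swl (HT n) as (gamma_term n a)"
  by (simp add: gamma_pure_def tsums_def gamma_term_def Let_def)

lemma gamma_term_closed: "length us = n \<Longrightarrow> gamma_term n a xs us \<in> mcar (HT n)"
  unfolding gamma_term_def by (intro hopf.T.T.smult_closed pure_closed)

text \<open>Linearity has two sources. In the first entry it is that of the trace, all Sweedler
  lists being fixed; in the others the lists themselves vary and \<open>multilinear_swl\<close> is
  required.\<close>

lemma gamma_multilinear:
  "multilinear A (Suc n) (HT n) (\<lambda>as. gamma_pure sA sH \<beta> Tr (hd as) (tl as))"
proof -
  have T1: "klinear A K (\<lambda>x. Tr (a * x))" for a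
    by (rule klinear_comp[OF comod.klinear_times(1) klinear_Tr])
  have T2: "klinear A K (\<lambda>x. Tr (x * a))" for a
    by (rule klinear_comp[OF comod.klinear_times(2) klinear_Tr])
  have "multilinear A (Suc n) (HT n) (\<lambda>as. swl (HT n) (tl as) (gamma_term n (hd as)))"
  proof (rule multilinear_SucI)
    fix a
    have "bimultilinear A H n (HT n) (gamma_term n a)"
      unfolding bimultilinear_def gamma_term_def
      by (auto intro!: multilinear_scalar multilinear_comp[OF comod.multilinear_prod_list T1]
          multilinear_comp[OF hopf.T.multilinear_pure] klinear_smult_id hopf.T.T.cmodule_axioms pure_closed)
    then show "multilinear A n (HT n) (\<lambda>xs. swl (HT n) (tl (a # xs)) (gamma_term n (hd (a # xs))))"
      using multilinear_swl[OF hopf.T.T.cmodule_axioms] by simp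
  next
    fix as assume "as \<in> tpow_gens A n"
    then have "klinear A (HT n) (\<lambda>a. swl (HT n) as (gamma_term n a))"
      unfolding gamma_term_def
      by (intro klinear_tsums_param klinear_scalar hopf.T.T.cmodule_axioms T2 pure_closed) simp_all
    then show "klinear A (HT n) (\<lambda>x. swl (HT n) (tl (x # as)) (gamma_term n (hd (x # as))))"
      by simp
  qed
  then show ?thesis
    by (subst multilinear_cong[OF gamma_pure_eq]) simp_all
qed

lemma gamma_lin_maps: "gamma sA sH \<beta> Tr n \<in> lin_maps (obj CA n) (obj CH n)"
  unfolding gamma_def comod.algebra_cyclic_sel hopf_cyclic_sel
  by (rule comod.T.tlift_lin_maps[OF hopf.T.T.cmodule_axioms gamma_multilinear])

lemma gamma_pure_tensor:
  "length as = n \<Longrightarrow> gamma sA sH \<beta> Tr n (pure A (a # as)) = gamma_pure sA sH \<beta> Tr a as"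
  unfolding gamma_def
  by (subst comod.T.tlift_pure[OF hopf.T.T.cmodule_axioms gamma_multilinear]) simp_all

lemma gamma_pure_tensor':
  "length as = n \<Longrightarrow> gamma sA sH \<beta> Tr n (pure A (a # as)) = swl (HT n) as (gamma_term n a)"
  by (simp add: gamma_pure_tensor gamma_pure_eq)

lemma swl_singleton:
  assumes "cmodule P" "\<And>x u. F [x] [u] \<in> mcar P"
  shows "swl P [c] F = sw P c (\<lambda>x u. F [x] [u])"
proof -
  have "swl P [c] F = sw P c (\<lambda>x u. swl P [] (\<lambda>xs us. F (x # xs) (u # us)))"
    using assms by (intro tsums_Cons) (auto simp: length_Suc_conv)
  then show ?thesis
    by (simp add: tsums_Nil assms)
qed

lemma swl_snoc:
  assumes P: "cmodule P"
    and F: "\<And>xs us. length xs = Suc (length as) \<Longrightarrow> length us = Suc (length as) \<Longrightarrow> F xs us \<in> mcar P"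
  shows "swl P (as @ [c]) F = swl P as (\<lambda>xs us. sw P c (\<lambda>x u. F (xs @ [x]) (us @ [u])))"
proof -
  have "swl P (as @ [c]) F = swl P as (\<lambda>xs us. swl P [c] (\<lambda>ys vs. F (xs @ ys) (us @ vs)))"
    using F by (intro tsums_append P) simp
  also have "\<dots> = swl P as (\<lambda>xs us. sw P c (\<lambda>x u. F (xs @ [x]) (us @ [u])))"
    using F by (intro tsums_cong swl_singleton P) simp
  finally show ?thesis .
qed

text \<open>An operator on the Hopf side is linear, hence moves inside the Sweedler sum of \<gamma>
  and meets pure tensors, where its values are prescribed.\<close>

lemma tlift_gamma:
  assumes f: "multilinear H n P f" and P: "cmodule P" and as: "length as = n"
  shows "tlift H n P f (swl (HT n) as (gamma_term n a))
    = swl P as (\<lambda>xs us. msmult P (Tr (a * prod_list xs)) (f us))"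
proof -
  have g: "klinear (HT n) P (tlift H n P f)"
    using hopf.T.tlift_lin_maps[OF P f] by (simp add: lin_maps_iff)
  have "tlift H n P f (swl (HT n) as (gamma_term n a)) = swl P as (\<lambda>xs us. tlift H n P f (gamma_term n a xs us))"
    by (rule tsums_map[OF hopf.T.T.cmodule_axioms P g]) (simp add: as gamma_term_closed)
  also have "\<dots> = swl P as (\<lambda>xs us. msmult P (Tr (a * prod_list xs)) (f us))"
    by (rule tsums_cong) (simp add: gamma_term_def as klinearD(3)[OF g] pure_closed hopf.T.tlift_pure[OF P f])
  finally show ?thesis .
qed

lemma gamma_face_zero:
  assumes "length as = m"
  shows "swl (HT m) (a # as) (\<lambda>xs us. msmult (HT m) (Tr (a0 * prod_list xs)) (msmult (HT m) (\<epsilon> (hd us)) (pure H (tl us))))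
    = swl (HT m) as (gamma_term m (a0 * a))" (is "swl ?T _ ?F = _")
proof -
  note T = hopf.T.T.cmodule_axioms[of m]
  have "swl ?T (a # as) ?F = sw ?T a (\<lambda>x u. swl ?T as (\<lambda>xs us. ?F (x # xs) (u # us)))"
    using assms by (intro tsums_Cons T hopf.T.T.smult_closed pure_closed) simp
  \<comment> \<open>The sum over \<open>a\<close> becomes innermost, with everything else fixed, so
    that the counit axiom can contract it.\<close>
  also have "\<dots> = swl ?T as (\<lambda>xs us. sw ?T a (\<lambda>x u. ?F (x # xs) (u # us)))"
    using assms by (intro tsums_tsum_swap[symmetric] T hopf.T.T.smult_closed pure_closed) simp
  also have "\<dots> = swl ?T as (gamma_term m (a0 * a))"
  proof (rule tsums_cong)
    fix xs :: "'a list" and us :: "'h list"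
    assume "length us = length as"
    then have p: "pure H us \<in> mcar ?T" using assms by (intro pure_closed) simp
    have lin: "klinear A ?T (\<lambda>x. msmult ?T (Tr (a0 * (x * prod_list xs))) (pure H us))"
      by (intro klinear_scalar T p klinear_comp[OF comod.klinear_times(2)] klinear_comp[OF comod.klinear_times(1) klinear_Tr])
    show "sw ?T a (\<lambda>x u. ?F (x # xs) (u # us)) = gamma_term m (a0 * a) xs us"
      using sw_counit[OF T lin, of a] p by (simp add: gamma_term_def mult.assoc mult.commute[of "\<epsilon> _"])
  qed
  finally show ?thesis .
qed

text \<open>Splitting the list around the pair makes the sums over \<open>a\<close> and
  \<open>b\<close> adjacent. For a fixed selection on \<open>ps\<close>, \<open>sw_mult\<close>
  fuses them into one sum over \<open>a * b\<close>; the bilinear function it needs is the whole sum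
  over \<open>qs\<close>, seen in the merged slot.\<close>

lemma gamma_face_merge:
  assumes "length (ps @ a # b # qs) = Suc m"
  shows "swl (HT m) (ps @ a # b # qs) (\<lambda>xs us. msmult (HT m) (Tr (a0 * prod_list xs))
      (pure H (take (length ps) us @ (us ! length ps * us ! Suc (length ps)) # drop (length ps + 2) us)))
    = swl (HT m) (ps @ a * b # qs) (gamma_term m a0)" (is "swl ?T _ ?F = _")
proof -
  note T = hopf.T.T.cmodule_axioms[of m]
  have Fc: "?F xs us \<in> mcar ?T" if "length us = Suc m" for xs us
    using that assms by (intro hopf.T.T.smult_closed pure_closed) simp
  have F: "?F (xs @ x # y # ys) (us @ u # v # vs) = gamma_term m a0 (xs @ x * y # ys) (us @ u * v # vs)"
    if "length us = length ps" for xs us x y u v ys vs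
    using take_drop_merge[OF that, of u v vs] by (simp add: gamma_term_def mult.assoc)
  have G: "kbilinear A H ?T (\<lambda>x u. swl ?T qs (\<lambda>ys vs. gamma_term m a0 (xs @ x # ys) (us @ u # vs)))"
    if l: "length us = length ps" for xs us
  proof (rule kbilinearI)
    fix u
    have "klinear A K (\<lambda>x. Tr (a0 * prod_list (xs @ x # ys)))" for ys
    proof -
      have "klinear A K (\<lambda>x. Tr (a0 * (prod_list xs * (x * prod_list ys))))"
        by (intro klinear_comp[OF comod.klinear_times(2)] klinear_comp[OF comod.klinear_times(1)] klinear_Tr)
      then show ?thesis by simp
    qed
    then show "klinear A ?T (\<lambda>x. swl ?T qs (\<lambda>ys vs. gamma_term m a0 (xs @ x # ys) (us @ u # vs)))"
      unfolding gamma_term_def using l assms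
      by (intro klinear_tsums_param T klinear_scalar pure_closed) simp_all
  next
    fix x
    have "klinear H ?T (\<lambda>u. pure H (us @ u # vs))" if "length vs = length qs" for vs
      using l assms that by (intro multilinear_slot[OF hopf.T.multilinear_pure]) simp_all
    then show "klinear H ?T (\<lambda>u. swl ?T qs (\<lambda>ys vs. gamma_term m a0 (xs @ x # ys) (us @ u # vs)))"
      unfolding gamma_term_def by (intro klinear_tsums_param T klinear_smult) simp_all
  qed
  have "swl ?T (ps @ a # b # qs) ?F = swl ?T ps (\<lambda>xs us. swl ?T (a # b # qs) (\<lambda>ys vs. ?F (xs @ ys) (us @ vs)))"
    using assms by (intro tsums_append T Fc) simp
  also have "\<dots> = swl ?T ps (\<lambda>xs us. sw ?T a (\<lambda>x u. swl ?T (b # qs) (\<lambda>ys vs. ?F (xs @ x # ys) (us @ u # vs))))"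
    using assms by (intro tsums_cong tsums_Cons T Fc) simp
  also have "\<dots> = swl ?T ps (\<lambda>xs us. sw ?T a (\<lambda>x u. sw ?T b (\<lambda>y v. swl ?T qs (\<lambda>ys vs. ?F (xs @ x # y # ys) (us @ u # v # vs)))))"
    using assms by (intro tsums_cong arg_cong[of _ _ "sw ?T a"] ext tsums_Cons T Fc) simp
  also have "\<dots> = swl ?T ps (\<lambda>xs us. sw ?T a (\<lambda>x u. sw ?T b (\<lambda>y v. swl ?T qs (\<lambda>ys vs. gamma_term m a0 (xs @ x * y # ys) (us @ u * v # vs)))))"
    by (intro tsums_cong) (simp only: F)
  also have "\<dots> = swl ?T ps (\<lambda>xs us. sw ?T (a * b) (\<lambda>x u. swl ?T qs (\<lambda>ys vs. gamma_term m a0 (xs @ x # ys) (us @ u # vs))))"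
    by (intro tsums_cong) (simp only: sw_mult[OF T G])
  also have "\<dots> = swl ?T ps (\<lambda>xs us. swl ?T (a * b # qs) (\<lambda>ys vs. gamma_term m a0 (xs @ ys) (us @ vs)))"
    using assms by (intro tsums_cong tsums_Cons[symmetric] T gamma_term_closed) simp
  also have "\<dots> = swl ?T (ps @ a * b # qs) (gamma_term m a0)"
    using assms by (intro tsums_append[symmetric] T gamma_term_closed) simp
  finally show ?thesis .
qed

text \<open>With the sum over \<open>c\<close> innermost, the \<delta>-trace property for
  \<open>c\<close> and \<open>a0 * prod_list xs\<close> moves \<open>c\<close> to the front;
  reassociation gives the coefficient belonging to \<open>c * a0\<close>.\<close>

lemma gamma_face_last:
  assumes "length as = m"
  shows "swl (HT m) (as @ [c]) (\<lambda>xs us. msmult (HT m) (Tr (a0 * prod_list xs)) (msmult (HT m) (\<delta> (last us)) (pure H (butlast us))))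
    = swl (HT m) as (gamma_term m (c * a0))" (is "swl ?T _ ?F = _")
proof -
  note T = hopf.T.T.cmodule_axioms[of m]
  have "swl ?T (as @ [c]) ?F = swl ?T as (\<lambda>xs us. sw ?T c (\<lambda>x u. ?F (xs @ [x]) (us @ [u])))"
    using assms by (intro swl_snoc T hopf.T.T.smult_closed pure_closed) simp
  also have "\<dots> = swl ?T as (gamma_term m (c * a0))"
  proof (rule tsums_cong)
    fix xs :: "'a list" and us :: "'h list"
    assume "length us = length as"
    then have p: "pure H us \<in> mcar ?T" using assms by (intro pure_closed) simp
    show "sw ?T c (\<lambda>x u. ?F (xs @ [x]) (us @ [u])) = gamma_term m (c * a0) xs us"
      using sw_trace[OF T p, of c "a0 * prod_list xs"] by (simp add: gamma_term_def mult.assoc)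
  qed
  finally show ?thesis .
qed

lemma gamma_cyc:
  assumes "length as = m"
  shows "swl (HT (Suc m)) (as @ [c]) (\<lambda>xs us. msmult (HT (Suc m)) (Tr (a * prod_list xs)) (hopf_tau sH \<Delta> S \<delta> \<sigma> us))
    = swl (HT (Suc m)) (a # as) (gamma_term (Suc m) c)"
proof -
  let ?T = "HT (Suc m)" and ?as = "as @ [c]"
  note T = hopf.T.T.cmodule_axioms[of "Suc m"]
  have l: "length ?as = Suc m" using assms by simp
  have tc: "tau_term (Suc m) vs ws \<in> mcar ?T" if "length ws = Suc m" for vs ws
    unfolding tau_term_def using that by (intro hopf.T.T.smult_closed pure_closed) simp
  \<comment> \<open>A summand of \<tau> as a function of its front entry: \<open>tau_term\<close> is
    the value of \<open>?L ws\<close> at \<open>S_sigma S \<sigma> (prod_list vs)\<close>.\<close>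
  let ?L = "\<lambda>ws h. msmult ?T (\<delta> (last ws)) (pure H (h # butlast ws))"
  have L: "klinear H ?T (?L ws)" if "length ws = Suc m" for ws
    using that by (intro klinear_smult T klinear_pure_Cons) simp
  have Lc: "?L ws h \<in> mcar ?T" if "length ws = Suc m" for ws h
    using that by (intro hopf.T.T.smult_closed pure_closed) simp
  have tri: "trimultilinear (length ?as) ?T (\<lambda>xs vs ws. msmult ?T (Tr (a * prod_list xs)) (tau_term (Suc m) vs ws))"
    unfolding trimultilinear_def l
  proof (intro conjI allI impI)
    fix vs ws :: "'h list" assume "length ws = Suc m"
    then show "multilinear A (Suc m) ?T (\<lambda>xs. msmult ?T (Tr (a * prod_list xs)) (tau_term (Suc m) vs ws))"
      by (intro multilinear_scalar T tc multilinear_comp[OF comod.multilinear_prod_list]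
          klinear_comp[OF comod.klinear_times(1) klinear_Tr])
  qed (auto intro!: multilinear_comp[OF tau_term_multilinear(1)] multilinear_comp[OF tau_term_multilinear(2)]
      klinear_smult_id T)
  \<comment> \<open>For fixed \<open>ws\<close>, multiplicativity collects the sums over the factors
    into the coaction of \<open>prod_list xs\<close>. Invariance exchanges it for the coaction of
    \<open>a\<close>, whose component \<open>u\<close> in \<open>H\<close> takes the front
    slot.\<close>
  have inner: "swl ?T xs (\<lambda>ys vs. msmult ?T (Tr (a * prod_list ys)) (tau_term (Suc m) vs ws))
      = sw ?T a (\<lambda>x u. msmult ?T (Tr (x * prod_list xs)) (?L ws u))" if ws: "length ws = Suc m" for xs ws
  proof -
    have bil: "kbilinear A H ?T (\<lambda>y v. msmult ?T (Tr (a * y)) (?L ws (S_sigma S \<sigma> v)))"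
      using ws by (intro kbilinearI klinear_scalar T Lc klinear_comp[OF comod.klinear_times(1) klinear_Tr]
          klinear_smult klinear_comp[OF klinear_S_sigma] klinear_pure_Cons) simp_all
    show ?thesis
      unfolding tau_term_def sw_invariant[OF T L[OF ws], symmetric] by (rule sw_prod_list[OF T bil, symmetric])
  qed
  have "swl ?T ?as (\<lambda>xs us. msmult ?T (Tr (a * prod_list xs)) (hopf_tau sH \<Delta> S \<delta> \<sigma> us))
      = swl ?T ?as (\<lambda>xs us. D.swl ?T us (\<lambda>vs ws. msmult ?T (Tr (a * prod_list xs)) (tau_term (Suc m) vs ws)))"
  proof (rule tsums_cong)
    fix xs :: "'a list" and us :: "'h list"
    assume "length us = length ?as"
    then have us: "length us = Suc m" using l by simp
    show "msmult ?T (Tr (a * prod_list xs)) (hopf_tau sH \<Delta> S \<delta> \<sigma> us)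
        = D.swl ?T us (\<lambda>vs ws. msmult ?T (Tr (a * prod_list xs)) (tau_term (Suc m) vs ws))"
      unfolding hopf_tau_eq[OF us] by (rule tsums_map[OF T T klinear_smult_id[OF T]]) (simp add: tc us)
  qed
  also have "\<dots> = swl ?T ?as (\<lambda>xs ws. swl ?T xs (\<lambda>ys vs. msmult ?T (Tr (a * prod_list ys)) (tau_term (Suc m) vs ws)))"
    by (rule swl_coassoc[OF T tri])
  also have "\<dots> = swl ?T ?as (\<lambda>xs ws. sw ?T a (\<lambda>x u. msmult ?T (Tr (x * prod_list xs)) (?L ws u)))"
    by (rule tsums_cong) (rule inner, simp add: l assms)
  \<comment> \<open>The coaction of \<open>a\<close> involves neither \<open>xs\<close> nor
    \<open>ws\<close>; outside, its sum is in the place of the head of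
    \<open>a # as\<close>.\<close>
  also have "\<dots> = sw ?T a (\<lambda>x u. swl ?T ?as (\<lambda>xs ws. msmult ?T (Tr (x * prod_list xs)) (?L ws u)))"
    by (rule tsums_tsum_swap[OF T]) (intro hopf.T.T.smult_closed pure_closed, simp add: assms)
  also have "\<dots> = sw ?T a (\<lambda>x u. swl ?T as (\<lambda>xs us. gamma_term (Suc m) c (x # xs) (u # us)))"
  proof (intro arg_cong[of _ _ "sw ?T a"] ext)
    fix x u
    \<comment> \<open>The last entry of \<open>ws\<close> is the one coming from \<open>c\<close>,
      and it occurs only under \<delta>. With the sum over \<open>c\<close> innermost,
      \<open>sw_trace\<close> applies to it.\<close>
    have "swl ?T ?as (\<lambda>xs ws. msmult ?T (Tr (x * prod_list xs)) (?L ws u))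
        = swl ?T as (\<lambda>xs us. sw ?T c (\<lambda>y w. msmult ?T (Tr (x * prod_list (xs @ [y]))) (?L (us @ [w]) u)))"
      using assms by (intro swl_snoc T hopf.T.T.smult_closed Lc) simp
    also have "\<dots> = swl ?T as (\<lambda>xs us. gamma_term (Suc m) c (x # xs) (u # us))"
    proof (rule tsums_cong)
      fix xs :: "'a list" and us :: "'h list"
      assume "length us = length as"
      then have p: "pure H (u # us) \<in> mcar ?T" using assms by (intro pure_closed) simp
      show "sw ?T c (\<lambda>y w. msmult ?T (Tr (x * prod_list (xs @ [y]))) (?L (us @ [w]) u))
          = gamma_term (Suc m) c (x # xs) (u # us)"
        using sw_trace[OF T p, of c "x * prod_list xs"] by (simp add: gamma_term_def mult.assoc)
    qed
    finally show "swl ?T ?as (\<lambda>xs ws. msmult ?T (Tr (x * prod_list xs)) (?L ws u))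
        = swl ?T as (\<lambda>xs us. gamma_term (Suc m) c (x # xs) (u # us))" .
  qed
  also have "\<dots> = swl ?T (a # as) (gamma_term (Suc m) c)"
    using assms by (intro tsums_Cons[symmetric] T gamma_term_closed) simp
  finally show ?thesis .
qed

text \<open>Both sides of each identity are linear on a tensor power, so pure tensors suffice; there
  \<open>tlift_gamma\<close> reduces the claim to the Sweedler identities for the faces and for
  \<tau>.\<close>

lemma cyclic_morphism_gamma: "cyclic_morphism CA CH (gamma sA sH \<beta> Tr)"
proof (intro cyclic_morphism.intro cyclic_morphism_axioms.intro comod.cyclic_modules_algebra cyclic_modules_hopf)
  interpret CA: cyclic_modules CA by (rule comod.cyclic_modules_algebra)
  interpret CH: cyclic_modules CH by (rule cyclic_modules_hopf)
  let ?g = "gamma sA sH \<beta> Tr"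
  show lin: "klinear (obj CA n) (obj CH n) (?g n)" for n
    using gamma_lin_maps by (simp add: lin_maps_iff)
  show "?g n (cyc CA n t) = cyc CH n (?g n t)" if t: "t \<in> mcar (obj CA n)" for n t
  proof (rule comod.T.tpow_klinear_eq[OF CH.cmodule_obj])
    show "klinear (tpow A (Suc n)) (obj CH n) (\<lambda>t. ?g n (cyc CA n t))"
      "klinear (tpow A (Suc n)) (obj CH n) (\<lambda>t. cyc CH n (?g n t))"
      using klinear_comp[OF CA.cyc_linear lin] klinear_comp[OF lin CH.cyc_linear]
      by (simp_all add: comod.algebra_cyclic_sel(1))
    show "t \<in> mcar (tpow A (Suc n))" using t by (simp add: comod.algebra_cyclic_sel(1))
    fix as assume as: "as \<in> tpow_gens A (Suc n)"
    have cycA: "cyc CA n (pure A as) = pure A (last as # butlast as)"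
      unfolding comod.algebra_cyclic_sel
      by (rule comod.T.tlift_pure[OF comod.T.T.cmodule_axioms comod.multilinear_rotate[OF comod.T.multilinear_pure] as])
    obtain a bs where a: "as = a # bs" "length bs = n" using as by (cases as) auto
    have cycH: "cyc CH n (?g n (pure A as))
        = swl (HT n) bs (\<lambda>xs us. msmult (HT n) (Tr (a * prod_list xs)) (hopf_tau sH \<Delta> S \<delta> \<sigma> us))"
      unfolding hopf_cyclic_sel a gamma_pure_tensor'[OF a(2)]
      by (rule tlift_gamma[OF hopf_tau_multilinear hopf.T.T.cmodule_axioms a(2)])
    show "?g n (cyc CA n (pure A as)) = cyc CH n (?g n (pure A as))"
    proof (cases n)
      \<comment> \<open>There is no last entry to split off: \<open>hopf_tau\<close> has a separate
        clause for the empty list, and rotation fixes a list of length one.\<close>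
      case 0
      then show ?thesis
        unfolding cycA cycH using a by (simp add: gamma_pure_tensor' tsums_Nil[OF hopf.T.T.cmodule_axioms]
            gamma_term_def pure_closed hopf_tau_def)
    next
      case (Suc m)
      then obtain cs c where bs: "bs = cs @ [c]" "length cs = m"
        using a by (cases bs rule: rev_cases) auto
      show ?thesis
        unfolding cycA cycH using gamma_cyc[OF bs(2), of c a] a bs Suc by (simp add: gamma_pure_tensor')
    qed
  qed
  show "?g (n - 1) (face CA n i t) = face CH n i (?g n t)"
    if n: "0 < n" and i: "i \<le> n" and t: "t \<in> mcar (obj CA n)" for n i t
  proof (rule comod.T.tpow_klinear_eq[OF CH.cmodule_obj])
    show "klinear (tpow A (Suc n)) (obj CH (n - 1)) (\<lambda>t. ?g (n - 1) (face CA n i t))"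
      "klinear (tpow A (Suc n)) (obj CH (n - 1)) (\<lambda>t. face CH n i (?g n t))"
      using klinear_comp[OF CA.face_linear[OF n i] lin] klinear_comp[OF lin CH.face_linear[OF n i]]
      by (simp_all add: comod.algebra_cyclic_sel(1))
    show "t \<in> mcar (tpow A (Suc n))" using t by (simp add: comod.algebra_cyclic_sel(1))
    fix as assume as: "as \<in> tpow_gens A (Suc n)"
    obtain m where m: "n = Suc m" using n by (cases n) auto
    \<comment> \<open>\<open>remdups_adj.cases\<close> serves as a case rule separating lists of
      length zero, one and at least two.\<close>
    obtain a b cs where a: "as = a # b # cs" "length cs = m"
      using as m by (cases as rule: remdups_adj.cases) auto
    have l: "length (b # cs) = n" using a m by simp
    note faceA = comod.T.tlift_pure[OF comod.T.T.cmodule_axioms comod.algebra_face_multilinear[OF n] as, of i]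
    note faceH = tlift_gamma[OF hopf_face_multilinear[OF n] hopf.T.T.cmodule_axioms l, of i a]
    note unf = comod.algebra_cyclic_sel hopf_cyclic_sel faceA
    have gas: "?g n (pure A as) = swl (HT n) (b # cs) (gamma_term n a)"
      using gamma_pure_tensor'[OF l] a by simp
    consider "i = 0" | j where "i = Suc j" "i < n" | "i = n" "i \<noteq> 0"
      using i by (metis le_neq_implies_less not0_implies_Suc)
    then show "?g (n - 1) (face CA n i (pure A as)) = face CH n i (?g n (pure A as))"
    proof cases
      case 1
      then show ?thesis
        unfolding unf gas faceH using gamma_face_zero[OF a(2), of b a] a m
        by (simp add: gamma_pure_tensor')
    next
      case (2 j)
      have "Suc j < length (b # cs)" using 2 l by simp
      from split_two[OF this] obtain ps x y qs where s: "b # cs = ps @ x # y # qs" "length ps = j" .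
      \<comment> \<open>Because \<open>a\<close> precedes the tail \<open>b # cs\<close>, the
        positions \<open>i\<close> and \<open>Suc i\<close> of \<open>as\<close> are
        \<open>j\<close> and \<open>Suc j\<close> in the tail, the same pair that the face on the
        Hopf side merges.\<close>
      have "take i as @ (as ! i * as ! Suc i) # drop (i + 2) as = a # ps @ x * y # qs"
        using take_drop_merge[OF s(2), of x y qs] s a 2 by simp
      moreover have "length (ps @ x # y # qs) = Suc m" using l m s by simp
      ultimately show ?thesis
        unfolding unf gas faceH using gamma_face_merge[of ps x y qs m a] 2 s m
        by (simp add: gamma_pure_tensor')
    next
      case 3
      obtain ds d where d: "b # cs = ds @ [d]" "length ds = m"
        using l m by (cases "b # cs" rule: rev_cases) auto
      have "(last as * hd as) # butlast (tl as) = (d * a) # ds"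
        using a d by (metis butlast_snoc last_ConsR last_snoc list.distinct(1) list.sel(1) list.sel(3))
      then show ?thesis
        unfolding unf gas faceH using gamma_face_last[OF d(2), of d a] 3 d m
        by (simp add: gamma_pure_tensor')
    qed
  qed
qed

end

theorem corollary3p1:
  fixes sH :: "'k::comm_ring_1 \<Rightarrow> 'h::{ring,monoid_mult} \<Rightarrow> 'h"
    and \<Delta> :: "'h \<Rightarrow> ('h \<times> 'h \<Rightarrow>\<^sub>0 'k) set"
    and \<epsilon> :: "'h \<Rightarrow> 'k"
    and S :: "'h \<Rightarrow> 'h"
    and \<delta> :: "'h \<Rightarrow> 'k"
    and \<sigma> :: 'h
    and sA :: "'k \<Rightarrow> 'a::{ring,monoid_mult} \<Rightarrow> 'a"
    and \<beta> :: "'a \<Rightarrow> ('a \<times> 'h \<Rightarrow>\<^sub>0 'k) set"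
    and Tr :: "'a \<Rightarrow> 'k"
  defines "\<gamma> \<equiv> gamma sA sH \<beta> Tr"
    and "CA \<equiv> algebra_cyclic sA"
    and "CH \<equiv> hopf_cyclic sH \<Delta> \<epsilon> S \<delta> \<sigma>"
  assumes "hopf_algebra sH \<Delta> \<epsilon> S"
    and "modular_pair_in_involution sH \<Delta> \<epsilon> S \<delta> \<sigma>"
    and "comodule_algebra sA sH \<Delta> \<epsilon> \<beta>"
    and "delta_trace sA sH \<beta> \<delta> Tr"
    and "sigma_invariant sA sH \<beta> S \<sigma> Tr"
  shows "\<forall>n. \<gamma> n \<in> lin_maps (obj CA n) (obj CH n) \<and>
           (\<forall>a0 as. length as = n \<longrightarrow>
              \<gamma> n (pure (kmod_of sA) (a0 # as)) = gamma_pure sA sH \<beta> Tr a0 as) \<and>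
           (\<exists>!\<gamma>s. \<gamma>s \<in> lin_maps (HC CA n) (HC CH n) \<and>
              (\<forall>x\<in>cycles CA n. tot_map \<gamma> n x \<in> cycles CH n \<and>
                 \<gamma>s (hclass CA n x) = hclass CH n (tot_map \<gamma> n x)))"
proof -
  interpret hopf_trace sH \<Delta> \<epsilon> S sA \<beta> \<delta> \<sigma> Tr
    using assms(4-8) by (intro hopf_trace.intro hopf_trace_axioms.intro)
  show ?thesis
    unfolding \<gamma>_def CA_def CH_def
    by (intro allI conjI impI gamma_lin_maps gamma_pure_tensor cyclic_morphism.ex1_homology_map[OF cyclic_morphism_gamma])
qed

end
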